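(* For every $\vec\kappa=(\kappa_1,\kappa_2)\in\mathbb{C}^2$, $$\lim_{L\to\infty}\frac{\mathbb{E}\Big[\exp\Big(\vec\kappa\circ\big\langle -f_L\mid\log\zeta^{\mathsf{rand}}(1/2+0+ix)\big\rangle\Big)\Big]}{\mathbb{E}\Big[\exp\Big(\vec\kappa\circ\big\langle -f_L\mid\log Z^{\mathsf{Gauss}}(e^{-ix-0})\big\rangle\Big)\Big]}=a(\vec\kappa),$$ where $$a(\vec\kappa)=\prod_p\Big\{(1-p^{-1})^{\kappa_1\kappa_2}\sum_{m=0}^\infty\frac{\Gamma(\kappa_1+m)}{m!\,\Gamma(\kappa_1)}\frac{\Gamma(\kappa_2+m)}{m!\,\Gamma(\kappa_2)}p^{-m}\Big\}.$$
   Context: Notation. $\vec\kappa\circ\lambda=\kappa_1\lambda+\kappa_2\overline\lambda$ for $\lambda\in\mathbb{C}$; $f_L(z)=\sqrt{L/(2\pi)}\exp(-Lz^2/2)$ for $L>0$; $p$ runs over primes; $\Gamma(\kappa+m)/\Gamma(\kappa)$ means $\kappa(\kappa+1)\cdots(\kappa+m-1)$. Fourier hyperfunctions. For $\delta>0$ let $D_\delta=\{z\in\mathbb{C}:|\mathrm{Im}\,z|<\delta\}$. $\mathfrak P_\delta$ is the space of holomorphic $f$ on $D_\delta$ with $\sup_{|\mathrm{Im} z|\le\delta_1}|f(z)|e^{-\epsilon|z|}<\infty$ for all $\epsilon>0$, $0<\delta_1<\delta$. $\widetilde{\mathfrak P}_\delta$ is the space of holomorphic $\varphi$ on $D_\delta\setminus\mathbb{R}$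 with $\sup_{\delta_1\le|\mathrm{Im} z|\le\delta_2}|\varphi(z)|e^{-\epsilon|z|}<\infty$ for all $\epsilon>0$, $0<\delta_1<\delta_2<\delta$. $\mathfrak Q=\varinjlim\widetilde{\mathfrak P}_\delta/\mathfrak P_\delta$ (under restriction to smaller $\delta$); $[\varphi]$ denotes the class of $\varphi$. $\mathfrak P^*$ is the space of functions $f$ holomorphic on some $D_\delta$ such that for each $0<\delta_1<\delta$ there is $\epsilon>0$ with $\sup_{|\mathrm{Im} z|\le\delta_1}|f(z)|e^{\epsilon|z|}<\infty$; $f_L\in\mathfrak P^*$. For $f\in\mathfrak P^*$ and $g=[\varphi]\in\mathfrak Q$, $\langle f\mid g\rangle=\int_{-\infty+ic}^{\infty+ic}f\varphi\,dz-\int_{-\infty-ic}^{\infty-ic}f\varphi\,dz$ for any sufficiently small $c>0$. The random hyperfunctions. Let $(\mathsf X(p))_p$ be independent random variables uniformly distributed on the unit circle, and $\log\zeta^{\mathsf{rand}}(s)=\sum_p\sum_{k\ge1}\frac1k\mathsf X(p)^kp^{-ks}$ (sum over $p$ in increasing order), almost surely holomorphic on $\mathrm{Re}(s)>1/2$. Almost surely $\varphi^{\mathsf{rand}}(z)=0$ for $0<\mathrm{Im} z<1/2$, $=\log\zeta^{\mathsf{rand}}(1/2+iz)$ for $-1/2<\mathrm{Im} z<0$, lies in $\widetilde{\mathfrak P}_{1/2}$, and $\log\zeta^{\mathsf{rand}}(1/2+0+ix):=[\varphi^{\mathsf{rand}}]$. Let $(\mathsf W(k))_{k\ge1}$ be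 independent standard complex Gaussian random variables ($\mathbb{E}|\mathsf W(k)|^2=1$) and $\log Z^{\mathsf{Gauss}}(s)=\sum_{k\ge1}\frac1{\sqrt k}\mathsf W(k)s^k$, almost surely holomorphic on $|s|<1$. Almost surely $\varphi^{\mathsf{Gauss}}(z)=0$ for $0<\mathrm{Im} z<1$, $=\log Z^{\mathsf{Gauss}}(e^{-iz})$ for $-1<\mathrm{Im} z<0$, lies in $\widetilde{\mathfrak P}_1$, and $\log Z^{\mathsf{Gauss}}(e^{-ix-0}):=[\varphi^{\mathsf{Gauss}}]$. Thus, for small $c>0$, $\langle -f_L\mid\log\zeta^{\mathsf{rand}}(1/2+0+ix)\rangle=\int_{-\infty-ic}^{\infty-ic}f_L(z)\log\zeta^{\mathsf{rand}}(1/2+iz)\,dz$ and $\langle -f_L\mid\log Z^{\mathsf{Gauss}}(e^{-ix-0})\rangle=\int_{-\infty-ic}^{\infty-ic}f_L(z)\log Z^{\mathsf{Gauss}}(e^{-iz})\,dz$. *)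

theory Defs
  imports "HOL-Probability.Probability" "HOL-Complex_Analysis.Complex_Analysis"
begin

section \<open>Fourier hyperfunctions\<close>

definition strip :: "real \<Rightarrow> complex set" where
  "strip \<delta> = {z. \<bar>Im z\<bar> < \<delta>}"

text \<open>
  The function spaces consist of total functions; only the values on the respective domain
  (\<open>strip \<delta>\<close> or \<open>strip \<delta> - \<real>\<close>) are constrained, so that restriction to a smaller strip is
  the identity on representatives.
\<close>

definition P_space :: "real \<Rightarrow> (complex \<Rightarrow> complex) set" where
  "P_space \<delta> = {f. f holomorphic_on strip \<delta> \<and>
     (\<forall>\<epsilon>>0. \<forall>\<delta>1. 0 < \<delta>1 \<and> \<delta>1 < \<delta> \<longrightarrow>
        bdd_above ((\<lambda>z. norm (f z) * exp (- \<epsilon> * norm z)) ` {z. \<bar>Im z\<bar> \<le> \<delta>1}))}"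

definition P_tilde :: "real \<Rightarrow> (complex \<Rightarrow> complex) set" where
  "P_tilde \<delta> = {\<phi>. \<phi> holomorphic_on (strip \<delta> - \<real>) \<and>
     (\<forall>\<epsilon>>0. \<forall>\<delta>1 \<delta>2. 0 < \<delta>1 \<and> \<delta>1 < \<delta>2 \<and> \<delta>2 < \<delta> \<longrightarrow>
        bdd_above ((\<lambda>z. norm (\<phi> z) * exp (- \<epsilon> * norm z)) ` {z. \<delta>1 \<le> \<bar>Im z\<bar> \<and> \<bar>Im z\<bar> \<le> \<delta>2}))}"

definition P_star :: "(complex \<Rightarrow> complex) set" where
  "P_star = {f. \<exists>\<delta>>0. f holomorphic_on strip \<delta> \<and>
     (\<forall>\<delta>1. 0 < \<delta>1 \<and> \<delta>1 < \<delta> \<longrightarrow>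
        (\<exists>\<epsilon>>0. bdd_above ((\<lambda>z. norm (f z) * exp (\<epsilon> * norm z)) ` {z. \<bar>Im z\<bar> \<le> \<delta>1})))}"

text \<open>
  The direct limit of the quotients \<open>P_tilde \<delta> / P_space \<delta>\<close> is realised as a quotient of the
  disjoint union of the \<open>P_tilde \<delta>\<close>: two representatives are identified if, on some common
  smaller strip, they differ by an element of \<open>P_space\<close>.
\<close>

definition hyper_reps :: "(real \<times> (complex \<Rightarrow> complex)) set" where
  "hyper_reps = {(\<delta>, \<phi>). 0 < \<delta> \<and> \<phi> \<in> P_tilde \<delta>}"

definition hyper_rel :: "((real \<times> (complex \<Rightarrow> complex)) \<times> (real \<times> (complex \<Rightarrow> complex))) set" where
  "hyper_rel = {((\<delta>, \<phi>), (\<delta>', \<phi>')). (\<delta>, \<phi>) \<in> hyper_reps \<and> (\<delta>', \<phi>') \<in> hyper_reps \<and>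
     (\<exists>\<eta>>0. \<eta> \<le> \<delta> \<and> \<eta> \<le> \<delta>' \<and>
        (\<exists>h \<in> P_space \<eta>. \<forall>z \<in> strip \<eta> - \<real>. \<phi> z - \<phi>' z = h z))}"

definition fourier_hyperfunctions :: "(real \<times> (complex \<Rightarrow> complex)) set set" where
  "fourier_hyperfunctions = hyper_reps // hyper_rel"

definition hyper_class :: "real \<Rightarrow> (complex \<Rightarrow> complex) \<Rightarrow> (real \<times> (complex \<Rightarrow> complex)) set" where
  "hyper_class \<delta> \<phi> = hyper_rel `` {(\<delta>, \<phi>)}"

lemma P_space_mono:
  assumes "f \<in> P_space \<delta>" "\<eta> \<le> \<delta>"
  shows "f \<in> P_space \<eta>"
proof -
  have "strip \<eta> \<subseteq> strip \<delta>" using assms(2) by (auto simp: strip_def)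
  then show ?thesis
    using assms by (auto simp: P_space_def intro: holomorphic_on_subset)
qed

lemma P_space_zero: "(\<lambda>_. 0) \<in> P_space \<delta>"
  by (auto simp: P_space_def)

lemma P_space_uminus:
  assumes "f \<in> P_space \<delta>"
  shows "(\<lambda>z. - f z) \<in> P_space \<delta>"
  using assms by (auto simp: P_space_def intro!: holomorphic_intros)

lemma P_space_add:
  assumes "f \<in> P_space \<delta>" "g \<in> P_space \<delta>"
  shows "(\<lambda>z. f z + g z) \<in> P_space \<delta>"
proof -
  have "bdd_above ((\<lambda>z. norm (f z + g z) * exp (- \<epsilon> * norm z)) ` {z. \<bar>Im z\<bar> \<le> \<delta>1})"
    if "\<epsilon> > 0" "0 < \<delta>1" "\<delta>1 < \<delta>" for \<epsilon> \<delta>1 :: real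
  proof -
    have "bdd_above ((\<lambda>z. norm (f z) * exp (- \<epsilon> * norm z)) ` {z. \<bar>Im z\<bar> \<le> \<delta>1})"
      using assms(1) that by (auto simp: P_space_def)
    then obtain A where A: "\<And>z. \<bar>Im z\<bar> \<le> \<delta>1 \<Longrightarrow> norm (f z) * exp (- \<epsilon> * norm z) \<le> A"
      by (auto simp: bdd_above_def)
    have "bdd_above ((\<lambda>z. norm (g z) * exp (- \<epsilon> * norm z)) ` {z. \<bar>Im z\<bar> \<le> \<delta>1})"
      using assms(2) that by (auto simp: P_space_def)
    then obtain B where B: "\<And>z. \<bar>Im z\<bar> \<le> \<delta>1 \<Longrightarrow> norm (g z) * exp (- \<epsilon> * norm z) \<le> B"
      by (auto simp: bdd_above_def)
    have "norm (f z + g z) * exp (- \<epsilon> * norm z) \<le> A + B" if "\<bar>Im z\<bar> \<le> \<delta>1" for z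
    proof -
      have "norm (f z + g z) * exp (- \<epsilon> * norm z)
          \<le> (norm (f z) + norm (g z)) * exp (- \<epsilon> * norm z)"
        by (intro mult_right_mono norm_triangle_ineq) auto
      with A[OF that] B[OF that] show ?thesis
        by (simp add: distrib_right)
    qed
    then show ?thesis by (auto simp: bdd_above_def)
  qed
  then show ?thesis
    using assms by (auto simp: P_space_def intro!: holomorphic_intros)
qed

lemma equiv_hyper_rel: "equiv hyper_reps hyper_rel"
proof (rule equivI)
  show "hyper_rel \<subseteq> hyper_reps \<times> hyper_reps"
    by (auto simp: hyper_rel_def)
  show "refl_on hyper_reps hyper_rel"
  proof (rule refl_onI)
    fix x assume x: "x \<in> hyper_reps"
    obtain \<delta> \<phi> where [simp]: "x = (\<delta>, \<phi>)" by (cases x)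
    have "\<delta> > 0" using x by (simp add: hyper_reps_def)
    then show "(x, x) \<in> hyper_rel"
      using x P_space_zero[of \<delta>] by (auto simp: hyper_rel_def intro!: exI[of _ \<delta>])
  qed
  show "sym hyper_rel"
  proof (rule symI)
    fix x y assume "(x, y) \<in> hyper_rel"
    moreover obtain \<delta> \<phi> where [simp]: "x = (\<delta>, \<phi>)" by (cases x)
    moreover obtain \<delta>' \<psi> where [simp]: "y = (\<delta>', \<psi>)" by (cases y)
    ultimately obtain \<eta> h where r: "(\<delta>, \<phi>) \<in> hyper_reps" "(\<delta>', \<psi>) \<in> hyper_reps"
      and \<eta>: "\<eta> > 0" "\<eta> \<le> \<delta>" "\<eta> \<le> \<delta>'" and h: "h \<in> P_space \<eta>"
      and eq: "\<And>z. z \<in> strip \<eta> - \<real> \<Longrightarrow> \<phi> z - \<psi> z = h z"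
      by (auto simp: hyper_rel_def)
    have "\<forall>z \<in> strip \<eta> - \<real>. \<psi> z - \<phi> z = - h z"
      using eq by (metis minus_diff_eq)
    then have "\<exists>h \<in> P_space \<eta>. \<forall>z \<in> strip \<eta> - \<real>. \<psi> z - \<phi> z = h z"
      using P_space_uminus[OF h] by (rule bexI)
    with r \<eta> show "(y, x) \<in> hyper_rel"
      unfolding hyper_rel_def by auto
  qed
  show "trans hyper_rel"
  proof (rule transI)
    fix x y w assume "(x, y) \<in> hyper_rel" "(y, w) \<in> hyper_rel"
    moreover obtain \<delta>1 \<phi>1 where [simp]: "x = (\<delta>1, \<phi>1)" by (cases x)
    moreover obtain \<delta>2 \<phi>2 where [simp]: "y = (\<delta>2, \<phi>2)" by (cases y)
    moreover obtain \<delta>3 \<phi>3 where [simp]: "w = (\<delta>3, \<phi>3)" by (cases w)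
    ultimately obtain \<eta> h \<eta>' h' where r: "(\<delta>1, \<phi>1) \<in> hyper_reps" "(\<delta>3, \<phi>3) \<in> hyper_reps"
      and \<eta>: "\<eta> > 0" "\<eta> \<le> \<delta>1" "\<eta>' > 0" "\<eta>' \<le> \<delta>3"
      and h: "h \<in> P_space \<eta>" "h' \<in> P_space \<eta>'"
      and eq: "\<And>z. z \<in> strip \<eta> - \<real> \<Longrightarrow> \<phi>1 z - \<phi>2 z = h z"
      and eq': "\<And>z. z \<in> strip \<eta>' - \<real> \<Longrightarrow> \<phi>2 z - \<phi>3 z = h' z"
      unfolding hyper_rel_def by auto
    define \<mu> where "\<mu> = min \<eta> \<eta>'"
    have \<mu>: "\<mu> > 0" "\<mu> \<le> \<delta>1" "\<mu> \<le> \<delta>3" "\<mu> \<le> \<eta>" "\<mu> \<le> \<eta>'"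
      using \<eta> by (auto simp: \<mu>_def)
    have s: "strip \<mu> \<subseteq> strip \<eta>" "strip \<mu> \<subseteq> strip \<eta>'"
      using \<mu> by (auto simp: strip_def)
    have "\<forall>z \<in> strip \<mu> - \<real>. \<phi>1 z - \<phi>3 z = h z + h' z"
    proof
      fix z assume "z \<in> strip \<mu> - \<real>"
      then have "z \<in> strip \<eta> - \<real>" "z \<in> strip \<eta>' - \<real>" using s by auto
      with eq[of z] eq'[of z] show "\<phi>1 z - \<phi>3 z = h z + h' z" by (simp add: algebra_simps)
    qed
    moreover have "(\<lambda>z. h z + h' z) \<in> P_space \<mu>"
      using P_space_mono h \<mu> by (intro P_space_add) auto
    ultimately have "\<exists>h \<in> P_space \<mu>. \<forall>z \<in> strip \<mu> - \<real>. \<phi>1 z - \<phi>3 z = h z"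
      by (rule bexI)
    with r \<mu> show "(x, w) \<in> hyper_rel"
      unfolding hyper_rel_def by auto
  qed
qed

definition horizontal_integral :: "(complex \<Rightarrow> complex) \<Rightarrow> real \<Rightarrow> complex" where
  "horizontal_integral F c = (\<integral>x. F (Complex x c) \<partial>lborel)"

text \<open>
  The pairing of \<open>f \<in> P_star\<close> with \<open>g \<in> fourier_hyperfunctions\<close>: the common value, over all
  representatives of \<open>g\<close> and all sufficiently small \<open>c > 0\<close>, of the difference of the two
  line integrals.
\<close>

definition hyper_pairing ::
    "(complex \<Rightarrow> complex) \<Rightarrow> (real \<times> (complex \<Rightarrow> complex)) set \<Rightarrow> complex" where
  "hyper_pairing f g = (THE v. \<exists>(\<delta>, \<phi>) \<in> g. \<forall>\<^sub>F c in at_right 0.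
     horizontal_integral (\<lambda>z. f z * \<phi> z) c - horizontal_integral (\<lambda>z. f z * \<phi> z) (- c) = v)"

definition gauss_kernel :: "real \<Rightarrow> complex \<Rightarrow> complex" where
  "gauss_kernel L z = of_real (sqrt (L / (2 * pi))) * exp (- of_real L * z\<^sup>2 / 2)"


section \<open>The random hyperfunctions\<close>

text \<open>
  The definitions below are for a fixed realisation \<open>x\<close> of the variables \<open>X(p)\<close> (only prime
  indices matter), respectively \<open>w\<close> of the variables \<open>W(k)\<close> (only indices \<open>k \<ge> 1\<close> matter).
  Sums over primes are taken in increasing order by putting zero at the non-primes, and
  sums over \<open>k \<ge> 1\<close> are indexed by \<open>k = j + 1\<close>.
\<close>

definition log_zeta_rand :: "(nat \<Rightarrow> complex) \<Rightarrow> complex \<Rightarrow> complex" where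
  "log_zeta_rand x s = (\<Sum>p. if prime p
     then (\<Sum>j. x p ^ Suc j * of_nat p powr (- of_nat (Suc j) * s) / of_nat (Suc j)) else 0)"

definition phi_rand :: "(nat \<Rightarrow> complex) \<Rightarrow> complex \<Rightarrow> complex" where
  "phi_rand x z = (if Im z > 0 then 0 else log_zeta_rand x (1/2 + \<i> * z))"

definition log_zeta_rand_hyper :: "(nat \<Rightarrow> complex) \<Rightarrow> (real \<times> (complex \<Rightarrow> complex)) set" where
  "log_zeta_rand_hyper x = hyper_class (1/2) (phi_rand x)"

definition log_Z_gauss :: "(nat \<Rightarrow> complex) \<Rightarrow> complex \<Rightarrow> complex" where
  "log_Z_gauss w s = (\<Sum>j. w (Suc j) / of_real (sqrt (real (Suc j))) * s ^ Suc j)"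

definition phi_gauss :: "(nat \<Rightarrow> complex) \<Rightarrow> complex \<Rightarrow> complex" where
  "phi_gauss w z = (if Im z > 0 then 0 else log_Z_gauss w (exp (- \<i> * z)))"

definition log_Z_gauss_hyper :: "(nat \<Rightarrow> complex) \<Rightarrow> (real \<times> (complex \<Rightarrow> complex)) set" where
  "log_Z_gauss_hyper w = hyper_class 1 (phi_gauss w)"

definition uniform_circle :: "complex measure" where
  "uniform_circle = distr (uniform_measure lborel {0..2 * pi}) borel cis"

definition std_complex_gaussian_density :: "complex \<Rightarrow> real" where
  "std_complex_gaussian_density z = exp (- (norm z)\<^sup>2) / pi"

text \<open>
  Expectation of a random variable that is only determined almost surely. The random
  hyperfunctions are meaningful outside a null set, and nothing is known about the
  measurability of the arbitrary values taken there; passing to the completion makes these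
  values irrelevant, and changes nothing for random variables measurable with respect to \<open>M\<close>.
\<close>

definition as_integrable :: "'a measure \<Rightarrow> ('a \<Rightarrow> complex) \<Rightarrow> bool" where
  "as_integrable M Y \<longleftrightarrow> integrable (completion M) Y"

definition as_expectation :: "'a measure \<Rightarrow> ('a \<Rightarrow> complex) \<Rightarrow> complex" where
  "as_expectation M Y = (\<integral>\<omega>. Y \<omega> \<partial>completion M)"


section \<open>The joint moments and the arithmetic factor\<close>

definition kcirc :: "complex \<times> complex \<Rightarrow> complex \<Rightarrow> complex" where
  "kcirc \<kappa> z = fst \<kappa> * z + snd \<kappa> * cnj z"

definition rand_moment_var ::
    "complex \<times> complex \<Rightarrow> (nat \<Rightarrow> 'a \<Rightarrow> complex) \<Rightarrow> real \<Rightarrow> 'a \<Rightarrow> complex" where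
  "rand_moment_var \<kappa> X L \<omega> =
     exp (kcirc \<kappa> (hyper_pairing (\<lambda>z. - gauss_kernel L z) (log_zeta_rand_hyper (\<lambda>p. X p \<omega>))))"

definition gauss_moment_var ::
    "complex \<times> complex \<Rightarrow> (nat \<Rightarrow> 'a \<Rightarrow> complex) \<Rightarrow> real \<Rightarrow> 'a \<Rightarrow> complex" where
  "gauss_moment_var \<kappa> W L \<omega> =
     exp (kcirc \<kappa> (hyper_pairing (\<lambda>z. - gauss_kernel L z) (log_Z_gauss_hyper (\<lambda>k. W k \<omega>))))"

definition arith_term :: "complex \<times> complex \<Rightarrow> nat \<Rightarrow> nat \<Rightarrow> complex" where
  "arith_term \<kappa> p m = pochhammer (fst \<kappa>) m / fact m * (pochhammer (snd \<kappa>) m / fact m) / of_nat p ^ m"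

definition arith_local_factor :: "complex \<times> complex \<Rightarrow> nat \<Rightarrow> complex" where
  "arith_local_factor \<kappa> p = (1 - 1 / of_nat p) powr (fst \<kappa> * snd \<kappa>) * (\<Sum>m. arith_term \<kappa> p m)"

text \<open>
  The product over primes, in increasing order. Finitely many local factors may vanish, which
  the library's notion of a convergent infinite product permits.
\<close>

definition arith_factor :: "complex \<times> complex \<Rightarrow> complex" where
  "arith_factor \<kappa> = (\<Prod>p. if prime p then arith_local_factor \<kappa> p else 1)"

end

theory Submission
  imports Defs "HOL-Real_Asymp.Real_Asymp"
begin

text \<open>Write \<open>f\<^sub>L\<close> for the Gaussian kernel.  Pairing with \<open>f\<^sub>L\<close> multiplies an oscillation
  \<open>exp (- \<i> u z)\<close> by \<open>exp (- u\<^sup>2 / (2 L))\<close>.  Almost surely the two pairings are therefore the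
  rapidly convergent series \<open>\<Sum> X(p)\<^sup>k p powr (-k/2) exp (- (k ln p)\<^sup>2 / (2 L)) / k\<close>, over the prime
  powers, and \<open>\<Sum> W(k) exp (- k\<^sup>2 / (2 L)) / sqrt k\<close>.

  By independence both moments factor.  The Gaussian one is \<open>exp (\<kappa>1 \<kappa>2 H)\<close> with
  \<open>H = \<Sum> exp (- k\<^sup>2 / L) / k\<close> (\<open>expectation_gauss_moment\<close>); the other one is an infinite product of
  local moments \<open>E\<^sub>p\<close> (\<open>expectation_rand_moment\<close>).  Orthogonality of the powers on the circle gives
  \<open>E\<^sub>p = 1 + \<kappa>1 \<kappa>2 exp (- (ln p)\<^sup>2 / L) / p + O(p powr (-3/2))\<close> uniformly in \<open>L\<close>, so \<open>E\<^sub>p\<close> has to be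
  compensated before \<open>L\<close> tends to infinity.  With the damped logarithm
  \<open>T\<^sub>p = \<Sum> p powr (-k) exp (- (k ln p)\<^sup>2 / L) / k\<close>, the factors \<open>E\<^sub>p exp (- \<kappa>1 \<kappa>2 T\<^sub>p)\<close> are
  \<open>1 + O(p powr (-3/2))\<close>, so their product converges to the product of their limits
  (\<open>local_product_limit\<close>).  In the limit \<open>T\<^sub>p\<close> is \<open>- ln (1 - 1/p)\<close>, and two binomial series turn
  \<open>E\<^sub>p\<close> into the series with the Pochhammer symbols: the limit is the arithmetic factor.

  It remains to show that \<open>\<Sum> T\<^sub>p - H\<close> tends to 0 (\<open>smoothed_mertens\<close>).  This is a smoothed form of
  Mertens' theorem: the difference is an average, with a fixed integrable weight, of \<open>log (\<zeta>(1 + s) (1 - exp (- s)))\<close> over a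
  vertical line at distance \<open>sqrt (2 / L)\<close> from 0.  This function tends to 0 with \<open>s\<close> because the
  zeta function has a simple pole with residue 1, and away from 0 the trivial bound on a vertical line
  suffices for dominated convergence.

  That the pairings are given by these series has a deterministic and a probabilistic part.
  The definite description in the definition of the pairing is resolved by shifting
  a contour across the real axis (\<open>hyper_pairing_eqI\<close>).  For the random zeta function one needs its
  holomorphic continuation to the right of 1/2 with at most linear growth; this follows by partial
  summation from the almost sure bound \<open>O(sqrt n ln n)\<close> for the sums of \<open>X(p)\<close> over \<open>p \<le> n\<close>, a
  consequence of Hoeffding's inequality and the Borel--Cantelli lemma.\<close>

section \<open>Gaussian integrals along horizontal lines\<close>

text \<open>For imaginary \<open>b\<close> this is the characteristic function of the standard normal law. Completing the
  square, that is, a translation by \<open>Re b\<close>, reduces the general case to this one.\<close>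

lemma has_bochner_integral_gaussian_exp:
  fixes b :: complex
  shows "has_bochner_integral lborel (\<lambda>x. exp (b * of_real x) * of_real (std_normal_density x))
           (exp (b\<^sup>2 / 2))"
proof -
  define s t where "s = Re b" and "t = Im b"
  define f where "f = (\<lambda>x. exp (b * of_real x) * of_real (std_normal_density x))"
  have int: "integrable lborel (\<lambda>y. iexp (t * y) * of_real (std_normal_density y))"
  proof (rule Bochner_Integration.integrable_bound[where f = "std_normal_density"])
    show "integrable lborel std_normal_density" by (rule integrable_normal_density) simp
    show "(\<lambda>y. iexp (t * y) * of_real (std_normal_density y)) \<in> borel_measurable lborel"
      by measurable
  qed (auto simp: norm_mult)
  have "complex_of_real (exp (- t\<^sup>2 / 2)) = char std_normal_distribution t"
    by (simp add: char_std_normal_distribution)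
  also have "\<dots> = (\<integral>y. std_normal_density y *\<^sub>R iexp (t * y) \<partial>lborel)"
    unfolding char_def by (rule integral_density) (auto)
  also have "\<dots> = (\<integral>y. iexp (t * y) * of_real (std_normal_density y) \<partial>lborel)"
    by (simp add: scaleR_conv_of_real mult.commute)
  finally have "has_bochner_integral lborel (\<lambda>y. iexp (t * y) * of_real (std_normal_density y))
      (complex_of_real (exp (- t\<^sup>2 / 2)))"
    using int by (simp add: has_bochner_integral_iff)
  then have "has_bochner_integral lborel
      (\<lambda>y. of_real (exp (s\<^sup>2 / 2)) * iexp (t * s) * (iexp (t * y) * of_real (std_normal_density y)))
      (of_real (exp (s\<^sup>2 / 2)) * iexp (t * s) * (complex_of_real (exp (- t\<^sup>2 / 2))))"
    by (rule has_bochner_integral_mult_right)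
  moreover have "of_real (exp (s\<^sup>2 / 2)) * iexp (t * s) * (iexp (t * y) * of_real (std_normal_density y))
      = f (s + 1 * y)" for y
  proof -
    have "b * complex_of_real (s + y) = of_real (s * (s + y)) + \<i> * of_real (t * s) + \<i> * of_real (t * y)"
      by (simp add: s_def t_def complex_eq_iff algebra_simps)
    then have e: "exp (b * complex_of_real (s + y)) = of_real (exp (s * (s + y))) * iexp (t * s) * iexp (t * y)"
      by (simp only: exp_add exp_of_real)
    have "exp (s * (s + y)) * std_normal_density (s + y) = exp (s\<^sup>2 / 2) * std_normal_density y"
      by (simp add: std_normal_density_def field_simps power2_eq_square flip: exp_add)
    then have "complex_of_real (exp (s * (s + y))) * of_real (std_normal_density (s + y)) =
        of_real (exp (s\<^sup>2 / 2)) * of_real (std_normal_density y)"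
      by (metis of_real_mult)
    then have "(complex_of_real (exp (s * (s + y))) * of_real (std_normal_density (s + y))) * (iexp (t * s) * iexp (t * y)) =
        (of_real (exp (s\<^sup>2 / 2)) * of_real (std_normal_density y)) * (iexp (t * s) * iexp (t * y))"
      by (rule arg_cong)
    then show ?thesis unfolding f_def mult_1_left e by (simp only: mult_ac)
  qed
  moreover have "of_real (exp (s\<^sup>2 / 2)) * iexp (t * s) * (complex_of_real (exp (- t\<^sup>2 / 2))) = exp (b\<^sup>2 / 2)"
  proof -
    have "b\<^sup>2 / 2 = of_real (s\<^sup>2 / 2) + \<i> * of_real (t * s) + of_real (- t\<^sup>2 / 2)"
      by (simp add: s_def t_def complex_eq_iff power2_eq_square field_simps)
    then show ?thesis by (simp only: exp_add exp_of_real)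
  qed
  ultimately have "has_bochner_integral lborel (\<lambda>y. f (s + 1 * y)) (exp (b\<^sup>2 / 2))"
    by simp
  then show ?thesis
    using lborel_has_bochner_integral_real_affine_iff[of 1 f "exp (b\<^sup>2 / 2)" s]
    unfolding f_def[symmetric] by simp
qed

lemma gauss_kernel_of_real:
  "gauss_kernel L (of_real x) = of_real (sqrt (L / (2 * pi)) * exp (- L * x\<^sup>2 / 2))"
  unfolding gauss_kernel_def by (simp flip: exp_of_real)

lemma has_bochner_integral_gauss_kernel_exp:
  fixes b :: complex
  assumes "L > 0"
  shows "has_bochner_integral lborel (\<lambda>x. gauss_kernel L (of_real x) * exp (b * of_real x))
           (exp (b\<^sup>2 / of_real (2 * L)))"
proof -
  define f where "f = (\<lambda>x. gauss_kernel L (of_real x) * exp (b * of_real x))"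
  define r where "r = sqrt L"
  have r: "r > 0" "r\<^sup>2 = L" using assms by (auto simp: r_def)
  have "f (0 + (1 / r) * y) = of_real r * (exp ((b / of_real r) * of_real y) * of_real (std_normal_density y))" for y
  proof -
    have 1: "sqrt (L / (2 * pi)) = r * (1 / sqrt (2 * pi))"
      by (simp add: r_def real_sqrt_divide)
    have 2: "- L * (1 / r * y)\<^sup>2 / 2 = - y\<^sup>2 / 2"
      using r by (auto simp: field_simps)
    show ?thesis
      unfolding f_def gauss_kernel_of_real std_normal_density_def 1 add_0_left 2
      by (simp add: mult_ac)
  qed
  moreover have "has_bochner_integral lborel
     (\<lambda>y. of_real r * (exp ((b / of_real r) * of_real y) * of_real (std_normal_density y)))
     (of_real r * exp ((b / of_real r)\<^sup>2 / 2))"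
    by (intro has_bochner_integral_mult_right has_bochner_integral_gaussian_exp)
  ultimately have "has_bochner_integral lborel (\<lambda>y. f (0 + (1 / r) * y)) (of_real r * exp ((b / of_real r)\<^sup>2 / 2))"
    by simp
  moreover have "(b / of_real r)\<^sup>2 / 2 = b\<^sup>2 / of_real (2 * L)"
    using r by (simp add: power_divide flip: of_real_power)
  ultimately have "has_bochner_integral lborel (\<lambda>y. f (0 + (1 / r) * y)) (exp (b\<^sup>2 / of_real (2 * L)) /\<^sub>R \<bar>1 / r\<bar>)"
    using r by (simp add: scaleR_conv_of_real)
  then show ?thesis
    using lborel_has_bochner_integral_real_affine_iff[of "1/r" f "exp (b\<^sup>2 / of_real (2 * L))" 0] r
    unfolding f_def[symmetric] by simp
qed

lemma gauss_kernel_line: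
  "gauss_kernel L (Complex x c) =
     of_real (exp (L * c\<^sup>2 / 2)) * (gauss_kernel L (of_real x) * exp (- \<i> * of_real (L * c) * of_real x))"
proof -
  have "- complex_of_real L * (Complex x c)\<^sup>2 / 2 =
      of_real (L * c\<^sup>2 / 2) + (- complex_of_real L * (of_real x)\<^sup>2 / 2 + (- \<i> * of_real (L * c) * of_real x))"
    by (simp add: complex_eq_iff power2_eq_square field_simps)
  then have "exp (- complex_of_real L * (Complex x c)\<^sup>2 / 2) =
      of_real (exp (L * c\<^sup>2 / 2)) * (exp (- complex_of_real L * (of_real x)\<^sup>2 / 2) * exp (- \<i> * of_real (L * c) * of_real x))"
    by (simp only: exp_add exp_of_real)
  then show ?thesis
    unfolding gauss_kernel_def by simp
qed

lemma norm_gauss_kernel_line: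
  assumes "L > 0"
  shows "norm (gauss_kernel L (Complex x c)) =
     sqrt (L / (2 * pi)) * exp (L * c\<^sup>2 / 2) * exp (- L * x\<^sup>2 / 2)"
  using assms unfolding gauss_kernel_line gauss_kernel_of_real
  by (simp add: norm_mult norm_exp_eq_Re)

text \<open>The value is the same on every horizontal line: by \<open>gauss_kernel_line\<close>, moving the line by \<open>c\<close>
  shifts the frequency by \<open>L * c\<close> and scales the kernel, and the two effects cancel after completing
  the square. For this reason the line integrals below do not depend on \<open>c\<close>.\<close>

lemma has_bochner_integral_gauss_kernel_fourier:
  assumes "L > 0"
  shows "has_bochner_integral lborel
           (\<lambda>x. gauss_kernel L (Complex x c) * exp (- \<i> * of_real u * Complex x c))
           (of_real (exp (- u\<^sup>2 / (2 * L))))"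
proof -
  define b where "b = - \<i> * of_real (L * c + u)"
  have "has_bochner_integral lborel
     (\<lambda>x. of_real (exp (L * c\<^sup>2 / 2 + u * c)) * (gauss_kernel L (of_real x) * exp (b * of_real x)))
     (of_real (exp (L * c\<^sup>2 / 2 + u * c)) * exp (b\<^sup>2 / of_real (2 * L)))"
    by (intro has_bochner_integral_mult_right has_bochner_integral_gauss_kernel_exp assms)
  moreover have "of_real (exp (L * c\<^sup>2 / 2 + u * c)) * (gauss_kernel L (of_real x) * exp (b * of_real x))
     = gauss_kernel L (Complex x c) * exp (- \<i> * of_real u * Complex x c)" for x
  proof -
    have "b * of_real x + of_real (u * c) = - \<i> * of_real (L * c) * of_real x + - \<i> * of_real u * Complex x c"
      by (simp add: b_def complex_eq_iff algebra_simps)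
    then have "exp (b * of_real x) * of_real (exp (u * c)) =
       exp (- \<i> * of_real (L * c) * of_real x) * exp (- \<i> * of_real u * Complex x c)"
      by (metis exp_add exp_of_real)
    then have "of_real (exp (L * c\<^sup>2 / 2)) * gauss_kernel L (of_real x) * (exp (b * of_real x) * of_real (exp (u * c))) =
       of_real (exp (L * c\<^sup>2 / 2)) * gauss_kernel L (of_real x) *
       (exp (- \<i> * of_real (L * c) * of_real x) * exp (- \<i> * of_real u * Complex x c))"
      by (simp only:)
    then show ?thesis
      unfolding gauss_kernel_line[of L x c] exp_add of_real_mult by (simp only: mult_ac)
  qed
  moreover have "of_real (exp (L * c\<^sup>2 / 2 + u * c)) * exp (b\<^sup>2 / of_real (2 * L)) = complex_of_real (exp (- u\<^sup>2 / (2 * L)))"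
  proof -
    have "b\<^sup>2 / of_real (2 * L) = of_real (- (L * c + u)\<^sup>2 / (2 * L))"
      by (simp add: b_def power_mult_distrib)
    moreover have "L * c\<^sup>2 / 2 + u * c + - (L * c + u)\<^sup>2 / (2 * L) = - u\<^sup>2 / (2 * L)"
      using assms by (simp add: field_simps power2_eq_square)
    ultimately show ?thesis
      by (metis exp_add exp_of_real of_real_mult)
  qed
  ultimately show ?thesis by simp
qed

lemma borel_measurable_gauss_kernel_line [measurable]:
  "(\<lambda>x. gauss_kernel L (Complex x c)) \<in> borel_measurable borel"
  unfolding gauss_kernel_line gauss_kernel_of_real by measurable

text \<open>The growth \<open>exp \<bar>x\<bar>\<close> majorizes everything that is integrated against the kernel below: the linear
  growth of the random series and the infra-exponential growth in \<open>P_space\<close> and \<open>P_tilde\<close>.\<close>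

lemma integrable_gauss_kernel_exp_abs:
  assumes "L > 0"
  shows "integrable lborel (\<lambda>x. norm (gauss_kernel L (Complex x c)) * exp \<bar>x\<bar>)"
proof -
  have 1: "integrable lborel (\<lambda>x. norm (gauss_kernel L (of_real x) * exp (of_real s * of_real x)))" for s :: real
    using has_bochner_integral_gauss_kernel_exp[OF assms, of "of_real s"]
    by (intro integrable_norm) (auto simp: has_bochner_integral_iff)
  have "integrable lborel (\<lambda>x. exp (L * c\<^sup>2 / 2) * (norm (gauss_kernel L (of_real x) * exp (of_real 1 * of_real x))
     + norm (gauss_kernel L (of_real x) * exp (of_real (-1) * of_real x))))"
    by (intro integrable_mult_right Bochner_Integration.integrable_add 1)
  then show ?thesis
  proof (rule Bochner_Integration.integrable_bound)
    show "AE x in lborel. norm (norm (gauss_kernel L (Complex x c)) * exp \<bar>x\<bar>) \<le>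
     norm (exp (L * c\<^sup>2 / 2) * (norm (gauss_kernel L (of_real x) * exp (of_real 1 * of_real x))
     + norm (gauss_kernel L (of_real x) * exp (of_real (-1) * of_real x))))"
    proof (rule AE_I2)
      fix x :: real
      have "exp \<bar>x\<bar> \<le> exp x + exp (- x)" by (simp add: abs_if)
      then have "norm (gauss_kernel L (of_real x)) * exp \<bar>x\<bar> \<le> norm (gauss_kernel L (of_real x)) * (exp x + exp (- x))"
        by (rule mult_left_mono) simp
      then show "norm (norm (gauss_kernel L (Complex x c)) * exp \<bar>x\<bar>) \<le>
     norm (exp (L * c\<^sup>2 / 2) * (norm (gauss_kernel L (of_real x) * exp (of_real 1 * of_real x))
     + norm (gauss_kernel L (of_real x) * exp (of_real (-1) * of_real x))))"
        unfolding gauss_kernel_line[of L x c]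
        using mult_left_mono[of "norm (gauss_kernel L (of_real x)) * exp \<bar>x\<bar>" "norm (gauss_kernel L (of_real x)) * (exp x + exp (- x))" "exp (L * c\<^sup>2 / 2)"]
        by (simp add: norm_mult abs_mult algebra_simps)
    qed
  qed measurable
qed

lemma integrable_gauss_kernel_mult:
  assumes "L > 0" and "(\<lambda>x. F (Complex x c)) \<in> borel_measurable borel"
    and "\<And>x. norm (F (Complex x c)) \<le> C * exp \<bar>x\<bar>"
  shows "integrable lborel (\<lambda>x. gauss_kernel L (Complex x c) * F (Complex x c))"
proof (rule Bochner_Integration.integrable_bound)
  show "integrable lborel (\<lambda>x. C * (norm (gauss_kernel L (Complex x c)) * exp \<bar>x\<bar>))"
    by (intro integrable_mult_right integrable_gauss_kernel_exp_abs assms)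
  show "(\<lambda>x. gauss_kernel L (Complex x c) * F (Complex x c)) \<in> borel_measurable lborel"
    using assms(2) by measurable
  show "AE x in lborel. norm (gauss_kernel L (Complex x c) * F (Complex x c))
      \<le> norm (C * (norm (gauss_kernel L (Complex x c)) * exp \<bar>x\<bar>))"
  proof (rule AE_I2)
    fix x
    have "norm (F (Complex x c)) \<le> \<bar>C\<bar> * exp \<bar>x\<bar>"
      using assms(3)[of x] abs_ge_self[of C] by (meson exp_ge_zero mult_right_mono order_trans)
    then have "norm (gauss_kernel L (Complex x c)) * norm (F (Complex x c))
      \<le> norm (gauss_kernel L (Complex x c)) * (\<bar>C\<bar> * exp \<bar>x\<bar>)"
      by (rule mult_left_mono) simp
    then show "norm (gauss_kernel L (Complex x c) * F (Complex x c))
      \<le> norm (C * (norm (gauss_kernel L (Complex x c)) * exp \<bar>x\<bar>))"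
      by (simp add: norm_mult abs_mult mult_ac)
  qed
qed

lemma horizontal_integral_limit:
  assumes "L > 0" and "\<And>n. (\<lambda>x. S n (Complex x c)) \<in> borel_measurable borel"
    and "\<And>n x. norm (S n (Complex x c)) \<le> C * exp \<bar>x\<bar>"
    and lim: "\<And>x. (\<lambda>n. S n (Complex x c)) \<longlonglongrightarrow> F (Complex x c)"
  shows "(\<lambda>n. horizontal_integral (\<lambda>z. gauss_kernel L z * S n z) c)
           \<longlonglongrightarrow> horizontal_integral (\<lambda>z. gauss_kernel L z * F z) c"
  unfolding horizontal_integral_def
proof (rule integral_dominated_convergence)
  have [measurable]: "(\<lambda>x. F (Complex x c)) \<in> borel_measurable borel"
    by (rule borel_measurable_LIMSEQ_metric[OF assms(2) lim])
  show "(\<lambda>x. gauss_kernel L (Complex x c) * F (Complex x c)) \<in> borel_measurable lborel"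
    by measurable
  show "(\<lambda>x. gauss_kernel L (Complex x c) * S n (Complex x c)) \<in> borel_measurable lborel" for n
    using assms(2)[of n] by measurable
  show "integrable lborel (\<lambda>x. C * (norm (gauss_kernel L (Complex x c)) * exp \<bar>x\<bar>))"
    by (intro integrable_mult_right integrable_gauss_kernel_exp_abs assms)
  show "AE x in lborel. (\<lambda>n. gauss_kernel L (Complex x c) * S n (Complex x c))
         \<longlonglongrightarrow> gauss_kernel L (Complex x c) * F (Complex x c)"
    by (intro AE_I2 tendsto_mult tendsto_const lim)
  show "AE x in lborel. norm (gauss_kernel L (Complex x c) * S n (Complex x c))
      \<le> C * (norm (gauss_kernel L (Complex x c)) * exp \<bar>x\<bar>)" for n
  proof (rule AE_I2)
    fix x
    show "norm (gauss_kernel L (Complex x c) * S n (Complex x c))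
      \<le> C * (norm (gauss_kernel L (Complex x c)) * exp \<bar>x\<bar>)"
      using mult_left_mono[OF assms(3)[of n x], of "norm (gauss_kernel L (Complex x c))"]
      by (simp add: norm_mult mult_ac)
  qed
qed

lemma norm_exp_line: "norm (exp (- \<i> * of_real u * Complex x c)) = exp (u * c)"
  by (simp add: norm_exp_eq_Re)

text \<open>On a fixed line, \<open>p powr (- k * s)\<close> and \<open>exp (- k * s)\<close> are oscillations in \<open>z\<close>; this lemma
  evaluates all the line integrals in this theory, up to passing to limits of partial sums.\<close>

lemma horizontal_integral_exp_series:
  fixes a :: "nat \<Rightarrow> complex" and u :: "nat \<Rightarrow> real"
  assumes "L > 0" and sm: "summable (\<lambda>j. norm (a j) * exp (u j * c))"
  shows "horizontal_integral (\<lambda>z. gauss_kernel L z * (\<Sum>j. a j * exp (- \<i> * of_real (u j) * z))) c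
           = (\<Sum>j. a j * of_real (exp (- (u j)\<^sup>2 / (2 * L))))"
    and "summable (\<lambda>j. a j * of_real (exp (- (u j)\<^sup>2 / (2 * L))))"
proof -
  define S where "S = (\<lambda>n z. \<Sum>j<n. a j * exp (- \<i> * of_real (u j) * z))"
  have nrm: "norm (a j * exp (- \<i> * of_real (u j) * Complex x c)) = norm (a j) * exp (u j * c)" for j x
    unfolding norm_mult norm_exp_line ..
  have bnd: "norm (S n (Complex x c)) \<le> (\<Sum>j. norm (a j) * exp (u j * c)) * exp \<bar>x\<bar>" for n x
  proof -
    have "norm (S n (Complex x c)) \<le> (\<Sum>j<n. norm (a j) * exp (u j * c))"
      unfolding S_def by (rule order_trans[OF norm_sum]) (simp only: nrm order_refl)
    also have "\<dots> \<le> (\<Sum>j. norm (a j) * exp (u j * c)) * 1"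
      unfolding mult_1_right by (rule sum_le_suminf[OF sm]) auto
    also have "\<dots> \<le> (\<Sum>j. norm (a j) * exp (u j * c)) * exp \<bar>x\<bar>"
      by (intro mult_left_mono suminf_nonneg sm) auto
    finally show ?thesis .
  qed
  have cont: "(\<lambda>x. a j * exp (- \<i> * of_real (u j) * Complex x c)) \<in> borel_measurable borel" for j
    by (intro borel_measurable_continuous_onI continuous_intros)
  have "horizontal_integral (\<lambda>z. gauss_kernel L z * S n z) c =
     (\<Sum>j<n. a j * of_real (exp (- (u j)\<^sup>2 / (2 * L))))" for n
  proof -
    have "has_bochner_integral lborel (\<lambda>x. \<Sum>j<n. a j * (gauss_kernel L (Complex x c) * exp (- \<i> * of_real (u j) * Complex x c)))
       (\<Sum>j<n. a j * of_real (exp (- (u j)\<^sup>2 / (2 * L))))"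
      by (intro has_bochner_integral_sum has_bochner_integral_mult_right
           has_bochner_integral_gauss_kernel_fourier assms)
    then show ?thesis
      unfolding horizontal_integral_def S_def sum_distrib_left
      by (simp add: has_bochner_integral_iff mult_ac)
  qed
  moreover have "(\<lambda>n. horizontal_integral (\<lambda>z. gauss_kernel L z * S n z) c) \<longlonglongrightarrow>
      horizontal_integral (\<lambda>z. gauss_kernel L z * (\<Sum>j. a j * exp (- \<i> * of_real (u j) * z))) c"
  proof (rule horizontal_integral_limit[OF assms(1) _ bnd])
    show "(\<lambda>x. S n (Complex x c)) \<in> borel_measurable borel" for n
      unfolding S_def using cont by measurable
    show "(\<lambda>n. S n (Complex x c)) \<longlonglongrightarrow> (\<Sum>j. a j * exp (- \<i> * of_real (u j) * Complex x c))" for x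
      unfolding S_def by (rule summable_LIMSEQ, rule summable_norm_cancel) (simp only: nrm sm)
  qed
  ultimately have "(\<lambda>j. a j * of_real (exp (- (u j)\<^sup>2 / (2 * L)))) sums
     horizontal_integral (\<lambda>z. gauss_kernel L z * (\<Sum>j. a j * exp (- \<i> * of_real (u j) * z))) c"
    by (simp add: sums_def)
  then show "horizontal_integral (\<lambda>z. gauss_kernel L z * (\<Sum>j. a j * exp (- \<i> * of_real (u j) * z))) c
           = (\<Sum>j. a j * of_real (exp (- (u j)\<^sup>2 / (2 * L))))"
    and "summable (\<lambda>j. a j * of_real (exp (- (u j)\<^sup>2 / (2 * L))))"
    by (auto simp: sums_iff)
qed

section \<open>The pairing in terms of one representative\<close>

lemma holomorphic_on_gauss_kernel: "gauss_kernel L holomorphic_on S"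
  unfolding gauss_kernel_def[abs_def] by (intro holomorphic_intros) auto

lemma open_strip: "open (strip \<delta>)" and convex_strip: "convex (strip \<delta>)"
proof -
  have *: "strip \<delta> = {z. Im z < \<delta>} \<inter> {z. Im z > - \<delta>}" by (auto simp: strip_def)
  show "open (strip \<delta>)" unfolding * by (intro open_Int open_halfspace_Im_lt open_halfspace_Im_gt)
  show "convex (strip \<delta>)" unfolding * by (intro convex_Int convex_halfspace_Im_lt convex_halfspace_Im_gt)
qed

lemma holomorphic_horizontal_measurable:
  assumes "F holomorphic_on S" and "\<And>x. Complex x c \<in> S"
  shows "(\<lambda>x. F (Complex x c)) \<in> borel_measurable borel"
proof (rule borel_measurable_continuous_onI)
  have "continuous_on UNIV (\<lambda>x. Complex x c)"
    by (intro continuous_intros)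
  then show "continuous_on UNIV (\<lambda>x. F (Complex x c))"
    using assms(2) holomorphic_on_imp_continuous_on[OF assms(1)]
    by (intro continuous_on_compose2[of S F UNIV "\<lambda>x. Complex x c"]) auto
qed

text \<open>The strip is convex, so \<open>gauss_kernel L * h\<close> has a primitive \<open>G\<close> on it, and the integral over a
  segment is a difference of values of \<open>G\<close>. The values of \<open>G\<close> at the two ends of a vertical side
  differ by at most the length of the side times the size of the integrand there, and the Gaussian
  decay beats the growth of \<open>h\<close>.\<close>

lemma horizontal_integral_shift:
  assumes "L > 0" "h \<in> P_space \<delta>" "0 < c" "c < \<delta>"
  shows "horizontal_integral (\<lambda>z. gauss_kernel L z * h z) c =
         horizontal_integral (\<lambda>z. gauss_kernel L z * h z) (- c)"
    and "\<And>c'. \<bar>c'\<bar> \<le> c \<Longrightarrow> integrable lborel (\<lambda>x. gauss_kernel L (Complex x c') * h (Complex x c'))"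
proof -
  have hol: "h holomorphic_on strip \<delta>" using assms(2) by (simp add: P_space_def)
  have "bdd_above ((\<lambda>z. norm (h z) * exp (- 1 * norm z)) ` {z. \<bar>Im z\<bar> \<le> c})"
  proof -
    have "\<forall>\<epsilon>>0. \<forall>\<delta>1. 0 < \<delta>1 \<and> \<delta>1 < \<delta> \<longrightarrow>
        bdd_above ((\<lambda>z. norm (h z) * exp (- \<epsilon> * norm z)) ` {z. \<bar>Im z\<bar> \<le> \<delta>1})"
      using assms(2) by (simp add: P_space_def)
    from this[rule_format, of 1 c] show ?thesis using assms(3,4) by simp
  qed
  then obtain A where A: "\<And>z. \<bar>Im z\<bar> \<le> c \<Longrightarrow> norm (h z) * exp (- 1 * norm z) \<le> A"
    by (auto simp: bdd_above_def)
  have A0: "A \<ge> 0" using A[of 0] assms(3) by (auto intro: order_trans[OF norm_ge_zero])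
  define B where "B = A * exp c"
  have B: "norm (h z) \<le> B * exp \<bar>Re z\<bar>" if "\<bar>Im z\<bar> \<le> c" for z
  proof -
    have "norm (h z) \<le> A * exp (norm z)"
      using A[OF that] by (simp add: exp_minus field_simps)
    also have "\<dots> \<le> A * exp (c + \<bar>Re z\<bar>)"
      using that cmod_le[of z] A0 by (intro mult_left_mono) auto
    finally show ?thesis by (simp add: B_def exp_add)
  qed
  have B0: "B \<ge> 0" using A0 by (simp add: B_def)
  define F where "F = (\<lambda>z. gauss_kernel L z * h z)"
  have instrip: "Complex x c' \<in> strip \<delta>" if "\<bar>c'\<bar> \<le> c" for x c'
    using that assms by (simp add: strip_def)
  show int: "integrable lborel (\<lambda>x. gauss_kernel L (Complex x c') * h (Complex x c'))" if "\<bar>c'\<bar> \<le> c" for c'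
  proof (rule integrable_gauss_kernel_mult[OF assms(1)])
    show "norm (h (Complex x c')) \<le> B * exp \<bar>x\<bar>" for x
      using B[of "Complex x c'"] that by simp
    show "(\<lambda>x. h (Complex x c')) \<in> borel_measurable borel"
      by (rule holomorphic_horizontal_measurable[OF hol instrip[OF that]])
  qed
  have hF: "F holomorphic_on strip \<delta>"
    unfolding F_def by (intro holomorphic_intros hol holomorphic_on_gauss_kernel)
  have "\<exists>G. \<forall>z\<in>strip \<delta>. (G has_field_derivative F z) (at z within strip \<delta>)"
    by (rule holomorphic_convex_primitive'[OF convex_strip open_strip hF]) blast
  then obtain G where G: "\<And>z. z \<in> strip \<delta> \<Longrightarrow> (G has_field_derivative F z) (at z within strip \<delta>)"
    by blast
  have G': "(G has_field_derivative F z) (at z)" if "z \<in> strip \<delta>" for z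
    using G[OF that] unfolding at_within_open[OF that open_strip] .
  have cF: "continuous_on UNIV (\<lambda>x. F (Complex x c'))" if "\<bar>c'\<bar> \<le> c" for c'
    using instrip[OF that] holomorphic_on_imp_continuous_on[OF hF]
    by (intro continuous_on_compose2[of "strip \<delta>" F UNIV "\<lambda>x. Complex x c'"]) (auto intro: continuous_intros)
  have lim: "(\<lambda>n. G (Complex (real n) c') - G (Complex (- real n) c')) \<longlonglongrightarrow> horizontal_integral F c'"
    if c': "\<bar>c'\<bar> \<le> c" for c'
  proof -
    have "(\<integral>x. indicator {- real n..real n} x *\<^sub>R F (Complex x c') \<partial>lborel) =
      G (Complex (real n) c') - G (Complex (- real n) c')" for n
    proof (rule integral_FTC_Icc)
      show "continuous_on {- real n..real n} (\<lambda>x. F (Complex x c'))"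
        using cF[OF c'] by (rule continuous_on_subset) auto
      fix x
      have "((\<lambda>x. Complex x c') has_vector_derivative 1) (at x within {- real n..real n})"
        unfolding Complex_eq by (auto intro!: derivative_eq_intros)
      from field_vector_diff_chain_within[OF this has_field_derivative_at_within[OF G'[OF instrip[OF c']]]]
      show "((\<lambda>x. G (Complex x c')) has_vector_derivative F (Complex x c')) (at x within {- real n..real n})"
        by (simp add: o_def)
    qed simp
    moreover have "(\<lambda>n. \<integral>x. indicator {- real n..real n} x *\<^sub>R F (Complex x c') \<partial>lborel) \<longlonglongrightarrow>
        (\<integral>x. F (Complex x c') \<partial>lborel)"
    proof (rule integral_dominated_convergence)
      have m: "(\<lambda>x. F (Complex x c')) \<in> borel_measurable borel"
        by (rule borel_measurable_continuous_onI[OF cF[OF c']])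
      show "(\<lambda>x. F (Complex x c')) \<in> borel_measurable lborel" using m by simp
      show "(\<lambda>x. indicator {- real n..real n} x *\<^sub>R F (Complex x c')) \<in> borel_measurable lborel" for n
        using m by measurable
      show "integrable lborel (\<lambda>x. norm (F (Complex x c')))"
        using int[OF c'] unfolding F_def by (rule integrable_norm)
      show "AE x in lborel. (\<lambda>n. indicator {- real n..real n} x *\<^sub>R F (Complex x c')) \<longlonglongrightarrow> F (Complex x c')"
      proof (rule AE_I2, rule tendsto_eventually)
        fix x :: real
        show "\<forall>\<^sub>F n in sequentially. indicator {- real n..real n} x *\<^sub>R F (Complex x c') = F (Complex x c')"
          using eventually_ge_at_top[of "nat \<lceil>\<bar>x\<bar>\<rceil>"]
          by eventually_elim (auto simp: indicator_def abs_le_iff nat_le_iff ceiling_le_iff)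
      qed
      show "AE x in lborel. norm (indicator {- real n..real n} x *\<^sub>R F (Complex x c')) \<le> norm (F (Complex x c'))" for n
        by (auto simp: indicator_def)
    qed
    ultimately show ?thesis
      by (simp add: horizontal_integral_def)
  qed
  define K where "K = (\<lambda>x. sqrt (L / (2 * pi)) * exp (L * c\<^sup>2 / 2) * exp (- L * x\<^sup>2 / 2) * (B * exp \<bar>x\<bar>))"
  have side: "norm (G (Complex x c) - G (Complex x (- c))) \<le> K x * (2 * c)" for x
  proof -
    have "norm (G (Complex x c) - G (Complex x (- c))) \<le> K x * norm (Complex x c - Complex x (- c))"
    proof (rule field_differentiable_bound[where f = G and f' = F and S = "closed_segment (Complex x c) (Complex x (- c))"])
      let ?S = "closed_segment (Complex x c) (Complex x (- c))"
      have S: "Re z = x \<and> \<bar>Im z\<bar> \<le> c" if "z \<in> ?S" for z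
        using that assms(3) by (auto simp: closed_segment_same_Re closed_segment_eq_real_ivl split: if_splits)
      show "convex ?S" by simp
      show "(G has_field_derivative F z) (at z within ?S)" if "z \<in> ?S" for z
        using S[OF that] assms by (intro has_field_derivative_at_within[OF G']) (auto simp: strip_def)
      show "norm (F z) \<le> K x" if "z \<in> ?S" for z
      proof -
        have z: "z = Complex x (Im z)" using S[OF that] by (simp add: complex_eq_iff)
        have "(Im z)\<^sup>2 \<le> c\<^sup>2" using S[OF that] assms(3) by (simp add: abs_le_square_iff[symmetric])
        then have "norm (gauss_kernel L z) \<le> sqrt (L / (2 * pi)) * exp (L * c\<^sup>2 / 2) * exp (- L * x\<^sup>2 / 2)"
          using assms(1) by (subst z, subst norm_gauss_kernel_line) (auto intro!: mult_right_mono mult_left_mono)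
        moreover have "norm (h z) \<le> B * exp \<bar>x\<bar>" using B[of z] S[OF that] by auto
        ultimately show ?thesis
          unfolding F_def K_def norm_mult using B0 assms(1) by (intro mult_mono) auto
      qed
    qed auto
    also have "norm (Complex x c - Complex x (- c)) = 2 * c"
      using assms(3) by (simp add: cmod_def real_sqrt_mult)
    finally show ?thesis .
  qed
  have "(\<lambda>n. K (real n) * (2 * c)) \<longlonglongrightarrow> 0" "(\<lambda>n. K (- real n) * (2 * c)) \<longlonglongrightarrow> 0"
    unfolding K_def using assms(1) by real_asymp+
  then have "(\<lambda>n. G (Complex (real n) c) - G (Complex (real n) (- c))) \<longlonglongrightarrow> 0"
      "(\<lambda>n. G (Complex (- real n) c) - G (Complex (- real n) (- c))) \<longlonglongrightarrow> 0"
    by (auto intro: Lim_null_comparison[OF always_eventually] side)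
  from tendsto_diff[OF this]
  have "(\<lambda>n. (G (Complex (real n) c) - G (Complex (- real n) c)) -
      (G (Complex (real n) (-c)) - G (Complex (- real n) (- c)))) \<longlonglongrightarrow> 0"
    by (simp add: algebra_simps)
  moreover have "(\<lambda>n. (G (Complex (real n) c) - G (Complex (- real n) c)) -
      (G (Complex (real n) (-c)) - G (Complex (- real n) (- c)))) \<longlonglongrightarrow>
      horizontal_integral F c - horizontal_integral F (- c)"
    using assms(3) by (intro tendsto_diff lim) auto
  ultimately have "horizontal_integral F c - horizontal_integral F (- c) = 0"
    by (rule LIMSEQ_unique[symmetric])
  then show "horizontal_integral (\<lambda>z. gauss_kernel L z * h z) c =
         horizontal_integral (\<lambda>z. gauss_kernel L z * h z) (- c)"
    by (simp add: F_def)
qed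

lemma P_tilde_integrable:
  assumes "L > 0" "\<phi> \<in> P_tilde \<delta>" "c \<noteq> 0" "\<bar>c\<bar> < \<delta>"
  shows "integrable lborel (\<lambda>x. gauss_kernel L (Complex x c) * \<phi> (Complex x c))"
proof -
  have "bdd_above ((\<lambda>z. norm (\<phi> z) * exp (- 1 * norm z)) ` {z. \<bar>c\<bar>/2 \<le> \<bar>Im z\<bar> \<and> \<bar>Im z\<bar> \<le> (\<bar>c\<bar>+\<delta>)/2})"
  proof -
    have "0 < \<bar>c\<bar>/2 \<and> \<bar>c\<bar>/2 < (\<bar>c\<bar>+\<delta>)/2 \<and> (\<bar>c\<bar>+\<delta>)/2 < \<delta>" using assms by auto
    moreover have "\<forall>\<epsilon>>0. \<forall>\<delta>1 \<delta>2. 0 < \<delta>1 \<and> \<delta>1 < \<delta>2 \<and> \<delta>2 < \<delta> \<longrightarrow>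
        bdd_above ((\<lambda>z. norm (\<phi> z) * exp (- \<epsilon> * norm z)) ` {z. \<delta>1 \<le> \<bar>Im z\<bar> \<and> \<bar>Im z\<bar> \<le> \<delta>2})"
      using assms(2) by (simp add: P_tilde_def)
    from this[rule_format, of 1, OF zero_less_one] calculation show ?thesis .
  qed
  then obtain A where A: "\<And>z. \<bar>c\<bar>/2 \<le> \<bar>Im z\<bar> \<and> \<bar>Im z\<bar> \<le> (\<bar>c\<bar>+\<delta>)/2 \<Longrightarrow> norm (\<phi> z) * exp (- 1 * norm z) \<le> A"
    by (auto simp: bdd_above_def)
  have A': "norm (\<phi> (Complex x c)) * exp (- 1 * norm (Complex x c)) \<le> A" for x
    using assms by (intro A) auto
  have A0: "A \<ge> 0" using A'[of 0] by (rule order_trans[rotated]) auto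
  have "norm (\<phi> (Complex x c)) \<le> A * exp \<bar>c\<bar> * exp \<bar>x\<bar>" for x
  proof -
    have "norm (\<phi> (Complex x c)) \<le> A * exp (norm (Complex x c))"
      using A'[of x] by (simp add: exp_minus field_simps)
    also have "\<dots> \<le> A * exp (\<bar>c\<bar> + \<bar>x\<bar>)"
      using cmod_le[of "Complex x c"] A0 by (intro mult_left_mono) auto
    finally show ?thesis by (simp add: exp_add)
  qed
  moreover have "(\<lambda>x. \<phi> (Complex x c)) \<in> borel_measurable borel"
    using assms by (intro holomorphic_horizontal_measurable[where S = "strip \<delta> - \<real>"])
      (auto simp: P_tilde_def strip_def complex_is_Real_iff)
  ultimately show ?thesis by (intro integrable_gauss_kernel_mult assms)
qed

text \<open>Two representatives of a hyperfunction differ by a function that is holomorphic across the real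
  axis; its integrals at heights \<open>c\<close> and \<open>- c\<close> agree by the contour shift, so it does not
  contribute. Hence every representative gives the value \<open>v\<close>, and the definite description in the
  definition of the pairing denotes \<open>v\<close>.\<close>

lemma hyper_pairing_eqI:
  assumes L: "L > 0" and "\<delta> > 0" "\<phi> \<in> P_tilde \<delta>" and zero: "\<And>z. Im z > 0 \<Longrightarrow> \<phi> z = 0"
    and val: "\<And>c. 0 < c \<Longrightarrow> c < \<delta> \<Longrightarrow> horizontal_integral (\<lambda>z. gauss_kernel L z * \<phi> z) (- c) = v"
  shows "hyper_pairing (\<lambda>z. - gauss_kernel L z) (hyper_class \<delta> \<phi>) = v"
proof -
  define J where "J = (\<lambda>\<psi> c. horizontal_integral (\<lambda>z. - gauss_kernel L z * \<psi> z) c -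
     horizontal_integral (\<lambda>z. - gauss_kernel L z * \<psi> z) (- c))"
  have Jm: "J \<psi> c = horizontal_integral (\<lambda>z. gauss_kernel L z * \<psi> z) (- c) -
     horizontal_integral (\<lambda>z. gauss_kernel L z * \<psi> z) c" for \<psi> c
    unfolding J_def horizontal_integral_def by simp
  have rep: "(\<delta>, \<phi>) \<in> hyper_reps" using assms by (simp add: hyper_reps_def)
  have J\<phi>: "J \<phi> c = v" if "0 < c" "c < \<delta>" for c
    using val[OF that] zero that unfolding Jm by (simp add: horizontal_integral_def)
  have ev: "\<forall>\<^sub>F c in at_right 0. J \<psi> c = v" if mem: "(\<delta>', \<psi>) \<in> hyper_class \<delta> \<phi>" for \<delta>' \<psi>
  proof -
    obtain \<eta> h where \<eta>: "0 < \<eta>" "\<eta> \<le> \<delta>" "\<eta> \<le> \<delta>'" and h: "h \<in> P_space \<eta>"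
      and \<psi>: "\<psi> \<in> P_tilde \<delta>'"
      and eq: "\<forall>z \<in> strip \<eta> - \<real>. \<phi> z - \<psi> z = h z"
    proof -
      have r: "((\<delta>, \<phi>), (\<delta>', \<psi>)) \<in> hyper_rel" using mem by (simp add: hyper_class_def)
      then have "\<psi> \<in> P_tilde \<delta>'" by (simp add: hyper_rel_def hyper_reps_def)
      moreover have "\<exists>\<eta>>0. \<eta> \<le> \<delta> \<and> \<eta> \<le> \<delta>' \<and> (\<exists>h \<in> P_space \<eta>. \<forall>z \<in> strip \<eta> - \<real>. \<phi> z - \<psi> z = h z)"
        using r unfolding hyper_rel_def mem_Collect_eq case_prod_conv by (elim conjE)
      ultimately show thesis using that by blast
    qed
    have "J \<psi> c = v" if c: "0 < c" "c < \<eta>" for c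
    proof -
      have hor: "horizontal_integral (\<lambda>z. gauss_kernel L z * \<psi> z) c' =
        horizontal_integral (\<lambda>z. gauss_kernel L z * \<phi> z) c' - horizontal_integral (\<lambda>z. gauss_kernel L z * h z) c'"
        if c': "c' = c \<or> c' = - c" for c'
      proof -
        have "\<psi> (Complex x c') = \<phi> (Complex x c') - h (Complex x c')" for x
          using bspec[OF eq, of "Complex x c'"] c c' by (auto simp: strip_def complex_is_Real_iff algebra_simps)
        then have "horizontal_integral (\<lambda>z. gauss_kernel L z * \<psi> z) c' =
           (\<integral>x. gauss_kernel L (Complex x c') * \<phi> (Complex x c') - gauss_kernel L (Complex x c') * h (Complex x c') \<partial>lborel)"
          unfolding horizontal_integral_def by (simp only: right_diff_distrib)
        also have "\<dots> = horizontal_integral (\<lambda>z. gauss_kernel L z * \<phi> z) c' - horizontal_integral (\<lambda>z. gauss_kernel L z * h z) c'"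
          unfolding horizontal_integral_def
          using c c' \<eta> by (intro Bochner_Integration.integral_diff P_tilde_integrable[OF L assms(3)]
             horizontal_integral_shift(2)[OF L h c]) auto
        finally show ?thesis .
      qed
      show ?thesis
        using hor[of c] hor[of "- c"] horizontal_integral_shift(1)[OF L h c] J\<phi>[of c] c \<eta>
        unfolding Jm by simp
    qed
    then show ?thesis
      using \<eta>(1) by (auto simp: eventually_at_right_field intro!: exI[of _ \<eta>])
  qed
  show ?thesis
    unfolding hyper_pairing_def
  proof (rule the_equality)
    have "(\<delta>, \<phi>) \<in> hyper_class \<delta> \<phi>"
      unfolding hyper_class_def using equiv_class_self[OF equiv_hyper_rel rep] .
    then show "\<exists>(\<delta>, \<phi>)\<in>hyper_class \<delta> \<phi>. \<forall>\<^sub>F c in at_right 0.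
       horizontal_integral (\<lambda>z. - gauss_kernel L z * \<phi> z) c -
       horizontal_integral (\<lambda>z. - gauss_kernel L z * \<phi> z) (- c) = v"
      using ev unfolding J_def by blast
  next
    fix w
    assume "\<exists>(\<delta>, \<phi>)\<in>hyper_class \<delta> \<phi>. \<forall>\<^sub>F c in at_right 0.
       horizontal_integral (\<lambda>z. - gauss_kernel L z * \<phi> z) c -
       horizontal_integral (\<lambda>z. - gauss_kernel L z * \<phi> z) (- c) = w"
    then obtain \<delta>' \<psi> where 1: "(\<delta>', \<psi>) \<in> hyper_class \<delta> \<phi>" "\<forall>\<^sub>F c in at_right 0. J \<psi> c = w"
      unfolding J_def by blast
    have "\<forall>\<^sub>F c in at_right (0::real). w = v"
      using 1(2) ev[OF 1(1)] by eventually_elim simp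
    then show "w = v" by (simp add: eventually_const)
  qed
qed

text \<open>Linear growth is infra-exponential because \<open>(1 + r) * exp (- \<epsilon> * r) \<le> 1 + 1 / \<epsilon>\<close>.\<close>

lemma P_tilde_lowerI:
  assumes hol: "\<phi> holomorphic_on {z. - \<delta> < Im z \<and> Im z < 0}" and zero: "\<And>z. Im z > 0 \<Longrightarrow> \<phi> z = 0"
    and bound: "\<And>\<delta>1. 0 < \<delta>1 \<Longrightarrow> \<exists>C. \<forall>z. Im z \<le> - \<delta>1 \<and> - \<delta> < Im z \<longrightarrow> norm (\<phi> z) \<le> C * (1 + norm z)"
  shows "\<phi> \<in> P_tilde \<delta>"
proof -
  have eq: "strip \<delta> - \<real> = {z. - \<delta> < Im z \<and> Im z < 0} \<union> {z. 0 < Im z \<and> Im z < \<delta>}"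
    unfolding set_eq_iff by (auto simp: strip_def complex_is_Real_iff abs_if split: if_splits)
  have op: "open {z. a < Im z \<and> Im z < b}" for a b
    using open_Int[OF open_halfspace_Im_gt[of a] open_halfspace_Im_lt[of b]] by (simp add: Int_def)
  have "\<phi> holomorphic_on {z. 0 < Im z \<and> Im z < \<delta>}"
    by (rule holomorphic_transform[of "\<lambda>_. 0"]) (auto simp: zero)
  then have "\<phi> holomorphic_on (strip \<delta> - \<real>)"
    unfolding eq by (intro holomorphic_on_Un hol op)
  moreover have "bdd_above ((\<lambda>z. norm (\<phi> z) * exp (- \<epsilon> * norm z)) ` {z. \<delta>1 \<le> \<bar>Im z\<bar> \<and> \<bar>Im z\<bar> \<le> \<delta>2})"
    if e: "\<epsilon> > 0" and d: "0 < \<delta>1" "\<delta>1 < \<delta>2" "\<delta>2 < \<delta>" for \<epsilon> \<delta>1 \<delta>2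
  proof -
    obtain C where C: "\<And>z. Im z \<le> - \<delta>1 \<Longrightarrow> - \<delta> < Im z \<Longrightarrow> norm (\<phi> z) \<le> C * (1 + norm z)"
      using bound[OF d(1)] by blast
    have "norm (\<phi> z) * exp (- \<epsilon> * norm z) \<le> \<bar>C\<bar> * (1 + 1 / \<epsilon>)"
      if z: "\<delta>1 \<le> \<bar>Im z\<bar>" "\<bar>Im z\<bar> \<le> \<delta>2" for z
    proof (cases "Im z > 0")
      case True
      then show ?thesis using e by (simp add: zero)
    next
      case False
      then have "norm (\<phi> z) \<le> C * (1 + norm z)"
        using z d by (intro C) auto
      also have "\<dots> \<le> \<bar>C\<bar> * (1 + norm z)" by (intro mult_right_mono) auto
      finally have "norm (\<phi> z) * exp (- \<epsilon> * norm z) \<le> \<bar>C\<bar> * (1 + norm z) * exp (- \<epsilon> * norm z)"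
        by (rule mult_right_mono) simp
      also have "\<dots> = \<bar>C\<bar> * ((1 + norm z) * exp (- \<epsilon> * norm z))" by simp
      also have "(1 + norm z) * exp (- \<epsilon> * norm z) \<le> 1 + 1 / \<epsilon>"
      proof -
        have "1 + norm z \<le> (1 + 1 / \<epsilon>) * (1 + \<epsilon> * norm z)"
          using e by (simp add: field_simps)
        also have "\<dots> \<le> (1 + 1 / \<epsilon>) * exp (\<epsilon> * norm z)"
          using e by (intro mult_left_mono exp_ge_add_one_self) auto
        finally show ?thesis by (simp add: exp_minus field_simps)
      qed
      finally show ?thesis by (simp add: mult_left_mono)
    qed
    then show ?thesis by (auto simp: bdd_above_def)
  qed
  ultimately show ?thesis by (simp add: P_tilde_def)
qed

section \<open>Logarithms of twisted Euler products\<close>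

lemma sums_neg_Ln_one_minus:
  fixes v :: complex
  assumes "norm v < 1"
  shows "(\<lambda>j. v ^ Suc j / of_nat (Suc j)) sums (- Ln (1 - v))"
proof -
  have "(\<lambda>n. (-1) ^ Suc n / of_nat n * (- v) ^ n) sums ln (1 + (- v))"
    using assms by (intro Ln_series) simp
  then have "(\<lambda>n. - ((-1) ^ Suc n / of_nat n * (- v) ^ n)) sums (- Ln (1 - v))"
    by (intro sums_minus) simp
  moreover have "- ((-1) ^ Suc n / of_nat n * (- v) ^ n) = v ^ n / of_nat n" for n
    by (simp flip: power_mult_distrib)
  ultimately have "(\<lambda>n. v ^ n / of_nat n) sums (- Ln (1 - v))" by (simp only:)
  then show ?thesis by (subst sums_Suc_iff) simp
qed

lemma norm_neg_Ln_one_minus_sub_le: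
  fixes v :: complex
  assumes "norm v < 1"
  shows "norm (- Ln (1 - v) - v) \<le> (norm v)\<^sup>2 / (1 - norm v)"
proof -
  have f: "(\<lambda>j. v ^ Suc (Suc j) / of_nat (Suc (Suc j))) sums (- Ln (1 - v) - v)"
    using sums_neg_Ln_one_minus[OF assms] by (subst sums_Suc_iff) simp
  have g: "(\<lambda>j. (norm v)\<^sup>2 * norm v ^ j) sums ((norm v)\<^sup>2 * (1 / (1 - norm v)))"
    using assms by (intro sums_mult geometric_sums) simp
  have "norm (v ^ Suc (Suc j) / of_nat (Suc (Suc j))) \<le> (norm v)\<^sup>2 * norm v ^ j" for j
  proof -
    have "norm (v ^ Suc (Suc j) / of_nat (Suc (Suc j))) = (norm v)\<^sup>2 * norm v ^ j / real (Suc (Suc j))"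
      by (simp only: norm_divide norm_power norm_of_nat) (simp add: power2_eq_square)
    also have "\<dots> \<le> (norm v)\<^sup>2 * norm v ^ j / 1"
      by (intro divide_left_mono) auto
    finally show ?thesis by simp
  qed
  from norm_suminf_le[OF this sums_summable[OF g]] show ?thesis
    unfolding sums_unique[OF f, symmetric] sums_unique[OF g, symmetric] by simp
qed

lemma norm_nat_powr:
  assumes "n > 0"
  shows "norm (of_nat n powr (s :: complex)) = real n powr Re s"
  using norm_powr_real_powr[of "of_nat n" s] assms by simp

lemma nat_powr_power:
  assumes "p > 0"
  shows "of_nat p powr (- of_nat k * s) = (of_nat p powr (- s :: complex)) ^ k"
  using assms by (simp add: powr_def exp_of_nat_mult[symmetric] mult_ac)

text \<open>If \<open>norm (x p) \<le> 1\<close> and \<open>Re s > 0\<close>, the argument of \<open>Ln\<close> lies in the right half-plane, so the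
  principal branch is the sum of the logarithmic power series in \<open>log_zeta_rand\<close>.\<close>

definition euler_log :: "(nat \<Rightarrow> complex) \<Rightarrow> nat \<Rightarrow> complex \<Rightarrow> complex" where
  "euler_log x p s = (if prime p then - Ln (1 - x p * of_nat p powr (- s)) else 0)"

lemma norm_euler_ratio:
  assumes "prime p" "norm (x p) \<le> 1" "0 < \<sigma>" "\<sigma> \<le> Re s"
  shows "norm (x p * of_nat p powr (- s)) \<le> real p powr (- \<sigma>)"
    and "real p powr (- \<sigma>) \<le> 2 powr (- \<sigma>)" "2 powr (- \<sigma>) < 1"
proof -
  have p: "2 \<le> real p" using prime_ge_2_nat[OF assms(1)] by simp
  have "norm (x p * of_nat p powr (- s)) \<le> 1 * real p powr (- Re s)"
    unfolding norm_mult using p assms(2) by (intro mult_mono) (auto simp: norm_nat_powr)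
  also have "\<dots> \<le> real p powr (- \<sigma>)"
    using p assms by (simp add: powr_mono)
  finally show "norm (x p * of_nat p powr (- s)) \<le> real p powr (- \<sigma>)" .
  show "real p powr (- \<sigma>) \<le> 2 powr (- \<sigma>)"
    using p assms by (intro powr_mono2') auto
  show "2 powr (- \<sigma>) < 1"
    using assms powr_less_mono[of "- \<sigma>" 0 "2"] by simp
qed

lemma norm_euler_ratio_less_1:
  assumes "prime p" "norm (x p) \<le> 1" "0 < Re s"
  shows "norm (x p * of_nat p powr (- s)) < 1"
  using norm_euler_ratio[of p x "Re s" s] assms by linarith

lemma euler_log_sums:
  assumes "prime p" "norm (x p) \<le> 1" "0 < Re s"
  shows "(\<lambda>j. x p ^ Suc j * of_nat p powr (- of_nat (Suc j) * s) / of_nat (Suc j)) sums euler_log x p s"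
proof -
  have p: "p > 0" using assms(1) by (simp add: prime_gt_0_nat)
  show ?thesis
    using sums_neg_Ln_one_minus[OF norm_euler_ratio_less_1[of p x s]] assms
    unfolding nat_powr_power[OF p] power_mult_distrib[symmetric] euler_log_def by simp
qed

lemma log_zeta_rand_eq_suminf:
  assumes "\<And>p. prime p \<Longrightarrow> norm (x p) \<le> 1" "0 < Re s"
  shows "log_zeta_rand x s = (\<Sum>p. euler_log x p s)"
  unfolding log_zeta_rand_def
  using euler_log_sums[of _ x s] assms
  by (intro suminf_cong) (auto simp: sums_iff euler_log_def)

lemma holomorphic_on_euler_log:
  assumes "\<And>p. prime p \<Longrightarrow> norm (x p) \<le> 1"
  shows "euler_log x p holomorphic_on {s. Re s > 0}"
proof (cases "prime p")
  case True
  then have p: "p > 0" by (simp add: prime_gt_0_nat)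
  have *: "1 - x p * of_nat p powr (- s) \<notin> \<real>\<^sub>\<le>\<^sub>0" if "Re s > 0" for s
  proof -
    have "Re (x p * of_nat p powr (- s)) < 1"
      using norm_euler_ratio_less_1[of p x s] complex_Re_le_cmod[of "x p * of_nat p powr (- s)"]
        assms that True by fastforce
    then show ?thesis by (auto simp: complex_nonpos_Reals_iff)
  qed
  have "(\<lambda>s. - Ln (1 - x p * of_nat p powr (- s))) holomorphic_on {s. Re s > 0}"
    using * p by (intro holomorphic_intros) auto
  then show ?thesis using True by (simp add: euler_log_def[abs_def])
qed (simp add: euler_log_def[abs_def])

lemma norm_powr_diff_Suc_le:
  assumes "n > 0" "0 \<le> \<sigma>" "\<sigma> \<le> Re s"
  shows "norm (of_nat n powr (- s) - of_nat (Suc n) powr (- s :: complex)) \<le> norm s * real n powr (- \<sigma> - 1)"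
proof -
  define S where "S = closed_segment (of_nat n :: complex) (of_nat (Suc n))"
  have S: "\<exists>t\<ge>real n. z = of_real t" if "z \<in> S" for z
  proof -
    obtain u where u: "0 \<le> u" "u \<le> 1" "z = (1 - u) *\<^sub>R of_nat n + u *\<^sub>R of_nat (Suc n)"
      using \<open>z \<in> S\<close> by (auto simp: closed_segment_def S_def)
    have "z = of_real (real n + u)" using u by (simp add: scaleR_conv_of_real algebra_simps)
    then show ?thesis using u by (intro exI[of _ "real n + u"]) auto
  qed
  have "norm ((of_nat n :: complex) powr (- s) - of_nat (Suc n) powr (- s)) \<le>
      (norm s * real n powr (- \<sigma> - 1)) * norm (of_nat n - of_nat (Suc n) :: complex)"
  proof (rule field_differentiable_bound[where f = "\<lambda>z. z powr (- s)" and S = S and f' = "\<lambda>z. - s * z powr (- s - 1)"])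
    show "convex S" by (simp add: S_def)
    fix z assume z: "z \<in> S"
    obtain t where t: "t \<ge> real n" "z = of_real t" using S[OF z] by blast
    have "z \<notin> \<real>\<^sub>\<le>\<^sub>0" using t assms by auto
    then show "((\<lambda>z. z powr (- s)) has_field_derivative - s * z powr (- s - 1)) (at z within S)"
      by (intro has_field_derivative_powr[THEN has_field_derivative_at_within])
    have "norm (z powr (- s - 1)) = t powr (- Re s - 1)"
      using norm_powr_real_powr[of z "- s - 1"] t assms by simp
    also have "\<dots> \<le> t powr (- \<sigma> - 1)" using t assms by (intro powr_mono) auto
    also have "\<dots> \<le> real n powr (- \<sigma> - 1)" using t assms by (intro powr_mono2') auto
    finally show "norm (- s * z powr (- s - 1)) \<le> norm s * real n powr (- \<sigma> - 1)"
      by (simp add: norm_mult mult_left_mono)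
  qed (auto simp: S_def)
  then show ?thesis by simp
qed

lemma sum_by_parts:
  fixes a f :: "nat \<Rightarrow> 'a :: comm_ring"
  shows "(\<Sum>n<N. a n * f n) = (\<Sum>n<N. (\<Sum>m\<le>n. a m) * (f n - f (Suc n))) + (\<Sum>m<N. a m) * f N"
  by (induction N) (simp_all add: algebra_simps flip: lessThan_Suc_atMost)

text \<open>
  The exponent \<open>\<theta>\<close> bounds the abscissa of convergence. It can be any number above 1/2 for Steinhaus
  variables, and it is 1 for the constant sequence, which gives the logarithm of the zeta
  function.\<close>

context
  fixes x :: "nat \<Rightarrow> complex" and \<theta> C :: real
  assumes theta: "1/2 \<le> \<theta>"
    and bounded: "\<And>p. prime p \<Longrightarrow> norm (x p) \<le> 1"
    and growth: "\<And>n. norm (\<Sum>p\<le>n. if prime p then x p else 0) \<le> C * real n powr \<theta>"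
begin

text \<open>The prime powers with exponent at least 2 form an absolutely convergent series since
  \<open>2 * Re s > 1\<close>; the primes themselves are summed by parts. This writes the partial sums as partial sums of a
  series with majorant \<open>m n * (1 + norm s)\<close> plus a boundary term \<open>B n s\<close> that tends to 0. The
  bounds are uniform in a half-plane and yield both locally uniform convergence and linear growth.\<close>

lemma euler_log_abel_bounds:
  assumes eta: "\<eta> > 0"
  shows "\<exists>m D B. summable m \<and> (\<forall>n. 0 \<le> m n) \<and> (\<forall>n s. \<theta> + \<eta> \<le> Re s \<longrightarrow>
      norm (D n s) \<le> m n * (1 + norm s) \<and> norm (B n s) \<le> C * real n powr (- \<eta>) \<and>
      (\<Sum>p<n. euler_log x p s) = (\<Sum>k<n. D k s) + B n s)"
proof -
  define a where "a = (\<lambda>n. if prime n then x n else 0)"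
  define \<sigma> where "\<sigma> = \<theta> + \<eta>"
  define q where "q = 1 / (1 - 2 powr (- \<sigma>))"
  have \<sigma>: "0 < \<sigma>" "1/2 \<le> \<sigma>" using theta eta by (auto simp: \<sigma>_def)
  have C: "C \<ge> 0" using growth[of 1] by (simp add: order_trans[OF norm_ge_zero])
  define f where "f = (\<lambda>n s. (of_nat n :: complex) powr (- s))"
  define D where "D = (\<lambda>n s. (euler_log x n s - a n * f n s) + (\<Sum>m\<le>n. a m) * (f n s - f (Suc n) s))"
  define B where "B = (\<lambda>n s. (\<Sum>m<n. a m) * f n s)"
  define m where "m = (\<lambda>n. q * real n powr (- 1 - 2 * \<eta>) + C * real n powr (- 1 - \<eta>))"
  have q: "q \<ge> 0"
  proof -
    have "2 powr (- \<sigma>) < (1::real)" using \<sigma> powr_less_mono[of "- \<sigma>" 0 2] by simp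
    then show ?thesis by (simp add: q_def)
  qed
  have sm: "summable m"
    unfolding m_def using eta
    by (intro summable_add summable_mult) (auto simp: summable_real_powr_iff)
  have "norm (D n s) \<le> m n * (1 + norm s) \<and> norm (B n s) \<le> C * real n powr (- \<eta>) \<and>
      (\<Sum>p<n. euler_log x p s) = (\<Sum>k<n. D k s) + B n s" if s: "\<theta> + \<eta> \<le> Re s" for n s
  proof (intro conjI)
    from s have s': "\<sigma> \<le> Re s" by (simp add: \<sigma>_def)
    have 1: "norm (euler_log x n s - a n * f n s) \<le> q * real n powr (- 1 - 2 * \<eta>)"
    proof (cases "prime n")
      case True
      then have n: "real n \<ge> 2" using prime_ge_2_nat[of n] by simp
      define v where "v = x n * f n s"
      have v: "norm v \<le> real n powr (- \<sigma>)" "real n powr (- \<sigma>) \<le> 2 powr (- \<sigma>)" "2 powr (- \<sigma>) < (1::real)"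
        using norm_euler_ratio[of n x \<sigma> s] True bounded \<sigma> s' by (auto simp: v_def f_def)
      have "norm (euler_log x n s - a n * f n s) = norm (- Ln (1 - v) - v)"
        using True by (simp add: euler_log_def a_def v_def f_def)
      also have "\<dots> \<le> (norm v)\<^sup>2 / (1 - norm v)"
        using v by (intro norm_neg_Ln_one_minus_sub_le) linarith
      also have "\<dots> \<le> (real n powr (- \<sigma>))\<^sup>2 / (1 - 2 powr (- \<sigma>))"
        using v by (intro frac_le power_mono) auto
      also have "(real n powr (- \<sigma>))\<^sup>2 = real n powr (- 2 * \<sigma>)"
        using n by (simp flip: powr_realpow add: powr_powr mult.commute)
      also have "\<dots> \<le> real n powr (- 1 - 2 * \<eta>)"
        using n theta by (intro powr_mono) (auto simp: \<sigma>_def)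
      finally show ?thesis
        using v by (simp add: q_def divide_right_mono)
    next
      case False
      then show ?thesis using q by (simp add: euler_log_def a_def)
    qed
    have gr: "norm (\<Sum>m\<le>n. a m) \<le> C * real n powr \<theta>" for n
      using growth[of n] unfolding a_def by simp
    have 2: "norm ((\<Sum>m\<le>n. a m) * (f n s - f (Suc n) s)) \<le> C * real n powr (- 1 - \<eta>) * norm s"
    proof (cases "n = 0")
      case False
      then have "norm ((\<Sum>m\<le>n. a m) * (f n s - f (Suc n) s)) \<le> (C * real n powr \<theta>) * (norm s * real n powr (- \<sigma> - 1))"
        unfolding norm_mult f_def using s' \<sigma> gr C
        by (intro mult_mono norm_powr_diff_Suc_le) auto
      also have "\<dots> = C * (real n powr \<theta> * real n powr (- \<sigma> - 1)) * norm s" by simp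
      also have "real n powr \<theta> * real n powr (- \<sigma> - 1) = real n powr (- 1 - \<eta>)"
        by (simp add: \<sigma>_def algebra_simps flip: powr_add)
      finally show ?thesis .
    qed (simp add: a_def)
    have "norm (D n s) \<le> q * real n powr (- 1 - 2 * \<eta>) + C * real n powr (- 1 - \<eta>) * norm s"
      unfolding D_def using 1 2 by (rule norm_triangle_mono)
    also have "\<dots> \<le> m n * (1 + norm s)"
      using q C by (simp add: m_def algebra_simps)
    finally show "norm (D n s) \<le> m n * (1 + norm s)" .
    show "norm (B n s) \<le> C * real n powr (- \<eta>)"
    proof (cases n)
      case (Suc k)
      have "norm (B n s) \<le> (C * real n powr \<theta>) * real n powr (- \<sigma>)"
        unfolding B_def norm_mult
      proof (rule mult_mono)
        have "norm (\<Sum>m<n. a m) \<le> C * real k powr \<theta>"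
          using gr[of k] Suc by (simp add: lessThan_Suc_atMost)
        also have "\<dots> \<le> C * real n powr \<theta>"
          using Suc theta C by (intro mult_left_mono powr_mono2) auto
        finally show "norm (\<Sum>m<n. a m) \<le> C * real n powr \<theta>" .
        show "norm (f n s) \<le> real n powr (- \<sigma>)"
          using Suc s' by (simp add: f_def norm_nat_powr powr_mono del: of_nat_Suc)
      qed (use C in auto)
      also have "\<dots> = C * real n powr (- \<eta>)" by (simp add: \<sigma>_def flip: powr_add)
      finally show ?thesis .
    qed (simp add: B_def)
    show "(\<Sum>p<n. euler_log x p s) = (\<Sum>k<n. D k s) + B n s"
    proof -
      have "(\<Sum>k<n. D k s) + B n s = (\<Sum>k<n. euler_log x k s) - (\<Sum>k<n. a k * f k s) +
         ((\<Sum>k<n. (\<Sum>m\<le>k. a m) * (f k s - f (Suc k) s)) + (\<Sum>m<n. a m) * f n s)"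
        unfolding D_def B_def by (simp add: sum.distrib sum_subtractf)
      then show ?thesis
        using sum_by_parts[of a "\<lambda>k. f k s" n] by simp
    qed
  qed
  moreover have "0 \<le> m n" for n using q C by (simp add: m_def)
  ultimately show ?thesis using sm by blast
qed

lemma euler_log_partial_sums_bound:
  assumes "\<eta> > 0"
  shows "\<exists>K. \<forall>N s. \<theta> + \<eta> \<le> Re s \<longrightarrow> norm (\<Sum>p<N. euler_log x p s) \<le> K * (1 + norm s)"
proof -
  obtain m D and B :: "nat \<Rightarrow> complex \<Rightarrow> complex" where m: "summable m" and m0: "\<And>n. 0 \<le> m n"
    and D: "\<And>n s. \<theta> + \<eta> \<le> Re s \<Longrightarrow> norm (D n s) \<le> m n * (1 + norm s)"
    and B: "\<And>n s. \<theta> + \<eta> \<le> Re s \<Longrightarrow> norm (B n s) \<le> C * real n powr (- \<eta>)"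
    and S: "\<And>N s. \<theta> + \<eta> \<le> Re s \<Longrightarrow> (\<Sum>p<N. euler_log x p s) = (\<Sum>n<N. D n s) + B N s"
    using euler_log_abel_bounds[OF assms] by blast
  have C: "C \<ge> 0" using growth[of 1] by (simp add: order_trans[OF norm_ge_zero])
  show ?thesis
  proof (intro exI allI impI)
    fix N s assume s: "\<theta> + \<eta> \<le> Re s"
    have "norm (\<Sum>n<N. D n s) \<le> (\<Sum>n<N. m n * (1 + norm s))"
      by (rule order_trans[OF norm_sum sum_mono]) (rule D[OF s])
    also have "\<dots> = (\<Sum>n<N. m n) * (1 + norm s)" by (simp add: sum_distrib_right)
    also have "\<dots> \<le> suminf m * (1 + norm s)"
      by (intro mult_right_mono sum_le_suminf m) (auto simp: m0)
    finally have 1: "norm (\<Sum>n<N. D n s) \<le> suminf m * (1 + norm s)" .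
    have "real N powr (- \<eta>) \<le> 1"
      using assms powr_mono[of "- \<eta>" 0 "real N"] by (cases "N = 0") auto
    then have "C * real N powr (- \<eta>) \<le> C * (1 + norm s)"
      using C by (intro mult_left_mono) (auto intro: order_trans)
    then have 2: "norm (B N s) \<le> C * (1 + norm s)" using B[OF s, of N] by linarith
    show "norm (\<Sum>p<N. euler_log x p s) \<le> (suminf m + C) * (1 + norm s)"
      unfolding S[OF s] using norm_triangle_mono[OF 1 2] by (simp add: algebra_simps)
  qed
qed

lemma euler_log_uniform_limit:
  assumes "\<eta> > 0"
  shows "uniform_limit {s. \<theta> + \<eta> \<le> Re s \<and> norm s \<le> R} (\<lambda>N s. \<Sum>p<N. euler_log x p s)
           (log_zeta_rand x) sequentially"
proof -
  define A where "A = {s. \<theta> + \<eta> \<le> Re s \<and> norm s \<le> R}"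
  obtain m D and B :: "nat \<Rightarrow> complex \<Rightarrow> complex" where m: "summable m" and m0: "\<And>n. 0 \<le> m n"
    and D: "\<And>n s. \<theta> + \<eta> \<le> Re s \<Longrightarrow> norm (D n s) \<le> m n * (1 + norm s)"
    and B: "\<And>n s. \<theta> + \<eta> \<le> Re s \<Longrightarrow> norm (B n s) \<le> C * real n powr (- \<eta>)"
    and S: "\<And>N s. \<theta> + \<eta> \<le> Re s \<Longrightarrow> (\<Sum>p<N. euler_log x p s) = (\<Sum>n<N. D n s) + B N s"
    using euler_log_abel_bounds[OF assms] by blast
  have "uniform_limit A (\<lambda>N s. \<Sum>n<N. D n s) (\<lambda>s. \<Sum>n. D n s) sequentially"
  proof (rule Weierstrass_m_test)
    show "summable (\<lambda>n. m n * (1 + \<bar>R\<bar>))" by (intro summable_mult2 m)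
    fix n s assume s: "s \<in> A"
    then have "norm (D n s) \<le> m n * (1 + norm s)" by (intro D) (auto simp: A_def)
    also have "\<dots> \<le> m n * (1 + \<bar>R\<bar>)" using s m0[of n] by (intro mult_left_mono) (auto simp: A_def)
    finally show "norm (D n s) \<le> m n * (1 + \<bar>R\<bar>)" .
  qed
  moreover have "uniform_limit A B (\<lambda>_. 0) sequentially"
  proof (rule uniform_limit_null_comparison[where g = "\<lambda>n _. C * real n powr (- \<eta>)"])
    show "\<forall>\<^sub>F n in sequentially. \<forall>s\<in>A. norm (B n s) \<le> C * real n powr (- \<eta>)"
      using B by (auto simp: A_def)
    have "(\<lambda>n. C * real n powr (- \<eta>)) \<longlonglongrightarrow> 0" using assms by real_asymp
    then show "uniform_limit A (\<lambda>n _. C * real n powr (- \<eta>)) (\<lambda>_. 0) sequentially"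
      unfolding uniform_limit_iff tendsto_iff by (auto elim!: eventually_mono)
  qed
  ultimately have *: "uniform_limit A (\<lambda>N s. (\<Sum>n<N. D n s) + B N s) (\<lambda>s. (\<Sum>n. D n s) + 0) sequentially"
    by (rule uniform_limit_add)
  have U: "uniform_limit A (\<lambda>N s. \<Sum>p<N. euler_log x p s) (\<lambda>s. (\<Sum>n. D n s) + 0) sequentially"
    by (rule uniform_limit_cong'[THEN iffD2, OF _ _ *]) (auto simp: S A_def)
  have eq: "(\<Sum>n. D n s) + 0 = log_zeta_rand x s" if "s \<in> A" for s
  proof -
    have "(\<lambda>N. \<Sum>p<N. euler_log x p s) \<longlonglongrightarrow> (\<Sum>n. D n s) + 0"
      using tendsto_uniform_limitI[OF U that] .
    moreover have "Re s > 0" using that theta assms by (auto simp: A_def)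
    ultimately show ?thesis
      using log_zeta_rand_eq_suminf[of x s] bounded by (simp add: sums_def[symmetric] sums_iff)
  qed
  show ?thesis
    unfolding A_def[symmetric] by (rule uniform_limit_cong'[THEN iffD1, OF _ _ U]) (use eq in auto)
qed

lemma log_zeta_rand_limit:
  assumes "\<theta> < Re s"
  shows "(\<lambda>N. \<Sum>p<N. euler_log x p s) \<longlonglongrightarrow> log_zeta_rand x s"
  using assms
  by (intro tendsto_uniform_limitI[OF euler_log_uniform_limit[of "Re s - \<theta>" "norm s"]]) auto

lemma log_zeta_rand_bound:
  assumes "\<eta> > 0"
  shows "\<exists>K. \<forall>s. \<theta> + \<eta> \<le> Re s \<longrightarrow> norm (log_zeta_rand x s) \<le> K * (1 + norm s)"
proof -
  obtain K where K: "\<And>N s. \<theta> + \<eta> \<le> Re s \<Longrightarrow> norm (\<Sum>p<N. euler_log x p s) \<le> K * (1 + norm s)"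
    using euler_log_partial_sums_bound[OF assms] by blast
  show ?thesis
  proof (intro exI allI impI)
    fix s assume s: "\<theta> + \<eta> \<le> Re s"
    show "norm (log_zeta_rand x s) \<le> K * (1 + norm s)"
      by (rule LIMSEQ_le_const2[OF tendsto_norm[OF log_zeta_rand_limit]])
         (use s assms K in auto)
  qed
qed

lemma holomorphic_on_log_zeta_rand: "log_zeta_rand x holomorphic_on {s. Re s > \<theta>}"
proof (rule holomorphic_uniform_sequence)
  show "open {s. Re s > \<theta>}" by (rule open_halfspace_Re_gt)
  show "(\<lambda>s. \<Sum>p<N. euler_log x p s) holomorphic_on {s. Re s > \<theta>}" for N
    using holomorphic_on_euler_log[of x] bounded theta
    by (intro holomorphic_on_sum holomorphic_on_subset[OF holomorphic_on_euler_log]) auto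
  fix s assume s: "s \<in> {s. Re s > \<theta>}"
  define d where "d = (Re s - \<theta>) / 2"
  have d: "d > 0" "\<theta> + d + d = Re s" using s by (auto simp: d_def field_simps)
  have sub: "cball s d \<subseteq> {w. \<theta> + d \<le> Re w \<and> norm w \<le> norm s + d}"
  proof
    fix w assume "w \<in> cball s d"
    then have w: "norm (s - w) \<le> d" by (simp add: dist_norm)
    have "Re s - Re w \<le> d" using w abs_Re_le_cmod[of "s - w"] by simp
    moreover have "norm w \<le> norm s + d" using w norm_triangle_ineq4[of s "s - w"] by simp
    ultimately show "w \<in> {w. \<theta> + d \<le> Re w \<and> norm w \<le> norm s + d}" using d by simp
  qed
  have "uniform_limit (cball s d) (\<lambda>N s. \<Sum>p<N. euler_log x p s) (log_zeta_rand x) sequentially"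
    by (rule uniform_limit_on_subset[OF euler_log_uniform_limit[OF d(1)] sub])
  moreover have "cball s d \<subseteq> {s. Re s > \<theta>}" using sub d(1) by force
  ultimately show "\<exists>d>0. cball s d \<subseteq> {s. Re s > \<theta>} \<and>
      uniform_limit (cball s d) (\<lambda>N s. \<Sum>p<N. euler_log x p s) (log_zeta_rand x) sequentially"
    using d(1) by blast
qed

end

section \<open>The pairings as explicit series\<close>

lemma horizontal_integral_cong:
  assumes "\<And>x. F (Complex x c) = G (Complex x c)"
  shows "horizontal_integral F c = horizontal_integral G c"
  unfolding horizontal_integral_def using assms by simp

text \<open>The pairing of the kernel with the logarithm of one Euler factor. The damping \<open>b\<close> is \<open>1 / (2 * L)\<close>
  for the random series on the line \<open>a = 1/2\<close>; the case \<open>a = 1\<close>, \<open>b = 1 / L\<close> occurs in the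
  weights that compensate the local moments; and \<open>b = 0\<close> gives back the undamped logarithm.\<close>

definition damped_log :: "real \<Rightarrow> real \<Rightarrow> nat \<Rightarrow> complex \<Rightarrow> complex" where
  "damped_log a b p y = (\<Sum>j. y ^ Suc j * of_real (real p powr (- (a * real (Suc j))) *
     exp (- (b * (real (Suc j) * ln (real p))\<^sup>2))) / of_nat (Suc j))"

lemma summable_ratio_powers:
  fixes a :: "nat \<Rightarrow> real"
  assumes "\<And>j. a j \<le> C * r ^ Suc j" "\<And>j. 0 \<le> a j" "0 \<le> r" "r < 1"
  shows "summable a"
proof (rule summable_comparison_test')
  show "summable (\<lambda>j. C * r ^ Suc j)"
    using assms by (intro summable_mult) (subst summable_Suc_iff, simp add: summable_geometric)
  show "norm (a j) \<le> C * r ^ Suc j" for j using assms(1,2)[of j] by simp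
qed

text \<open>The scale \<open>t\<close> is 1 for the random series. It varies in the comparison with the zeta function, where
  the line approaches the pole as the damping disappears.\<close>

lemma euler_log_line_integral:
  assumes p: "prime p" and x: "norm (x p) \<le> 1" and L: "L > 0" and ac: "a + t * c > 0"
  shows "horizontal_integral (\<lambda>z. gauss_kernel L z * euler_log x p (of_real a + \<i> * of_real t * z)) (- c)
           = damped_log a (t\<^sup>2 / (2 * L)) p (x p)"
    and "integrable lborel (\<lambda>y. gauss_kernel L (Complex y (- c)) *
            euler_log x p (of_real a + \<i> * of_real t * Complex y (- c)))"
proof -
  have p0: "p > 0" "real p > 1" using prime_gt_0_nat[OF p] prime_gt_1_nat[OF p] by auto
  define A where "A = (\<lambda>j. x p ^ Suc j * of_real (real p powr (- (a * real (Suc j)))) / of_nat (Suc j))"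
  define u where "u = (\<lambda>j. t * (real (Suc j) * ln (real p)))"
  define r where "r = real p powr (- (a + t * c))"
  have r: "0 \<le> r" "r < 1" using p0 ac by (auto simp: r_def powr_less_one)
  have Re: "0 < Re (of_real a + \<i> * of_real t * Complex y (- c))" for y using ac by simp
  have trm: "x p ^ Suc j * of_nat p powr (- of_nat (Suc j) * (of_real a + \<i> * of_real t * z)) / of_nat (Suc j)
      = A j * exp (- \<i> * of_real (u j) * z)" for j z
  proof -
    have "- of_nat (Suc j) * (of_real a + \<i> * of_real t * z) * of_real (ln (real p)) =
       of_real (- (a * real (Suc j)) * ln (real p)) + (- \<i> * of_real (u j) * z)"
      by (simp add: u_def algebra_simps)
    moreover have "of_nat p powr w = exp (w * of_real (ln (real p)))" for w :: complex
      using p0 by (simp add: powr_def Ln_of_nat)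
    moreover have "real p powr (- (a * real (Suc j))) = exp (- (a * real (Suc j)) * ln (real p))"
      using p0 by (simp add: powr_def)
    ultimately have "of_nat p powr (- of_nat (Suc j) * (of_real a + \<i> * of_real t * z)) =
       of_real (real p powr (- (a * real (Suc j)))) * exp (- \<i> * of_real (u j) * z)"
      by (simp only: exp_add exp_of_real)
    then show ?thesis by (simp add: A_def)
  qed
  have eq: "euler_log x p (of_real a + \<i> * of_real t * Complex y (- c)) =
      (\<Sum>j. A j * exp (- \<i> * of_real (u j) * Complex y (- c)))" for y
    using euler_log_sums[of p x, OF p x Re[of y]] unfolding trm by (simp only: sums_iff)
  have "norm (A j) * exp (u j * (- c)) \<le> 1 * r ^ Suc j" for j
  proof -
    have "norm (A j) = norm (x p) ^ Suc j * real p powr (- (a * real (Suc j))) / real (Suc j)"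
      unfolding A_def norm_mult norm_divide norm_power norm_of_nat norm_of_real by simp
    also have "\<dots> \<le> 1 * real p powr (- (a * real (Suc j))) / 1"
      using x by (intro frac_le mult_mono power_le_one) auto
    finally have "norm (A j) * exp (u j * (- c)) \<le> real p powr (- (a * real (Suc j))) * exp (u j * (- c))"
      by (simp add: mult_right_mono)
    also have "\<dots> = r ^ Suc j"
      using p0 by (simp add: r_def u_def powr_def exp_of_nat_mult[symmetric] exp_add[symmetric] algebra_simps
           del: power_Suc of_nat_Suc)
    finally show ?thesis by simp
  qed
  then have sm: "summable (\<lambda>j. norm (A j) * exp (u j * (- c)))"
    by (rule summable_ratio_powers) (use r in auto)
  have "horizontal_integral (\<lambda>z. gauss_kernel L z * euler_log x p (of_real a + \<i> * of_real t * z)) (- c)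
      = horizontal_integral (\<lambda>z. gauss_kernel L z * (\<Sum>j. A j * exp (- \<i> * of_real (u j) * z))) (- c)"
    by (rule horizontal_integral_cong) (simp only: eq)
  also have "\<dots> = (\<Sum>j. A j * of_real (exp (- (u j)\<^sup>2 / (2 * L))))"
    by (rule horizontal_integral_exp_series(1)[OF L sm])
  also have "\<dots> = damped_log a (t\<^sup>2 / (2 * L)) p (x p)"
    unfolding damped_log_def A_def u_def by (simp add: power_mult_distrib mult_ac)
  finally show "horizontal_integral (\<lambda>z. gauss_kernel L z * euler_log x p (of_real a + \<i> * of_real t * z)) (- c)
           = damped_log a (t\<^sup>2 / (2 * L)) p (x p)" .
  show "integrable lborel (\<lambda>y. gauss_kernel L (Complex y (- c)) *
            euler_log x p (of_real a + \<i> * of_real t * Complex y (- c)))"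
  proof (rule integrable_gauss_kernel_mult[OF L, where C = "\<Sum>j. norm (A j) * exp (u j * (- c))"
       and F = "\<lambda>z. euler_log x p (of_real a + \<i> * of_real t * z)"])
    have nrm: "norm (A j * exp (- \<i> * of_real (u j) * Complex y (- c))) = norm (A j) * exp (u j * (- c))" for j y
      unfolding norm_mult norm_exp_line ..
    have m: "(\<lambda>y. A j * exp (- \<i> * of_real (u j) * Complex y (- c))) \<in> borel_measurable borel" for j
      by (intro borel_measurable_continuous_onI continuous_intros)
    show "(\<lambda>y. euler_log x p (of_real a + \<i> * of_real t * Complex y (- c))) \<in> borel_measurable borel"
      unfolding eq using m by measurable
    fix y
    have "norm (euler_log x p (of_real a + \<i> * of_real t * Complex y (- c))) \<le> (\<Sum>j. norm (A j) * exp (u j * (- c)))"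
      unfolding eq by (rule norm_suminf_le[OF _ sm]) (simp only: nrm order_refl)
    also have "\<dots> \<le> (\<Sum>j. norm (A j) * exp (u j * (- c))) * exp \<bar>y\<bar>"
      using mult_left_mono[of 1 "exp \<bar>y\<bar>"] suminf_nonneg[OF sm] by simp
    finally show "norm (euler_log x p (of_real a + \<i> * of_real t * Complex y (- c)))
       \<le> (\<Sum>j. norm (A j) * exp (u j * (- c))) * exp \<bar>y\<bar>" .
  qed
qed

text \<open>The sum over the primes may converge only conditionally on the line, but its partial sums grow at
  most linearly there, which suffices for dominated convergence.\<close>

lemma log_zeta_rand_line_integral:
  assumes theta: "1/2 \<le> \<theta>"
    and bounded: "\<And>p. prime p \<Longrightarrow> norm (x p) \<le> 1"
    and growth: "\<And>n. norm (\<Sum>p\<le>n. if prime p then x p else 0) \<le> C * real n powr \<theta>"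
    and L: "L > 0" and ac: "\<theta> < a + t * c"
  shows "(\<lambda>p. if prime p then damped_log a (t\<^sup>2 / (2 * L)) p (x p) else 0) sums
     horizontal_integral (\<lambda>z. gauss_kernel L z * log_zeta_rand x (of_real a + \<i> * of_real t * z)) (- c)"
proof -
  define s where "s = (\<lambda>z. of_real a + \<i> * of_real t * z)"
  define S where "S = (\<lambda>N z. \<Sum>p<N. euler_log x p (s z))"
  have Re_s: "Re (s (Complex y (- c))) = a + t * c" for y by (simp add: s_def)
  have pos: "a + t * c > 0" using theta ac by simp
  obtain K where K: "\<And>N w. \<theta> + (a + t * c - \<theta>) \<le> Re w \<Longrightarrow> norm (\<Sum>p<N. euler_log x p w) \<le> K * (1 + norm w)"
    using euler_log_partial_sums_bound[OF theta bounded growth, of "a + t * c - \<theta>"] ac by auto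
  define K' where "K' = \<bar>K\<bar> * (1 + \<bar>a + t * c\<bar> + \<bar>t\<bar>)"
  have hor: "horizontal_integral (\<lambda>z. gauss_kernel L z * S N z) (- c) =
     (\<Sum>p<N. if prime p then damped_log a (t\<^sup>2 / (2 * L)) p (x p) else 0)" for N
  proof -
    have "horizontal_integral (\<lambda>z. gauss_kernel L z * S N z) (- c) =
       (\<Sum>p<N. horizontal_integral (\<lambda>z. gauss_kernel L z * euler_log x p (s z)) (- c))"
      unfolding horizontal_integral_def S_def sum_distrib_left
    proof (rule Bochner_Integration.integral_sum)
      fix p
      show "integrable lborel (\<lambda>y. gauss_kernel L (Complex y (- c)) * euler_log x p (s (Complex y (- c))))"
      proof (cases "prime p")
        case True
        then show ?thesis using euler_log_line_integral(2)[of p x L a t c] bounded L pos by (simp add: s_def)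
      qed (simp add: euler_log_def)
    qed
    also have "\<dots> = (\<Sum>p<N. if prime p then damped_log a (t\<^sup>2 / (2 * L)) p (x p) else 0)"
    proof (intro sum.cong refl)
      fix p
      show "horizontal_integral (\<lambda>z. gauss_kernel L z * euler_log x p (s z)) (- c) =
         (if prime p then damped_log a (t\<^sup>2 / (2 * L)) p (x p) else 0)"
      proof (cases "prime p")
        case True
        then show ?thesis using euler_log_line_integral(1)[of p x L a t c] bounded L pos by (simp add: s_def)
      qed (simp add: euler_log_def horizontal_integral_def)
    qed
    finally show ?thesis .
  qed
  have "(\<lambda>N. horizontal_integral (\<lambda>z. gauss_kernel L z * S N z) (- c)) \<longlonglongrightarrow>
     horizontal_integral (\<lambda>z. gauss_kernel L z * log_zeta_rand x (s z)) (- c)"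
  proof (rule horizontal_integral_limit[OF L, where C = K'])
    show "(\<lambda>y. S N (Complex y (- c))) \<in> borel_measurable borel" for N
    proof (rule holomorphic_horizontal_measurable)
      show "S N holomorphic_on {z. Re (s z) > 0}"
      proof -
        have "s holomorphic_on {z. Re (s z) > 0}" unfolding s_def by (intro holomorphic_intros)
        then have "(euler_log x p \<circ> s) holomorphic_on {z. Re (s z) > 0}" for p
          using holomorphic_on_euler_log[of x p, OF bounded] by (rule holomorphic_on_compose_gen) auto
        then have "(\<lambda>z. euler_log x p (s z)) holomorphic_on {z. Re (s z) > 0}" for p
          by (simp add: o_def)
        then show ?thesis unfolding S_def by (intro holomorphic_on_sum)
      qed
    qed (use pos Re_s in auto)
    show "(\<lambda>N. S N (Complex y (- c))) \<longlonglongrightarrow> log_zeta_rand x (s (Complex y (- c)))" for y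
      unfolding S_def by (rule log_zeta_rand_limit[OF theta bounded growth]) (use ac Re_s in auto)
    fix N y
    have "norm (S N (Complex y (- c))) \<le> K * (1 + norm (s (Complex y (- c))))"
      unfolding S_def by (rule K) (simp add: Re_s)
    also have "\<dots> \<le> \<bar>K\<bar> * ((1 + \<bar>a + t * c\<bar> + \<bar>t\<bar>) * exp \<bar>y\<bar>)"
    proof (intro mult_mono)
      have "norm (s (Complex y (- c))) \<le> \<bar>a + t * c\<bar> + \<bar>t\<bar> * \<bar>y\<bar>"
        using cmod_le[of "s (Complex y (- c))"] by (simp add: s_def abs_mult)
      also have "\<dots> \<le> \<bar>a + t * c\<bar> * exp \<bar>y\<bar> + \<bar>t\<bar> * exp \<bar>y\<bar>"
        using exp_ge_add_one_self[of "\<bar>y\<bar>", THEN order_trans[rotated], of "\<bar>y\<bar>"]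
          mult_left_mono[of 1 "exp \<bar>y\<bar>" "\<bar>a + t * c\<bar>"] by (intro add_mono mult_left_mono) auto
      finally show "1 + norm (s (Complex y (- c))) \<le> (1 + \<bar>a + t * c\<bar> + \<bar>t\<bar>) * exp \<bar>y\<bar>"
        using one_le_exp_iff[of "\<bar>y\<bar>"] unfolding distrib_right by linarith
    qed auto
    finally show "norm (S N (Complex y (- c))) \<le> K' * exp \<bar>y\<bar>" by (simp add: K'_def mult_ac)
  qed
  then show ?thesis
    unfolding hor s_def sums_def .
qed

text \<open>For each \<open>c > 0\<close> the line integral at height \<open>- c\<close> stays to the right of some admissible abscissa
  \<open>\<theta> > 1/2\<close>, and its value, a series in which \<open>c\<close> no longer occurs, is the same for all \<open>c\<close>.\<close>

lemma hyper_pairing_log_zeta_rand: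
  assumes bounded: "\<And>p. prime p \<Longrightarrow> norm (x p) \<le> 1"
    and growth: "\<And>\<theta>. 1/2 < \<theta> \<Longrightarrow> \<exists>C. \<forall>n. norm (\<Sum>p\<le>n. if prime p then x p else 0) \<le> C * real n powr \<theta>"
    and L: "L > 0"
  shows "(\<lambda>p. if prime p then damped_log (1/2) (1 / (2 * L)) p (x p) else 0) sums
     hyper_pairing (\<lambda>z. - gauss_kernel L z) (log_zeta_rand_hyper x)"
proof -
  define v where "v = (\<Sum>p. if prime p then damped_log (1/2) (1 / (2 * L)) p (x p) else 0)"
  have S: "(\<lambda>p. if prime p then damped_log (1/2) (1 / (2 * L)) p (x p) else 0) sums
     horizontal_integral (\<lambda>z. gauss_kernel L z * log_zeta_rand x (1/2 + \<i> * z)) (- c)" if c: "0 < c" for c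
  proof -
    \<comment> \<open>an admissible exponent strictly between 1/2 and the abscissa \<open>1/2 + c\<close> of the line\<close>
    obtain C where C: "\<And>n. norm (\<Sum>p\<le>n. if prime p then x p else 0) \<le> C * real n powr (1/2 + c/2)"
      using growth[of "1/2 + c/2"] c by auto
    show ?thesis
      using log_zeta_rand_line_integral[of "1/2 + c/2" x C L "1/2" 1 c, OF _ bounded C L] c by (simp cong: if_cong)
  qed
  have "hyper_pairing (\<lambda>z. - gauss_kernel L z) (log_zeta_rand_hyper x) = v"
    unfolding log_zeta_rand_hyper_def
  proof (rule hyper_pairing_eqI[OF L])
    show "phi_rand x \<in> P_tilde (1/2)"
    proof (rule P_tilde_lowerI)
      have hol: "log_zeta_rand x holomorphic_on {s. Re s > 1/2}"
      proof -
        have "log_zeta_rand x holomorphic_on (\<Union>\<theta>\<in>{1/2<..}. {s. Re s > \<theta>})"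
        proof (rule holomorphic_on_UN_open)
          fix \<theta> :: real assume t: "\<theta> \<in> {1/2<..}"
          obtain C where C: "\<And>n. norm (\<Sum>p\<le>n. if prime p then x p else 0) \<le> C * real n powr \<theta>"
            using growth[of \<theta>] t by auto
          show "log_zeta_rand x holomorphic_on {s. Re s > \<theta>}"
            using t by (intro holomorphic_on_log_zeta_rand[OF _ bounded C]) auto
        qed (rule open_halfspace_Re_gt)
        moreover have "(\<Union>\<theta>\<in>{1/2<..}. {s. Re s > \<theta>}) = {s. Re s > 1/2}"
          using dense[of "1/2::real"] by (auto intro: less_trans simp: greaterThan_def Bex_def)
        ultimately show ?thesis by simp
      qed
      have "(\<lambda>z. log_zeta_rand x (1/2 + \<i> * z)) holomorphic_on {z. - (1/2) < Im z \<and> Im z < 0}"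
      proof -
        have "(\<lambda>z. 1/2 + \<i> * z) holomorphic_on {z. - (1/2) < Im z \<and> Im z < 0}"
          by (intro holomorphic_intros)
        from holomorphic_on_compose_gen[OF this hol] show ?thesis
          by (auto simp: o_def image_subset_iff)
      qed
      then show "phi_rand x holomorphic_on {z. - (1/2) < Im z \<and> Im z < 0}"
        by (rule holomorphic_transform) (auto simp: phi_rand_def)
      show "\<exists>C. \<forall>z. Im z \<le> - \<delta>1 \<and> - (1/2) < Im z \<longrightarrow> norm (phi_rand x z) \<le> C * (1 + norm z)"
        if d: "0 < \<delta>1" for \<delta>1
      proof -
        obtain C where C: "\<And>n. norm (\<Sum>p\<le>n. if prime p then x p else 0) \<le> C * real n powr (1/2 + \<delta>1/2)"
          using growth[of "1/2 + \<delta>1/2"] d by auto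
        obtain K where K: "\<And>s. 1/2 + \<delta>1/2 + \<delta>1/2 \<le> Re s \<Longrightarrow> norm (log_zeta_rand x s) \<le> K * (1 + norm s)"
          using log_zeta_rand_bound[OF _ bounded C, of "\<delta>1/2"] d by auto
        have "norm (phi_rand x z) \<le> (2 * \<bar>K\<bar>) * (1 + norm z)" if z: "Im z \<le> - \<delta>1" for z
        proof -
          have "norm (phi_rand x z) \<le> K * (1 + norm (1/2 + \<i> * z))"
            using z d K[of "1/2 + \<i> * z"] by (simp add: phi_rand_def)
          also have "\<dots> \<le> \<bar>K\<bar> * (2 * (1 + norm z))"
          proof (rule mult_mono)
            show "1 + norm (1/2 + \<i> * z) \<le> 2 * (1 + norm z)"
              using norm_triangle_ineq[of "1/2" "\<i> * z"] norm_ge_zero[of z] unfolding norm_mult norm_ii mult_1_left norm_divide norm_one norm_numeral distrib_left by linarith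
          qed auto
          finally show ?thesis by (simp add: mult_ac)
        qed
        then show ?thesis by blast
      qed
    qed (simp add: phi_rand_def)
    fix c :: real assume c: "0 < c"
    have "horizontal_integral (\<lambda>z. gauss_kernel L z * phi_rand x z) (- c) =
      horizontal_integral (\<lambda>z. gauss_kernel L z * log_zeta_rand x (1/2 + \<i> * z)) (- c)"
      using c by (intro horizontal_integral_cong) (simp add: phi_rand_def)
    also have "\<dots> = v" using S[OF c] by (simp add: v_def sums_iff)
    finally show "horizontal_integral (\<lambda>z. gauss_kernel L z * phi_rand x z) (- c) = v" .
  qed (auto simp: phi_rand_def)
  then show ?thesis using S[of 1] by (simp add: v_def sums_iff)
qed

text \<open>On the line at height \<open>- c\<close> the powers of \<open>exp (- \<i> * z)\<close> decay geometrically, so linear growth of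
  the coefficients is harmless.\<close>

lemma hyper_pairing_log_Z_gauss:
  assumes w: "\<And>j. norm (w (Suc j)) \<le> C * real (Suc j)" and L: "L > 0"
  shows "(\<lambda>j. w (Suc j) / of_real (sqrt (real (Suc j))) * of_real (exp (- (real (Suc j))\<^sup>2 / (2 * L)))) sums
     hyper_pairing (\<lambda>z. - gauss_kernel L z) (log_Z_gauss_hyper w)"
proof -
  define A where "A = (\<lambda>j. w (Suc j) / of_real (sqrt (real (Suc j))))"
  have A: "norm (A j) \<le> C * real (Suc j)" for j
  proof -
    have "norm (A j) = norm (w (Suc j)) / sqrt (real (Suc j))" by (simp add: A_def norm_divide del: of_nat_Suc)
    also have "\<dots> \<le> norm (w (Suc j)) / 1" by (intro divide_left_mono) auto
    finally show ?thesis using w[of j] by simp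
  qed
  have sm: "summable (\<lambda>j. norm (A j) * r ^ Suc j)" if r: "0 \<le> r" "r < 1" for r
  proof (rule summable_comparison_test')
    show "summable (\<lambda>j. C * (real (Suc j) * r ^ Suc j))"
    proof (intro summable_mult)
      have "summable (\<lambda>j. real (Suc j) * r ^ j * r)"
        using geometric_deriv_sums[of r] r by (intro summable_mult2) (simp add: sums_iff)
      then show "summable (\<lambda>j. real (Suc j) * r ^ Suc j)" by (simp add: mult_ac)
    qed
    show "norm (norm (A j) * r ^ Suc j) \<le> C * (real (Suc j) * r ^ Suc j)" for j
      using mult_right_mono[OF A[of j], of "r ^ Suc j"] r by (simp add: mult.assoc)
  qed
  have Z: "log_Z_gauss w (exp (- \<i> * z)) = (\<Sum>j. A j * exp (- \<i> * of_real (real (Suc j)) * z))" for z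
  proof -
    have "exp (- \<i> * z) ^ Suc j = exp (- \<i> * of_real (real (Suc j)) * z)" for j
      unfolding exp_of_nat_mult[symmetric] by (simp add: mult_ac)
    then show ?thesis unfolding log_Z_gauss_def A_def by (simp only:)
  qed
  have sm': "summable (\<lambda>j. norm (A j) * exp (real (Suc j) * (- c)))" if "c > 0" for c
  proof -
    have "exp (real (Suc j) * (- c)) = exp (- c) ^ Suc j" for j
      by (rule exp_of_nat_mult)
    then show ?thesis using sm[of "exp (- c)"] that by (simp only:) simp
  qed
  define v where "v = (\<Sum>j. A j * of_real (exp (- (real (Suc j))\<^sup>2 / (2 * L))))"
  have val: "horizontal_integral (\<lambda>z. gauss_kernel L z * log_Z_gauss w (exp (- \<i> * z))) (- c) = v" if "c > 0" for c
    unfolding Z v_def by (rule horizontal_integral_exp_series(1)[OF L sm'[OF that]])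
  have v: "(\<lambda>j. A j * of_real (exp (- (real (Suc j))\<^sup>2 / (2 * L)))) sums v"
    unfolding v_def using horizontal_integral_exp_series(2)[OF L sm'[of 1]] by (simp add: summable_sums)
  have "hyper_pairing (\<lambda>z. - gauss_kernel L z) (log_Z_gauss_hyper w) = v"
    unfolding log_Z_gauss_hyper_def
  proof (rule hyper_pairing_eqI[OF L])
    show "phi_gauss w \<in> P_tilde 1"
    proof (rule P_tilde_lowerI)
      have hol: "log_Z_gauss w holomorphic_on ball 0 1"
      proof (rule power_series_holomorphic)
        fix s :: complex assume "s \<in> ball 0 1"
        then have "summable (\<lambda>j. A j * s ^ Suc j)"
          using sm[of "norm s"] by (intro summable_norm_cancel[of "\<lambda>j. A j * s ^ Suc j"])
            (simp add: norm_mult norm_power del: power_Suc)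
        then have "(\<lambda>j. A j * s ^ Suc j) sums log_Z_gauss w s"
          unfolding log_Z_gauss_def A_def by (rule summable_sums)
        then show "(\<lambda>n. (case n of 0 \<Rightarrow> 0 | Suc j \<Rightarrow> A j) * (s - 0) ^ n) sums log_Z_gauss w s"
          using sums_Suc_iff[of "\<lambda>n. (case n of 0 \<Rightarrow> 0 | Suc j \<Rightarrow> A j) * s ^ n" "log_Z_gauss w s"] by simp
      qed
      have "(\<lambda>z. log_Z_gauss w (exp (- \<i> * z))) holomorphic_on {z. - 1 < Im z \<and> Im z < 0}"
      proof -
        have "(\<lambda>z. exp (- \<i> * z)) holomorphic_on {z. - 1 < Im z \<and> Im z < 0}"
          by (intro holomorphic_intros)
        from holomorphic_on_compose_gen[OF this hol] show ?thesis
          by (auto simp: o_def norm_exp_eq_Re image_subset_iff)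
      qed
      then show "phi_gauss w holomorphic_on {z. - 1 < Im z \<and> Im z < 0}"
        by (rule holomorphic_transform) (auto simp: phi_gauss_def)
      show "\<exists>C. \<forall>z. Im z \<le> - \<delta>1 \<and> - 1 < Im z \<longrightarrow> norm (phi_gauss w z) \<le> C * (1 + norm z)"
        if d: "0 < \<delta>1" for \<delta>1
      proof -
        have "norm (phi_gauss w z) \<le> (\<Sum>j. norm (A j) * exp (real (Suc j) * (- \<delta>1))) * (1 + norm z)"
          if z: "Im z \<le> - \<delta>1" for z
        proof -
          have "norm (phi_gauss w z) \<le> (\<Sum>j. norm (A j) * exp (real (Suc j) * (- \<delta>1)))"
          proof -
            have "norm (A j * exp (- \<i> * of_real (real (Suc j)) * z)) \<le> norm (A j) * exp (real (Suc j) * (- \<delta>1))" for j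
              unfolding norm_mult using mult_left_mono[OF z, of "real (Suc j)"] by (intro mult_left_mono) (auto simp: norm_exp_eq_Re simp del: of_nat_Suc)
            from norm_suminf_le[OF this sm'[OF d]] show ?thesis
              using z d Z[of z] by (simp add: phi_gauss_def)
          qed
          also have "\<dots> \<le> (\<Sum>j. norm (A j) * exp (real (Suc j) * (- \<delta>1))) * (1 + norm z)"
            using suminf_nonneg[OF sm'[OF d]] mult_left_mono[of 1 "1 + norm z"] by simp
          finally show ?thesis .
        qed
        then show ?thesis by blast
      qed
    qed (simp add: phi_gauss_def)
    fix c :: real assume c: "0 < c"
    have "horizontal_integral (\<lambda>z. gauss_kernel L z * phi_gauss w z) (- c) =
      horizontal_integral (\<lambda>z. gauss_kernel L z * log_Z_gauss w (exp (- \<i> * z))) (- c)"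
      using c by (intro horizontal_integral_cong) (simp add: phi_gauss_def)
    then show "horizontal_integral (\<lambda>z. gauss_kernel L z * phi_gauss w z) (- c) = v"
      using val[OF c] by simp
  qed (auto simp: phi_gauss_def)
  then show ?thesis using v by (simp add: A_def)
qed

section \<open>Euler product and pole of the zeta function\<close>

lemma nat_powr_eq_exp:
  assumes "n > 0"
  shows "of_nat n powr (w::complex) = exp (w * of_real (ln (real n)))"
  using assms by (simp add: powr_def Ln_of_nat)

lemma summable_on_nat_powr:
  assumes "Re w > 1"
  shows "(\<lambda>n. norm (of_nat n powr (- w :: complex))) summable_on A"
proof -
  have "summable (\<lambda>n. real n powr (- Re w))" using assms by (simp add: summable_real_powr_iff)
  then have "(\<lambda>n. real n powr (- Re w)) summable_on UNIV"
    by (subst summable_on_UNIV_nonneg_real_iff) auto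
  then have "(\<lambda>n. real n powr (- Re w)) summable_on A"
    by (rule summable_on_subset_banach) simp
  moreover have "norm (of_nat n powr (- w)) = real n powr (- Re w)" for n
    by (cases "n = 0") (simp_all add: norm_nat_powr)
  ultimately show ?thesis by simp
qed

text \<open>The \<open>N\<close>-rough numbers of sieve theory. The bound on \<open>p\<close> is strict, so that \<open>rough 0\<close> contains all
  positive integers and the step from \<open>N\<close> to \<open>Suc N\<close> sieves by \<open>N\<close>.\<close>

definition rough :: "nat \<Rightarrow> nat set" where
  "rough N = {n. n \<ge> 1 \<and> (\<forall>p<N. prime p \<longrightarrow> \<not> p dvd n)}"

text \<open>For a prime \<open>N\<close>, the multiples of \<open>N\<close> among the \<open>N\<close>-rough numbers are exactly \<open>N\<close> times the
  \<open>N\<close>-rough numbers; removing them multiplies the sum by \<open>1 - N powr (- w)\<close>.\<close>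

lemma sieve_step:
  assumes w: "Re w > 1"
  defines "f \<equiv> (\<lambda>n. of_nat n powr (- w :: complex))"
  shows "infsum f (rough (Suc N)) = (if prime N then 1 - f N else 1) * infsum f (rough N)"
proof (cases "prime N")
  case False
  then have "rough (Suc N) = rough N" by (auto simp: rough_def less_Suc_eq)
  then show ?thesis using False by simp
next
  case True
  then have N: "N > 0" by (simp add: prime_gt_0_nat)
  have sm: "f summable_on A" for A
    unfolding f_def by (rule abs_summable_summable[OF summable_on_nat_powr[OF w]])
  have im: "{n \<in> rough N. N dvd n} = (\<lambda>m. N * m) ` rough N"
  proof (intro equalityI subsetI)
    fix n assume n: "n \<in> {n \<in> rough N. N dvd n}"
    then obtain m where m: "n = N * m" by auto
    moreover have "m \<in> rough N" using n m by (auto simp: rough_def)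
    ultimately show "n \<in> (\<lambda>m. N * m) ` rough N" by blast
  next
    fix n assume "n \<in> (\<lambda>m. N * m) ` rough N"
    then obtain m where m: "m \<in> rough N" "n = N * m" by auto
    have "\<not> p dvd N * m" if "p < N" "prime p" for p
    proof
      assume "p dvd N * m"
      then have "p dvd N \<or> p dvd m" using \<open>prime p\<close> by (simp add: prime_dvd_mult_iff)
      moreover have "\<not> p dvd N" using that True primes_dvd_imp_eq by blast
      ultimately show False using m(1) that by (auto simp: rough_def)
    qed
    then show "n \<in> {n \<in> rough N. N dvd n}" using m N by (auto simp: rough_def)
  qed
  have "rough N = rough (Suc N) \<union> {n \<in> rough N. N dvd n}"
    using True by (auto simp: rough_def less_Suc_eq)
  moreover have "rough (Suc N) \<inter> {n \<in> rough N. N dvd n} = {}"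
    using True by (auto simp: rough_def)
  ultimately have "infsum f (rough N) = infsum f (rough (Suc N)) + infsum f {n \<in> rough N. N dvd n}"
    by (metis infsum_Un_disjoint sm)
  moreover have "infsum f {n \<in> rough N. N dvd n} = infsum (f \<circ> (\<lambda>m. N * m)) (rough N)"
    unfolding im using N by (intro infsum_reindex) (auto simp: inj_on_def)
  moreover have "(f \<circ> (\<lambda>m. N * m)) m = f N * f m" if "m \<in> rough N" for m
  proof -
    have "m > 0" using that by (simp add: rough_def)
    then show ?thesis
      using N by (simp add: f_def nat_powr_eq_exp ln_mult distrib_left exp_add[symmetric] del: of_nat_mult)
        (simp add: ln_mult algebra_simps)
  qed
  then have "infsum (f \<circ> (\<lambda>m. N * m)) (rough N) = infsum (\<lambda>m. f N * f m) (rough N)"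
    by (intro infsum_cong)
  moreover have "\<dots> = f N * infsum f (rough N)"
    by (rule infsum_cmult_right) (simp add: sm)
  ultimately show ?thesis using True by (simp add: algebra_simps)
qed

definition zeta_series :: "complex \<Rightarrow> complex" where
  "zeta_series w = (\<Sum>n. of_nat (Suc n) powr (- w))"

lemma sums_nat_powr:
  assumes "Re w > 1"
  shows "(\<lambda>n. of_nat n powr (- w)) sums zeta_series w" "summable (\<lambda>n. norm (of_nat n powr (- w)))"
proof -
  show 1: "summable (\<lambda>n. norm (of_nat n powr (- w)))"
    using summable_on_nat_powr[OF assms, of UNIV] by (simp add: summable_on_UNIV_nonneg_real_iff)
  then have "summable (\<lambda>n. of_nat n powr (- w))" by (rule summable_norm_cancel)
  then show "(\<lambda>n. of_nat n powr (- w)) sums zeta_series w"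
    unfolding zeta_series_def by (subst suminf_split_head) (auto simp: sums_iff)
qed

lemma norm_sum_prime_indicator:
  "norm (\<Sum>p\<le>n. if prime p then (\<lambda>_. 1 :: complex) p else 0) \<le> 1 * real n powr 1"
proof -
  have "(\<Sum>p\<le>n. if prime p then 1 else 0 :: complex) = of_nat (card {p. p \<le> n \<and> prime p})"
    by (simp add: sum.If_cases Int_def)
  moreover have "card {p. p \<le> n \<and> prime p} \<le> card {1..n}"
    by (intro card_mono) (auto simp: Suc_leI prime_gt_0_nat)
  ultimately show ?thesis by simp
qed

text \<open>Euler's product by sieving: the sum over the \<open>N\<close>-rough numbers times the Euler factors of
  the primes below \<open>N\<close> does not depend on \<open>N\<close>. For \<open>N = 0\<close> it is the zeta series; as \<open>N\<close> grows only
  the term 1 survives, because every other \<open>N\<close>-rough number is at least \<open>N\<close>.\<close>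

lemma exp_log_zeta_one:
  assumes w: "Re w > 1"
  shows "exp (log_zeta_rand (\<lambda>_. 1) w) = zeta_series w"
proof -
  define f where "f = (\<lambda>n. of_nat n powr (- w :: complex))"
  have sm: "f summable_on A" for A
    unfolding f_def by (rule abs_summable_summable[OF summable_on_nat_powr[OF w]])
  have zeta: "infsum f (rough 0) = zeta_series w"
  proof -
    have "(f has_sum infsum f (rough 0)) UNIV"
      using has_sum_infsum[OF sm[of "rough 0"]]
      by (rule has_sum_cong_neutral[THEN iffD1, rotated -1]) (auto simp: rough_def f_def)
    then have "f sums infsum f (rough 0)" by (rule has_sum_imp_sums)
    then show ?thesis using sums_nat_powr(1)[OF w] sums_unique2 unfolding f_def by blast
  qed
  have prod: "infsum f (rough N) * exp (\<Sum>p<N. euler_log (\<lambda>_. 1) p w) = zeta_series w" for N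
  proof (induction N)
    case 0
    then show ?case by (simp add: zeta)
  next
    case (Suc N)
    have e: "(if prime N then 1 - f N else 1) * exp (euler_log (\<lambda>_. 1) N w) = 1"
    proof (cases "prime N")
      case True
      have "norm (1 * of_nat N powr (- w)) < 1"
        using norm_euler_ratio_less_1[of N "\<lambda>_. 1" w] True w by simp
      then have "norm (f N) < 1" by (simp add: f_def)
      then have "1 - f N \<noteq> 0" by (metis eq_iff_diff_eq_0 less_irrefl norm_one)
      then show ?thesis using True by (simp add: euler_log_def f_def exp_minus)
    qed (simp add: euler_log_def)
    have "infsum f (rough (Suc N)) * exp (\<Sum>p<Suc N. euler_log (\<lambda>_. 1) p w) =
       (infsum f (rough N) * exp (\<Sum>p<N. euler_log (\<lambda>_. 1) p w)) *
         ((if prime N then 1 - f N else 1) * exp (euler_log (\<lambda>_. 1) N w))"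
      unfolding sieve_step[OF w, of N, folded f_def] sum.lessThan_Suc exp_add
      by (simp only: f_def mult_ac)
    then show ?case using Suc by (simp only: e mult_1_right)
  qed
  have tail: "(\<lambda>N. infsum f (rough N)) \<longlonglongrightarrow> 1"
  proof (rule LIM_zero_cancel, rule Lim_null_comparison)
    define g where "g = (\<lambda>n. norm (f n))"
    have g: "g summable_on A" for A unfolding g_def f_def by (rule summable_on_nat_powr[OF w])
    have "g sums infsum g UNIV" using has_sum_infsum[OF g] by (rule has_sum_imp_sums)
    then have "(\<lambda>N. infsum g UNIV - (\<Sum>n<N. g n)) \<longlonglongrightarrow> infsum g UNIV - infsum g UNIV"
      unfolding sums_def by (intro tendsto_diff tendsto_const)
    then show "(\<lambda>N. infsum g UNIV - (\<Sum>n<N. g n)) \<longlonglongrightarrow> 0" by simp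
    show "\<forall>\<^sub>F N in sequentially. norm (infsum f (rough N) - 1) \<le> infsum g UNIV - (\<Sum>n<N. g n)"
      using eventually_ge_at_top[of 2]
    proof eventually_elim
      fix N :: nat assume N: "N \<ge> 2"
      have 1: "1 \<in> rough N" by (auto simp: rough_def)
      have "infsum f (rough N) = infsum f {1} + infsum f (rough N - {1})"
        using 1 infsum_Un_disjoint[OF sm[of "{1}"] sm[of "rough N - {1}"]]
        by (metis Diff_disjoint insert_Diff insert_is_Un)
      then have "norm (infsum f (rough N) - 1) = norm (infsum f (rough N - {1}))"
        by (simp add: f_def)
      also have "\<dots> \<le> infsum g (rough N - {1})"
        unfolding g_def by (rule norm_infsum_bound) (use g in \<open>simp add: g_def\<close>)
      also have "\<dots> \<le> infsum g (UNIV - {..<N})"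
      proof (rule infsum_mono_neutral[OF g g])
        fix n assume "n \<in> (rough N - {1}) - (UNIV - {..<N})"
        then have n: "n \<noteq> 1" "n < N" "n \<ge> 1" "\<forall>p<N. prime p \<longrightarrow> \<not> p dvd n" by (auto simp: rough_def)
        obtain p where p: "prime p" "p dvd n" using prime_factor_nat[of n] n by auto
        then have "p < N" using dvd_imp_le[of p n] n by auto
        then show "g n \<le> 0" using n p by blast
      qed (auto simp: g_def)
      also have "\<dots> = infsum g UNIV - infsum g {..<N}"
        by (rule infsum_Diff) (auto intro: g)
      also have "infsum g {..<N} = (\<Sum>n<N. g n)" by simp
      finally show "norm (infsum f (rough N) - 1) \<le> infsum g UNIV - (\<Sum>n<N. g n)" .
    qed
  qed
  have "(\<lambda>N. infsum f (rough N) * exp (\<Sum>p<N. euler_log (\<lambda>_. 1) p w)) \<longlonglongrightarrow> 1 * exp (log_zeta_rand (\<lambda>_. 1) w)"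
  proof (intro tendsto_mult tail tendsto_exp log_zeta_rand_limit[OF _ _ norm_sum_prime_indicator])
  qed (use w in auto)
  then have "(\<lambda>N. zeta_series w) \<longlonglongrightarrow> exp (log_zeta_rand (\<lambda>_. 1) w)" unfolding prod by simp
  then show ?thesis by (simp add: LIMSEQ_const_iff)
qed

text \<open>The simple pole of the zeta function at 1 with residue 1. Telescoping writes 1 as the sum of
  \<open>n powr (- s) - (n + 1) powr (- s)\<close>, and by Taylor's theorem this difference is
  \<open>s * n powr (- 1 - s)\<close> up to \<open>norm s * norm (1 + s) / n\<^sup>2\<close>.\<close>

lemma norm_zeta_pole_le:
  assumes s: "Re s > 0"
  shows "norm (s * zeta_series (1 + s) - 1) \<le> norm s * norm (1 + s) * (\<Sum>n. 1 / real (Suc n) ^ 2)"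
proof -
  define f where "f = (\<lambda>n. (of_nat (Suc n) :: complex) powr (- s))"
  define h where "h = (\<lambda>n. s * of_nat (Suc n) powr (- (1 + s)) - (f n - f (Suc n)))"
  have "(\<lambda>n. f n) \<longlonglongrightarrow> 0"
  proof (rule Lim_null_comparison[OF always_eventually])
    show "\<forall>n. norm (f n) \<le> real (Suc n) powr (- Re s)"
      by (simp add: f_def norm_nat_powr del: of_nat_Suc)
    show "(\<lambda>n. real (Suc n) powr (- Re s)) \<longlonglongrightarrow> 0" using s by real_asymp
  qed
  then have tel: "(\<lambda>n. f n - f (Suc n)) sums 1"
    using telescope_sums'[of f 0] by (simp add: f_def)
  have "(\<lambda>n. of_nat (Suc n) powr (- (1 + s))) sums zeta_series (1 + s)"
    using sums_nat_powr(1)[of "1 + s"] s by (subst sums_Suc_iff) simp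
  then have h: "h sums (s * zeta_series (1 + s) - 1)"
    unfolding h_def by (intro sums_diff sums_mult tel)
  have hb: "norm (h n) \<le> norm s * norm (1 + s) * (1 / real (Suc n) ^ 2)" for n
  proof -
    define m where "m = Suc n"
    define S where "S = closed_segment (of_nat m :: complex) (of_nat (Suc m))"
    \<comment> \<open>the derivatives of order 0, 1 and 2 of \<open>z powr (- s)\<close>\<close>
    define F where "F = (\<lambda>i z. if i = (0::nat) then z powr (- s) else if i = 1 then - s * z powr (- s - 1)
        else - s * ((- s - 1) * z powr (- s - 1 - 1)))"
    have S: "\<exists>t\<ge>real m. z = of_real t" if "z \<in> S" for z
    proof -
      obtain u where u: "0 \<le> u" "u \<le> 1" "z = (1 - u) *\<^sub>R of_nat m + u *\<^sub>R of_nat (Suc m)"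
        using \<open>z \<in> S\<close> by (auto simp: closed_segment_def S_def)
      have "z = of_real (real m + u)" using u by (simp add: scaleR_conv_of_real algebra_simps)
      then show ?thesis using u by (intro exI[of _ "real m + u"]) auto
    qed
    have S': "z \<notin> \<real>\<^sub>\<le>\<^sub>0" if "z \<in> S" for z
      using S[OF that] by (auto simp: m_def)
    have "norm (F 0 (of_nat (Suc m)) - (\<Sum>i\<le>1. F i (of_nat m) * (of_nat (Suc m) - of_nat m) ^ i / fact i))
        \<le> (norm s * norm (1 + s) * (1 / real m ^ 2)) * norm (of_nat (Suc m) - of_nat m :: complex) ^ (Suc 1) / fact 1"
    proof (rule field_Taylor[where S = S])
      show "convex S" by (simp add: S_def)
      show "(F i has_field_derivative F (Suc i) z) (at z within S)" if "z \<in> S" "i \<le> 1" for i z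
      proof -
        have d: "((\<lambda>z. z powr r) has_field_derivative r * z powr (r - 1)) (at z within S)" for r
          using S'[OF that(1)] by (intro has_field_derivative_powr[THEN has_field_derivative_at_within])
        show ?thesis
          using that(2) d[of "- s"] DERIV_cmult[OF d[of "- s - 1"], of "- s"]
          by (cases "i = 0") (auto simp: F_def le_Suc_eq)
      qed
      show "norm (F (Suc 1) z) \<le> norm s * norm (1 + s) * (1 / real m ^ 2)" if zS: "z \<in> S" for z
      proof -
        obtain t where t: "t \<ge> real m" "z = of_real t" using S[OF zS] by blast
        have t1: "t \<ge> 1" "t > 0" using t by (auto simp: m_def)
        have "norm (z powr (- s - 1 - 1)) = t powr (- Re s - 2)"
          using norm_powr_real_powr[of z "- s - 1 - 1"] t t1 by (simp add: minus_diff_commute)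
        also have "\<dots> \<le> t powr (- 2)" using t1 s by (intro powr_mono) auto
        also have "\<dots> \<le> real m powr (- 2)" using t by (intro powr_mono2') (auto simp: m_def)
        also have "\<dots> = 1 / real m ^ 2" by (simp add: powr_minus_divide m_def del: of_nat_Suc)
        finally have le: "norm (z powr (- s - 1 - 1)) \<le> 1 / real m ^ 2" .
        have eq: "norm (- s - 1) = norm (1 + s)" by (metis minus_add_distrib norm_minus_cancel add.commute diff_conv_add_uminus)
        have "norm (F (Suc 1) z) = (norm s * norm (1 + s)) * norm (z powr (- s - 1 - 1))"
          by (simp add: F_def norm_mult eq)
        also have "\<dots> \<le> norm s * norm (1 + s) * (1 / real m ^ 2)"
          by (rule mult_left_mono[OF le]) simp
        finally show ?thesis .
      qed
    qed (auto simp: S_def)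
    also have "F 0 (of_nat (Suc m)) - (\<Sum>i\<le>1. F i (of_nat m) * (of_nat (Suc m) - of_nat m) ^ i / fact i) = h n"
      by (simp add: F_def h_def f_def m_def algebra_simps minus_diff_commute)
    finally show ?thesis by (simp add: m_def)
  qed
  have sm: "summable (\<lambda>n. 1 / real (Suc n) ^ 2)"
    using inverse_power_summable[of 2] by (subst summable_Suc_iff) (simp add: field_simps)
  have "norm (suminf h) \<le> (\<Sum>n. norm s * norm (1 + s) * (1 / real (Suc n) ^ 2))"
    by (rule norm_suminf_le[OF hb]) (intro summable_mult sm)
  also have "\<dots> = norm s * norm (1 + s) * (\<Sum>n. 1 / real (Suc n) ^ 2)"
    by (rule suminf_mult[OF sm])
  finally show ?thesis using h by (simp add: sums_iff)
qed

section \<open>A smoothed form of the theorem of Mertens\<close>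

text \<open>A logarithm of \<open>\<zeta>(1 + s) * (1 - exp (- s))\<close>. The second factor has the logarithmic series
  \<open>- \<Sum> exp (- k s) / k\<close>, the Dirichlet series belonging to the Gaussian side, and its zero at 0
  cancels the pole of the first factor.\<close>

definition log_ratio :: "complex \<Rightarrow> complex" where
  "log_ratio s = log_zeta_rand (\<lambda>_. 1) (1 + s) + Ln (1 - exp (- s))"

lemma norm_Ln_one_minus_le:
  fixes v :: complex
  assumes "norm v < 1"
  shows "norm (Ln (1 - v)) \<le> - ln (1 - norm v)"
proof -
  have v: "norm (complex_of_real (norm v)) < 1" using assms by simp
  have s1: "(\<lambda>j. v ^ Suc j / of_nat (Suc j)) sums (- Ln (1 - v))"
    by (rule sums_neg_Ln_one_minus[OF assms])
  have "(\<lambda>j. complex_of_real (norm v ^ Suc j / of_nat (Suc j))) sums (complex_of_real (- ln (1 - norm v)))"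
  proof -
    have "Ln (complex_of_real (1 - norm v)) = of_real (ln (1 - norm v))"
      using assms by (intro Ln_of_real) simp
    then have "Ln (1 - complex_of_real (norm v)) = of_real (ln (1 - norm v))"
      by (simp only: of_real_diff of_real_1)
    with sums_neg_Ln_one_minus[OF v] show ?thesis by simp
  qed
  then have s2: "(\<lambda>j. norm v ^ Suc j / of_nat (Suc j)) sums (- ln (1 - norm v))"
    by (simp only: sums_of_real_iff)
  have "norm (v ^ Suc j / of_nat (Suc j)) \<le> norm v ^ Suc j / of_nat (Suc j)" for j
    by (simp only: norm_divide norm_power norm_of_nat order_refl)
  from norm_suminf_le[OF this sums_summable[OF s2]]
  have "norm (- Ln (1 - v)) \<le> - ln (1 - norm v)"
    using s1 s2 by (simp add: sums_iff)
  then show ?thesis by simp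
qed

lemma norm_exp_minus_less_1: "Re s > 0 \<Longrightarrow> norm (exp (- s :: complex)) < 1"
  by (simp add: norm_exp_eq_Re)

lemma one_minus_exp_not_nonpos:
  assumes "Re s > 0"
  shows "1 - exp (- s) \<notin> \<real>\<^sub>\<le>\<^sub>0" "1 - exp (- s) \<noteq> 0"
proof -
  have "Re (exp (- s)) < 1"
    using norm_exp_minus_less_1[OF assms] complex_Re_le_cmod[of "exp (- s)"] by linarith
  then show "1 - exp (- s) \<notin> \<real>\<^sub>\<le>\<^sub>0" by (auto simp: complex_nonpos_Reals_iff)
  then show "1 - exp (- s) \<noteq> 0" by (metis nonpos_Reals_zero_I)
qed

lemma holomorphic_on_log_ratio: "log_ratio holomorphic_on {s. Re s > 0}"
proof -
  have "(\<lambda>s. 1 + s) holomorphic_on {s. Re s > 0}" by (intro holomorphic_intros)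
  from holomorphic_on_compose_gen[OF this holomorphic_on_log_zeta_rand[OF _ _ norm_sum_prime_indicator]]
  have "(\<lambda>s. log_zeta_rand (\<lambda>_. 1) (1 + s)) holomorphic_on {s. Re s > 0}"
    by (auto simp: o_def image_subset_iff)
  moreover have "(\<lambda>s. Ln (1 - exp (- s))) holomorphic_on {s. Re s > 0}"
    using one_minus_exp_not_nonpos by (intro holomorphic_intros) auto
  ultimately show ?thesis
    unfolding log_ratio_def[abs_def] by (intro holomorphic_on_add)
qed

lemma exp_log_ratio:
  assumes "Re s > 0"
  shows "exp (log_ratio s) = zeta_series (1 + s) * (1 - exp (- s))"
  using assms one_minus_exp_not_nonpos[OF assms]
  by (simp add: log_ratio_def exp_add exp_log_zeta_one)

text \<open>The two logarithmic series have nonnegative coefficients, so on the line \<open>Re s = c\<close> each is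
  bounded by its value at \<open>c\<close>. The sum of these values is \<open>log_ratio c - 2 * ln (1 - exp (- c))\<close>.\<close>

lemma log_ratio_real:
  assumes "c > 0"
  shows "log_ratio (of_real c) = of_real (Re (log_ratio (of_real c)))"
    and "Re s = c \<Longrightarrow> norm (log_ratio s) \<le> Re (log_ratio (of_real c)) - 2 * ln (1 - exp (- c))"
proof -
  define l where "l = (\<lambda>p. if prime p then - ln (1 - real p powr (- (1 + c))) else 0)"
  have l: "euler_log (\<lambda>_. 1) p (1 + of_real c) = of_real (l p)" for p
  proof (cases "prime p")
    case True
    then have p: "p > 0" "real p > 1" using prime_gt_0_nat[of p] prime_gt_1_nat[of p] by auto
    have "of_nat p powr (- (1 + complex_of_real c)) = of_real (real p powr (- (1 + c)))"
      using p powr_of_real[of "real p" "- (1 + c)"] by simp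
    moreover have "Ln (1 - complex_of_real (real p powr (- (1 + c)))) = of_real (ln (1 - real p powr (- (1 + c))))"
    proof -
      have "real p powr (- (1 + c)) < 1" using p assms by (simp add: powr_less_one)
      then have "Ln (complex_of_real (1 - real p powr (- (1 + c)))) = of_real (ln (1 - real p powr (- (1 + c))))"
        by (intro Ln_of_real) simp
      then show ?thesis by (simp only: of_real_diff of_real_1)
    qed
    ultimately show ?thesis using True by (simp add: euler_log_def l_def)
  qed (simp add: euler_log_def l_def)
  have lim: "(\<lambda>p. euler_log (\<lambda>_. 1) p (1 + s)) sums log_zeta_rand (\<lambda>_. 1) (1 + s)" if "Re s > 0" for s
    unfolding sums_def by (rule log_zeta_rand_limit[OF _ _ norm_sum_prime_indicator]) (use that in auto)
  have "(\<lambda>p. complex_of_real (l p)) sums log_zeta_rand (\<lambda>_. 1) (1 + of_real c)"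
    using lim[of "of_real c"] assms unfolding l by simp
  then obtain Z where Z: "log_zeta_rand (\<lambda>_. 1) (1 + of_real c) = of_real Z" "l sums Z"
    by (metis sums_of_real_iff sums_summable summable_of_real_iff summable_sums sums_unique2)
  have Ln: "Ln (1 - exp (- complex_of_real c)) = of_real (ln (1 - exp (- c)))"
  proof -
    have "Ln (complex_of_real (1 - exp (- c))) = of_real (ln (1 - exp (- c)))"
      using assms by (intro Ln_of_real) simp
    then show ?thesis by (simp only: of_real_diff of_real_1 of_real_minus exp_of_real[symmetric])
  qed
  have D: "log_ratio (of_real c) = of_real (Z + ln (1 - exp (- c)))"
    by (simp add: log_ratio_def Z Ln)
  then show "log_ratio (of_real c) = of_real (Re (log_ratio (of_real c)))" by simp
  assume s: "Re s = c"
  have "norm (euler_log (\<lambda>_. 1) p (1 + s)) \<le> l p" for p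
  proof (cases "prime p")
    case True
    then have p: "p > 0" by (simp add: prime_gt_0_nat)
    have "norm (Ln (1 - of_nat p powr (- (1 + s)))) \<le> - ln (1 - norm (of_nat p powr (- (1 + s))))"
      using norm_euler_ratio_less_1[of p "\<lambda>_. 1" "1 + s"] True s assms by (intro norm_Ln_one_minus_le) simp
    then show ?thesis using True p s by (simp add: euler_log_def l_def norm_nat_powr)
  qed (simp add: euler_log_def l_def)
  from norm_suminf_le[OF this sums_summable[OF Z(2)]]
  have "norm (log_zeta_rand (\<lambda>_. 1) (1 + s)) \<le> Z"
    using lim[of s] Z(2) s assms by (simp add: sums_iff)
  moreover have "norm (Ln (1 - exp (- s))) \<le> - ln (1 - exp (- c))"
    using norm_Ln_one_minus_le[OF norm_exp_minus_less_1[of s]] s assms by (simp add: norm_exp_eq_Re)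
  ultimately have "norm (log_ratio s) \<le> Z - ln (1 - exp (- c))"
    unfolding log_ratio_def using norm_triangle_mono by fastforce
  then show "norm (log_ratio s) \<le> Re (log_ratio (of_real c)) - 2 * ln (1 - exp (- c))"
    by (simp add: D)
qed

text \<open>The exponential of \<open>log_ratio\<close> tends to 1. On a small half-disc \<open>log_ratio\<close> therefore differs from
  the principal logarithm of its exponential by a continuous function with values in the
  multiples of \<open>2 \<pi> \<i>\<close>. This function is constant, and it is 0 on the real axis, where \<open>log_ratio\<close> is real.\<close>

lemma log_ratio_tendsto_0: "(log_ratio \<longlongrightarrow> 0) (at 0 within {s. Re s > 0})"
proof -
  let ?H = "{s. Re s > 0}"
  have nb: "at 0 within ?H \<le> at (0::complex)" by (rule at_le) simp
  have z: "((\<lambda>s. s * zeta_series (1 + s) - 1) \<longlongrightarrow> 0) (at 0 within ?H)"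
  proof (rule Lim_null_comparison)
    show "\<forall>\<^sub>F s in at 0 within ?H. norm (s * zeta_series (1 + s) - 1) \<le> norm s * norm (1 + s) * (\<Sum>n. 1 / real (Suc n) ^ 2)"
      unfolding eventually_at_filter by (rule always_eventually) (simp add: norm_zeta_pole_le del: of_nat_Suc)
    have "((\<lambda>s::complex. norm s * norm (1 + s) * (\<Sum>n. 1 / real (Suc n) ^ 2)) \<longlongrightarrow>
       norm (0::complex) * norm (1 + 0 :: complex) * (\<Sum>n. 1 / real (Suc n) ^ 2)) (at 0 within ?H)"
      by (intro tendsto_intros)
    then show "((\<lambda>s::complex. norm s * norm (1 + s) * (\<Sum>n. 1 / real (Suc n) ^ 2)) \<longlongrightarrow> 0) (at 0 within ?H)"
      by simp
  qed
  have e: "((\<lambda>s::complex. (1 - exp (- s)) / s) \<longlongrightarrow> 1) (at 0 within ?H)"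
  proof -
    have "((\<lambda>s::complex. 1 - exp (- s)) has_field_derivative 1) (at 0)"
      by (auto intro!: derivative_eq_intros)
    then have "((\<lambda>s::complex. (1 - exp (- s)) / s) \<longlongrightarrow> 1) (at 0)"
      by (simp add: has_field_derivative_iff)
    then show ?thesis by (rule tendsto_mono[OF nb])
  qed
  have E: "((\<lambda>s. exp (log_ratio s)) \<longlongrightarrow> 1) (at 0 within ?H)"
  proof -
    have "((\<lambda>s. ((s * zeta_series (1 + s) - 1) + 1) * ((1 - exp (- s)) / s)) \<longlongrightarrow> (0 + 1) * 1) (at 0 within ?H)"
      by (intro tendsto_intros z e)
    moreover have "\<forall>\<^sub>F s in at 0 within ?H. ((s * zeta_series (1 + s) - 1) + 1) * ((1 - exp (- s)) / s) = exp (log_ratio s)"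
      by (auto simp: eventually_at_filter exp_log_ratio)
    ultimately show ?thesis by (simp add: tendsto_cong)
  qed
  then have "\<forall>\<^sub>F s in at 0 within ?H. dist (exp (log_ratio s)) 1 < 1"
    by (rule tendstoD) simp
  then obtain r where r: "r > 0"
    and r': "\<forall>s\<in>?H. s \<noteq> 0 \<and> dist s 0 < r \<longrightarrow> dist (exp (log_ratio s)) 1 < 1"
    unfolding eventually_at by blast
  have rE: "norm (exp (log_ratio s) - 1) < 1" if "Re s > 0" "norm s < r" for s
    using bspec[OF r', of s] that by (auto simp: dist_norm)
  define S where "S = ?H \<inter> ball 0 r"
  have "convex S" unfolding S_def by (intro convex_Int convex_halfspace_Re_gt convex_ball)
  then have con: "connected S" by (rule convex_connected)
  \<comment> \<open>the multiple of \<open>2 \<pi> \<i>\<close> by which the two logarithms differ\<close>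
  define m where "m = (\<lambda>s. log_ratio s - Ln (exp (log_ratio s)))"
  have np: "exp (log_ratio s) \<notin> \<real>\<^sub>\<le>\<^sub>0" if "s \<in> S" for s
  proof -
    have "norm (exp (log_ratio s) - 1) < 1" using that by (intro rE) (auto simp: S_def)
    then have "Re (exp (log_ratio s)) > 0"
      using abs_Re_le_cmod[of "exp (log_ratio s) - 1"] by simp
    then show ?thesis by (auto simp: complex_nonpos_Reals_iff)
  qed
  have cont: "continuous_on S m"
  proof -
    have "continuous_on S log_ratio"
      using holomorphic_on_imp_continuous_on[OF holomorphic_on_log_ratio]
      by (rule continuous_on_subset) (auto simp: S_def)
    then show ?thesis unfolding m_def using np by (intro continuous_intros) auto
  qed
  have expm: "exp (m s) = 1" for s by (simp add: m_def exp_diff)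
  have "m constant_on S"
  proof (rule continuous_discrete_range_constant[OF con cont])
    fix s assume "s \<in> S"
    have "2 * pi \<le> norm (m y - m s)" if "m y \<noteq> m s" for y
    proof -
      have "exp (m y - m s) = 1" by (simp add: exp_diff expm)
      then obtain n :: int where n: "Re (m y - m s) = 0" "Im (m y - m s) = of_int (2 * n) * pi"
        by (auto simp: exp_eq_1)
      have "n \<noteq> 0" using n that by (auto simp: complex_eq_iff)
      then have "1 \<le> \<bar>real_of_int n\<bar>" by linarith
      then have "2 * pi \<le> \<bar>Im (m y - m s)\<bar>" using n by (simp add: abs_mult)
      also have "\<dots> \<le> norm (m y - m s)" by (rule abs_Im_le_cmod)
      finally show ?thesis .
    qed
    then show "\<exists>e>0. \<forall>y. y \<in> S \<and> m y \<noteq> m s \<longrightarrow> e \<le> norm (m y - m s)"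
      by (intro exI[of _ "2 * pi"]) auto
  qed
  moreover have "of_real (r / 2) \<in> S" using r by (auto simp: S_def)
  moreover have "m (of_real (r / 2)) = 0"
  proof -
    obtain d where d: "log_ratio (of_real (r / 2)) = of_real d"
      using log_ratio_real(1)[of "r / 2"] r by auto
    show ?thesis unfolding m_def d by (simp add: exp_of_real Ln_of_real)
  qed
  ultimately have m0: "m s = 0" if "s \<in> S" for s
    using that unfolding constant_on_def by metis
  have "((\<lambda>s. Ln (exp (log_ratio s))) \<longlongrightarrow> Ln 1) (at 0 within ?H)"
    by (rule tendsto_Ln[OF E]) simp
  moreover have "\<forall>\<^sub>F s in at 0 within ?H. Ln (exp (log_ratio s)) = log_ratio s"
    unfolding eventually_at using r m0 by (intro exI[of _ r]) (auto simp: S_def m_def dist_norm)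
  ultimately show ?thesis by (simp add: tendsto_cong)
qed

text \<open>A majorant that is independent of the scale \<open>t\<close>. The function is bounded near 0. Outside a disc
  of radius \<open>d\<close> one has \<open>1 / t \<le> (1 + \<bar>y\<bar>) / d\<close>, so that the crude bound \<open>1 + 4 / t\<close>, which
  explodes as \<open>t\<close> tends to 0, turns into growth in \<open>y\<close>.\<close>

lemma log_ratio_scaled_bound:
  obtains r K where "r > 0" "r \<le> 1" "\<And>t y. 0 < t \<Longrightarrow> t < r \<Longrightarrow> norm (log_ratio (of_real t * Complex 1 y)) \<le> K * exp \<bar>y\<bar>"
proof -
  have "\<forall>\<^sub>F s in at 0 within {s. Re s > 0}. dist (log_ratio s) 0 < 1"
    by (rule tendstoD[OF log_ratio_tendsto_0]) simp
  then obtain d where d: "d > 0"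
    and D': "\<forall>s\<in>{s. Re s > 0}. s \<noteq> 0 \<and> dist s 0 < d \<longrightarrow> dist (log_ratio s) 0 < 1"
    unfolding eventually_at by blast
  have D: "norm (log_ratio s) < 1" if "Re s > 0" "norm s < d" for s
    using bspec[OF D', of s] that by auto
  \<comment> \<open>\<open>t \<le> 1\<close> gives \<open>exp (- t) \<le> 1 - t / 2\<close> below\<close>
  define r where "r = min d 1"
  show thesis
  proof
    show "r > 0" "r \<le> 1" using d by (auto simp: r_def)
    fix t y :: real assume t: "0 < t" "t < r"
    have e1: "1 + \<bar>y\<bar> \<le> exp \<bar>y\<bar>" by (rule exp_ge_add_one_self)
    show "norm (log_ratio (of_real t * Complex 1 y)) \<le> (1 + 4 / d) * exp \<bar>y\<bar>"
    proof (cases "norm (of_real t * Complex 1 y) < d")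
      case True
      then have "norm (log_ratio (of_real t * Complex 1 y)) \<le> 1 * 1" using D[of "of_real t * Complex 1 y"] t by simp
      also have "\<dots> \<le> (1 + 4 / d) * exp \<bar>y\<bar>" using d by (intro mult_mono) auto
      finally show ?thesis .
    next
      case False
      have "norm (Complex 1 y) \<le> 1 + \<bar>y\<bar>" using cmod_le[of "Complex 1 y"] by simp
      then have "t * norm (Complex 1 y) \<le> t * (1 + \<bar>y\<bar>)" using t by (intro mult_left_mono) auto
      moreover have "norm (of_real t * Complex 1 y) = t * norm (Complex 1 y)" using t by (simp add: norm_mult)
      ultimately have "d \<le> t * (1 + \<bar>y\<bar>)" using False by linarith
      then have inv: "1 / t \<le> (1 + \<bar>y\<bar>) / d" using t d by (simp add: field_simps)
      have "Re (log_ratio (of_real t)) \<le> 1"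
        using D[of "of_real t"] t complex_Re_le_cmod[of "log_ratio (of_real t)"] by (simp add: r_def)
      moreover have "- ln (1 - exp (- t)) \<le> 2 / t"
      proof -
        have "exp (- t) \<le> 1 - t / 2"
        proof -
          have "1 + t \<le> exp t" by (rule exp_ge_add_one_self)
          then have "exp (- t) \<le> 1 / (1 + t)" using t by (simp add: exp_minus field_simps)
          also have "\<dots> \<le> 1 - t / 2"
          proof -
            have "t * t \<le> t * 1" using t by (intro mult_left_mono) (auto simp: r_def)
            then show ?thesis using t by (simp add: field_simps)
          qed
          finally show ?thesis .
        qed
        then have "t / 2 \<le> 1 - exp (- t)" by simp
        then have "ln (t / 2) \<le> ln (1 - exp (- t))" using t by simp
        moreover have "ln (2 / t) \<le> 2 / t" using ln_le_minus_one[of "2 / t"] t by simp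
        moreover have "ln (2 / t) = - ln (t / 2)" using t by (simp add: ln_div)
        ultimately show ?thesis by linarith
      qed
      moreover have "norm (log_ratio (of_real t * Complex 1 y)) \<le> Re (log_ratio (of_real t)) - 2 * ln (1 - exp (- t))"
        using t by (intro log_ratio_real(2)) auto
      ultimately have "norm (log_ratio (of_real t * Complex 1 y)) \<le> 1 + 4 * (1 / t)" by simp
      also have "\<dots> \<le> 1 + 4 * ((1 + \<bar>y\<bar>) / d)" using mult_left_mono[OF inv, of 4] by linarith
      also have "\<dots> \<le> exp \<bar>y\<bar> + 4 * (exp \<bar>y\<bar> / d)"
        using e1 d by (intro add_mono mult_left_mono divide_right_mono) auto
      finally show ?thesis by (simp add: algebra_simps)
    qed
  qed
qed

text \<open>On the line \<open>Im z = - 1\<close> the point \<open>s = \<i> * t * z\<close> runs through the vertical line \<open>Re s = t\<close>.\<close>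

lemma smoothed_sums_line_integral:
  assumes t: "t > 0"
  shows "(\<lambda>p. if prime p then damped_log 1 (t\<^sup>2 / 2) p 1 else 0) sums
      (horizontal_integral (\<lambda>z. gauss_kernel 1 z * log_ratio (\<i> * of_real t * z)) (- 1) +
       (\<Sum>j. of_real (exp (- ((t\<^sup>2 / 2) * (real (Suc j))\<^sup>2)) / real (Suc j))))"
proof -
  define s where "s = (\<lambda>z. \<i> * of_real t * z)"
  have s: "s (Complex y (- 1)) = of_real t * Complex 1 y" for y
    by (simp add: s_def complex_eq_iff)
  have Re_s: "Re (s (Complex y (- 1))) = t" for y by (simp add: s_def)
  have 1: "(\<lambda>p. if prime p then damped_log 1 (t\<^sup>2 / 2) p 1 else 0) sums
     horizontal_integral (\<lambda>z. gauss_kernel 1 z * log_zeta_rand (\<lambda>_. 1) (1 + s z)) (- 1)"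
    using log_zeta_rand_line_integral[OF _ _ norm_sum_prime_indicator, of 1 1 t 1] t
    by (simp add: s_def cong: if_cong)
  define A u where "A = (\<lambda>j. 1 / of_nat (Suc j) :: complex)" and "u = (\<lambda>j. t * real (Suc j))"
  have sm: "summable (\<lambda>j. norm (A j) * exp (u j * (- 1)))"
  proof (rule summable_ratio_powers[of _ 1 "exp (- t)"])
    show "norm (A j) * exp (u j * (- 1)) \<le> 1 * exp (- t) ^ Suc j" for j
    proof -
      have "norm (A j) \<le> 1" by (simp add: A_def norm_divide del: of_nat_Suc)
      moreover have "exp (u j * (- 1)) = exp (- t) ^ Suc j"
        unfolding exp_of_nat_mult[symmetric] by (simp add: u_def algebra_simps)
      ultimately show ?thesis by (simp add: mult_right_mono del: power_Suc)
    qed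
  qed (use t in auto)
  have ser: "(\<Sum>j. A j * exp (- \<i> * of_real (u j) * Complex y (- 1))) = - Ln (1 - exp (- s (Complex y (- 1))))" for y
  proof -
    have "exp (- s (Complex y (- 1))) ^ Suc j / of_nat (Suc j) = A j * exp (- \<i> * of_real (u j) * Complex y (- 1))" for j
      unfolding exp_of_nat_mult[symmetric] by (simp add: A_def u_def s_def mult_ac)
    moreover have "norm (exp (- s (Complex y (- 1)))) < 1"
      using Re_s t by (intro norm_exp_minus_less_1) simp
    ultimately show ?thesis
      using sums_neg_Ln_one_minus[of "exp (- s (Complex y (- 1)))"] by (simp add: sums_iff)
  qed
  have "horizontal_integral (\<lambda>z. gauss_kernel 1 z * (\<Sum>j. A j * exp (- \<i> * of_real (u j) * z))) (- 1)
     = (\<Sum>j. A j * of_real (exp (- (u j)\<^sup>2 / (2 * 1))))"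
    by (rule horizontal_integral_exp_series(1)[OF _ sm]) simp
  moreover have trm: "A j * of_real (exp (- (u j)\<^sup>2 / (2 * 1))) = of_real (exp (- ((t\<^sup>2 / 2) * (real (Suc j))\<^sup>2)) / real (Suc j))" for j
    by (simp add: A_def u_def power_mult_distrib del: of_nat_Suc)
  ultimately have 2: "horizontal_integral (\<lambda>z. gauss_kernel 1 z * (- Ln (1 - exp (- s z)))) (- 1)
     = (\<Sum>j. of_real (exp (- ((t\<^sup>2 / 2) * (real (Suc j))\<^sup>2)) / real (Suc j)))"
    using horizontal_integral_cong[of "\<lambda>z. gauss_kernel 1 z * (\<Sum>j. A j * exp (- \<i> * of_real (u j) * z))" "-1"
      "\<lambda>z. gauss_kernel 1 z * (- Ln (1 - exp (- s z)))"] ser by simp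
  have hol: "s holomorphic_on {z. Re (s z) > 0}" unfolding s_def by (intro holomorphic_intros)
  have i1: "integrable lborel (\<lambda>y. gauss_kernel 1 (Complex y (- 1)) * (- Ln (1 - exp (- s (Complex y (- 1))))))"
  proof (rule integrable_gauss_kernel_mult[where F = "\<lambda>z. - Ln (1 - exp (- s z))" and C = "- ln (1 - exp (- t))"])
    show "(\<lambda>y. - Ln (1 - exp (- s (Complex y (- 1))))) \<in> borel_measurable borel"
    proof (rule holomorphic_horizontal_measurable[where F = "\<lambda>z. - Ln (1 - exp (- s z))"])
      show "(\<lambda>z. - Ln (1 - exp (- s z))) holomorphic_on {z. Re (s z) > 0}"
        using one_minus_exp_not_nonpos by (intro holomorphic_intros hol) auto
    qed (use Re_s t in auto)
    fix y
    have "norm (- Ln (1 - exp (- s (Complex y (- 1))))) \<le> - ln (1 - norm (exp (- s (Complex y (- 1)))))"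
      using norm_Ln_one_minus_le[OF norm_exp_minus_less_1[of "s (Complex y (- 1))"]] Re_s t by simp
    also have "\<dots> = - ln (1 - exp (- t))" by (simp add: norm_exp_eq_Re Re_s)
    also have "\<dots> \<le> - ln (1 - exp (- t)) * exp \<bar>y\<bar>"
      using t mult_left_mono[of 1 "exp \<bar>y\<bar>" "- ln (1 - exp (- t))"] by simp
    finally show "norm (- Ln (1 - exp (- s (Complex y (- 1))))) \<le> - ln (1 - exp (- t)) * exp \<bar>y\<bar>" .
  qed simp
  have i2: "integrable lborel (\<lambda>y. gauss_kernel 1 (Complex y (- 1)) * log_ratio (s (Complex y (- 1))))"
  proof (rule integrable_gauss_kernel_mult[where F = "\<lambda>z. log_ratio (s z)" and C = "\<bar>Re (log_ratio (of_real t)) - 2 * ln (1 - exp (- t))\<bar>"])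
    show "(\<lambda>y. log_ratio (s (Complex y (- 1)))) \<in> borel_measurable borel"
    proof (rule holomorphic_horizontal_measurable[where F = "\<lambda>z. log_ratio (s z)"])
      show "(\<lambda>z. log_ratio (s z)) holomorphic_on {z. Re (s z) > 0}"
        using holomorphic_on_compose_gen[OF hol holomorphic_on_log_ratio] by (auto simp: o_def)
    qed (use Re_s t in auto)
    fix y
    have "norm (log_ratio (s (Complex y (- 1)))) \<le> \<bar>Re (log_ratio (of_real t)) - 2 * ln (1 - exp (- t))\<bar>"
      using log_ratio_real(2)[OF t Re_s] by (rule order_trans) simp
    also have "\<dots> \<le> \<bar>Re (log_ratio (of_real t)) - 2 * ln (1 - exp (- t))\<bar> * exp \<bar>y\<bar>"
      using mult_left_mono[of 1 "exp \<bar>y\<bar>" "\<bar>Re (log_ratio (of_real t)) - 2 * ln (1 - exp (- t))\<bar>"] by simp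
    finally show "norm (log_ratio (s (Complex y (- 1)))) \<le> \<bar>Re (log_ratio (of_real t)) - 2 * ln (1 - exp (- t))\<bar> * exp \<bar>y\<bar>" .
  qed simp
  have "horizontal_integral (\<lambda>z. gauss_kernel 1 z * log_zeta_rand (\<lambda>_. 1) (1 + s z)) (- 1) =
     (\<integral>y. gauss_kernel 1 (Complex y (- 1)) * log_ratio (s (Complex y (- 1))) +
        gauss_kernel 1 (Complex y (- 1)) * (- Ln (1 - exp (- s (Complex y (- 1))))) \<partial>lborel)"
    unfolding horizontal_integral_def by (simp add: log_ratio_def algebra_simps)
  also have "\<dots> = horizontal_integral (\<lambda>z. gauss_kernel 1 z * log_ratio (s z)) (- 1) +
     horizontal_integral (\<lambda>z. gauss_kernel 1 z * (- Ln (1 - exp (- s z)))) (- 1)"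
    unfolding horizontal_integral_def by (rule Bochner_Integration.integral_add[OF i2 i1])
  finally show "(\<lambda>p. if prime p then damped_log 1 (t\<^sup>2 / 2) p 1 else 0) sums
      (horizontal_integral (\<lambda>z. gauss_kernel 1 z * log_ratio (\<i> * of_real t * z)) (- 1) +
       (\<Sum>j. of_real (exp (- ((t\<^sup>2 / 2) * (real (Suc j))\<^sup>2)) / real (Suc j))))"
    using 1 unfolding 2 by (simp add: s_def)
qed

lemma log_ratio_integral_tendsto_0:
  "((\<lambda>t. horizontal_integral (\<lambda>z. gauss_kernel 1 z * log_ratio (\<i> * of_real t * z)) (- 1)) \<longlongrightarrow> 0) (at_right 0)"
proof -
  obtain r K where r: "r > 0" "r \<le> 1"
    and K: "\<And>t y. 0 < t \<Longrightarrow> t < r \<Longrightarrow> norm (log_ratio (of_real t * Complex 1 y)) \<le> K * exp \<bar>y\<bar>"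
    using log_ratio_scaled_bound by metis
  show ?thesis
  proof (rule tendsto_at_right_sequentially[OF r(1)])
    fix T :: "nat \<Rightarrow> real" assume T: "\<And>n. 0 < T n" "\<And>n. T n < r" "T \<longlonglongrightarrow> 0"
    have eq: "\<i> * of_real t * Complex y (- 1) = of_real t * Complex 1 y" for t y
      by (simp add: complex_eq_iff)
    have "(\<lambda>n. horizontal_integral (\<lambda>z. gauss_kernel 1 z * log_ratio (\<i> * of_real (T n) * z)) (- 1)) \<longlonglongrightarrow>
       horizontal_integral (\<lambda>z. gauss_kernel 1 z * 0) (- 1)"
    proof (rule horizontal_integral_limit[where C = K])
      show "(\<lambda>y. log_ratio (\<i> * of_real (T n) * Complex y (- 1))) \<in> borel_measurable borel" for n
      proof (rule holomorphic_horizontal_measurable[where F = "\<lambda>z. log_ratio (\<i> * of_real (T n) * z)"])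
        have "(\<lambda>z. \<i> * of_real (T n) * z) holomorphic_on {z. Re (\<i> * of_real (T n) * z) > 0}"
          by (intro holomorphic_intros)
        from holomorphic_on_compose_gen[OF this holomorphic_on_log_ratio]
        show "(\<lambda>z. log_ratio (\<i> * of_real (T n) * z)) holomorphic_on {z. Re (\<i> * of_real (T n) * z) > 0}"
          by (auto simp: o_def image_subset_iff)
      qed (use T(1) in auto)
      show "norm (log_ratio (\<i> * of_real (T n) * Complex y (- 1))) \<le> K * exp \<bar>y\<bar>" for n y
        unfolding eq by (rule K[OF T(1) T(2)])
      show "(\<lambda>n. log_ratio (\<i> * of_real (T n) * Complex y (- 1))) \<longlonglongrightarrow> 0" for y
        unfolding eq
      proof (rule filterlim_compose[OF log_ratio_tendsto_0])
        have "(\<lambda>n. of_real (T n) * Complex 1 y) \<longlonglongrightarrow> of_real 0 * Complex 1 y"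
          by (intro tendsto_intros T)
        then show "filterlim (\<lambda>n. of_real (T n) * Complex 1 y) (at 0 within {s. Re s > 0}) sequentially"
          unfolding filterlim_at using T(1) by (auto simp: complex_eq_iff order_less_imp_not_eq2)
      qed
    qed simp
    then show "(\<lambda>n. horizontal_integral (\<lambda>z. gauss_kernel 1 z * log_ratio (\<i> * of_real (T n) * z)) (- 1)) \<longlonglongrightarrow> 0"
      by (simp add: horizontal_integral_def)
  qed
qed

text \<open>Both sums diverge like \<open>ln (1 / b) / 2\<close> as \<open>b\<close> tends to 0. With \<open>t = sqrt (2 * b)\<close> their difference
  is the integral of \<open>log_ratio (t * (1 + \<i> * y))\<close> against a fixed kernel in \<open>y\<close>, and the arguments
  shrink to 0.\<close>

lemma smoothed_mertens:
  shows "((\<lambda>b. (\<Sum>p. if prime p then damped_log 1 b p 1 else 0) -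
      (\<Sum>j. of_real (exp (- (b * (real (Suc j))\<^sup>2)) / real (Suc j)))) \<longlongrightarrow> 0) (at_right 0)"
proof -
  have "filterlim (\<lambda>b. sqrt (2 * b)) (at_right 0) (at_right 0)" by real_asymp
  from filterlim_compose[OF log_ratio_integral_tendsto_0 this]
  have *: "((\<lambda>b. horizontal_integral (\<lambda>z. gauss_kernel 1 z * log_ratio (\<i> * of_real (sqrt (2 * b)) * z)) (- 1))
     \<longlongrightarrow> 0) (at_right 0)" .
  show ?thesis
  proof (rule Lim_transform_eventually[OF *])
    show "\<forall>\<^sub>F b in at_right 0. horizontal_integral (\<lambda>z. gauss_kernel 1 z * log_ratio (\<i> * of_real (sqrt (2 * b)) * z)) (- 1) =
      (\<Sum>p. if prime p then damped_log 1 b p 1 else 0) - (\<Sum>j. of_real (exp (- (b * (real (Suc j))\<^sup>2)) / real (Suc j)))"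
      using eventually_at_right_less[of 0]
    proof eventually_elim
      fix b :: real assume b: "0 < b"
      show "horizontal_integral (\<lambda>z. gauss_kernel 1 z * log_ratio (\<i> * of_real (sqrt (2 * b)) * z)) (- 1) =
        (\<Sum>p. if prime p then damped_log 1 b p 1 else 0) - (\<Sum>j. of_real (exp (- (b * (real (Suc j))\<^sup>2)) / real (Suc j)))"
        using smoothed_sums_line_integral[of "sqrt (2 * b)"] b by (simp add: sums_iff cong: if_cong)
    qed
  qed
qed

section \<open>Infinite products depending on a parameter\<close>

text \<open>The expansion of a product as \<open>1 + \<Sum>k. (\<Prod>j<k. f j) * (f k - 1)\<close> reduces the statement to
  Tannery's theorem for series; the terms are majorized by those of the same expansion of the
  convergent product of \<open>1 + m k\<close>. The factors may vanish.\<close>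

lemma tannery_product:
  fixes f :: "nat \<Rightarrow> 'b \<Rightarrow> complex"
  assumes lim: "\<And>k. ((\<lambda>b. f k b) \<longlongrightarrow> g k) F" and m: "summable m"
    and bound: "\<forall>\<^sub>F b in F. \<forall>k. norm (f k b - 1) \<le> m k" and F: "F \<noteq> bot"
  shows "((\<lambda>b. \<Prod>k. f k b) \<longlongrightarrow> (\<Prod>k. g k)) F" and "convergent_prod g"
    and "\<forall>\<^sub>F b in F. convergent_prod (\<lambda>k. f k b)"
proof -
  have gb: "norm (g k - 1) \<le> m k" for k
  proof (rule tendsto_upperbound[OF tendsto_norm[OF tendsto_diff[OF lim tendsto_const]] _ F])
    show "\<forall>\<^sub>F b in F. norm (f k b - 1) \<le> m k" using bound by eventually_elim simp
  qed
  have m0: "m k \<ge> 0" for k using gb[of k] norm_ge_zero order_trans by blast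
  define P where "P = (\<lambda>(h :: nat \<Rightarrow> complex) n. \<Prod>k<n. h k)"
  define Q where "Q = (\<lambda>n. \<Prod>k<n. 1 + m k)"
  have conv: "convergent_prod h" if "\<And>k. norm (h k - 1) \<le> m k" for h :: "nat \<Rightarrow> complex"
    using m that by (intro abs_convergent_prod_imp_convergent_prod summable_imp_abs_convergent_prod)
      (auto intro: summable_comparison_test')
  have QS: "summable (\<lambda>k. Q k * m k)"
  proof -
    have "convergent_prod (\<lambda>k. 1 + m k)"
      using m m0 by (intro abs_convergent_prod_imp_convergent_prod summable_imp_abs_convergent_prod) simp
    then have "(\<lambda>n. \<Prod>k\<le>n. 1 + m k) \<longlonglongrightarrow> (\<Prod>k. 1 + m k)" by (rule convergent_prod_LIMSEQ)
    then have "Q \<longlonglongrightarrow> (\<Prod>k. 1 + m k)" unfolding Q_def by (simp add: LIMSEQ_lessThan_iff_atMost)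
    then have "(\<lambda>k. Q (Suc k) - Q k) sums ((\<Prod>k. 1 + m k) - Q 0)" by (rule telescope_sums)
    moreover have "Q (Suc k) - Q k = Q k * m k" for k by (simp add: Q_def algebra_simps)
    ultimately show ?thesis by (simp add: sums_iff)
  qed
  have Pb: "norm (P h n) \<le> Q n" if "\<And>k. norm (h k - 1) \<le> m k" for h n
  proof -
    have "norm (h k) \<le> 1 + m k" for k
      using norm_triangle_ineq[of 1 "h k - 1"] that[of k] by simp
    then show ?thesis unfolding P_def Q_def by (simp add: prod_norm[symmetric] prod_mono)
  qed
  have lim_P: "(\<lambda>k. P h k * (h k - 1)) sums ((\<Prod>k. h k) - 1)" if "\<And>k. norm (h k - 1) \<le> m k" for h
  proof -
    have "(\<lambda>n. \<Prod>k\<le>n. h k) \<longlonglongrightarrow> (\<Prod>k. h k)" by (rule convergent_prod_LIMSEQ[OF conv[OF that]])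
    then have "P h \<longlonglongrightarrow> (\<Prod>k. h k)" unfolding P_def by (simp add: LIMSEQ_lessThan_iff_atMost)
    then have "(\<lambda>k. P h (Suc k) - P h k) sums ((\<Prod>k. h k) - P h 0)" by (rule telescope_sums)
    then show ?thesis by (simp add: P_def algebra_simps)
  qed
  have "((\<lambda>b. \<Sum>k. P (\<lambda>k. f k b) k * (f k b - 1)) \<longlongrightarrow> (\<Sum>k. P g k * (g k - 1))) F"
  proof (rule tannerys_theorem[where M = "\<lambda>k. Q k * m k", THEN conjunct2, THEN conjunct2])
    show "((\<lambda>b. P (\<lambda>k. f k b) k * (f k b - 1)) \<longlongrightarrow> P g k * (g k - 1)) F" for k
      unfolding P_def by (intro tendsto_intros lim)
    have "\<forall>\<^sub>F b in F. \<forall>k. norm (P (\<lambda>k. f k b) k * (f k b - 1)) \<le> Q k * m k"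
      using bound
    proof eventually_elim
      fix b assume b: "\<forall>k. norm (f k b - 1) \<le> m k"
      show "\<forall>k. norm (P (\<lambda>k. f k b) k * (f k b - 1)) \<le> Q k * m k"
        unfolding norm_mult
        using b m0 by (intro allI mult_mono Pb) (auto simp: Q_def intro!: prod_nonneg add_nonneg_nonneg)
    qed
    then show "\<forall>\<^sub>F (k, b) in sequentially \<times>\<^sub>F F. norm (P (\<lambda>k. f k b) k * (f k b - 1)) \<le> Q k * m k"
      unfolding eventually_prod_filter
      by (intro exI[of _ "\<lambda>_. True"] exI[of _ "\<lambda>b. \<forall>k. norm (P (\<lambda>k. f k b) k * (f k b - 1)) \<le> Q k * m k"]) auto
  qed (use QS F in auto)
  then have "((\<lambda>b. (\<Sum>k. P (\<lambda>k. f k b) k * (f k b - 1)) + 1) \<longlongrightarrow> (\<Sum>k. P g k * (g k - 1)) + 1) F"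
    by (intro tendsto_add tendsto_const)
  moreover have "(\<Sum>k. P g k * (g k - 1)) + 1 = (\<Prod>k. g k)"
    using lim_P[of g] gb by (simp add: sums_iff)
  moreover have "\<forall>\<^sub>F b in F. (\<Sum>k. P (\<lambda>k. f k b) k * (f k b - 1)) + 1 = (\<Prod>k. f k b)"
    using bound
  proof eventually_elim
    fix b assume "\<forall>k. norm (f k b - 1) \<le> m k"
    then show "(\<Sum>k. P (\<lambda>k. f k b) k * (f k b - 1)) + 1 = (\<Prod>k. f k b)"
      using lim_P[of "\<lambda>k. f k b"] by (simp add: sums_iff)
  qed
  ultimately show "((\<lambda>b. \<Prod>k. f k b) \<longlongrightarrow> (\<Prod>k. g k)) F"
    by (simp add: tendsto_cong)
  show "convergent_prod g" by (rule conv[OF gb])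
  show "\<forall>\<^sub>F b in F. convergent_prod (\<lambda>k. f k b)"
    using bound by eventually_elim (simp add: conv)
qed

section \<open>The uniform distribution on the circle\<close>

lemma prob_space_uniform_circle: "prob_space uniform_circle"
  unfolding uniform_circle_def
proof (rule prob_space.prob_space_distr)
  show "prob_space (uniform_measure lborel {0..2 * pi})"
    by (rule prob_space_uniform_measure) auto
  show "cis \<in> uniform_measure lborel {0..2 * pi} \<rightarrow>\<^sub>M borel"
    unfolding cis_conv_exp by measurable
qed

lemma sets_uniform_circle [measurable_cong, simp]: "sets uniform_circle = sets borel"
  and space_uniform_circle [simp]: "space uniform_circle = UNIV"
  by (simp_all add: uniform_circle_def)

lemma borel_measurable_cis [measurable]: "cis \<in> borel_measurable borel"
  unfolding cis_conv_exp by measurable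

lemma AE_uniform_circle: "AE u in uniform_circle. norm u = 1"
  unfolding uniform_circle_def by (subst AE_distr_iff) auto

lemma integral_uniform_circle:
  fixes f :: "complex \<Rightarrow> complex"
  assumes [measurable]: "f \<in> borel_measurable borel"
  shows "(\<integral>u. f u \<partial>uniform_circle) = (\<integral>t. indicator {0..2 * pi} t *\<^sub>R f (cis t) \<partial>lborel) / of_real (2 * pi)"
proof -
  have "(\<integral>u. f u \<partial>uniform_circle) = (\<integral>t. f (cis t) \<partial>uniform_measure lborel {0..2 * pi})"
    unfolding uniform_circle_def by (rule integral_distr) auto
  also have "uniform_measure lborel {0..2 * pi} = density lborel (\<lambda>t. ennreal (indicator {0..2 * pi} t / (2 * pi)))"
    unfolding uniform_measure_def
    using divide_ennreal[of 1 "2 * pi"] by (intro density_cong) (auto simp: indicator_def)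
  also have "(\<integral>t. f (cis t) \<partial>\<dots>) = (\<integral>t. (indicator {0..2 * pi} t / (2 * pi)) *\<^sub>R f (cis t) \<partial>lborel)"
    by (rule integral_density) auto
  also have "\<dots> = (\<integral>t. (indicator {0..2 * pi} t *\<^sub>R f (cis t)) / of_real (2 * pi) \<partial>lborel)"
    by (simp add: scaleR_conv_of_real field_simps)
  finally show ?thesis by (simp only: integral_divide_zero)
qed

lemma integral_cis_int:
  fixes k :: int
  shows "(\<integral>t. indicator {0..2 * pi} t *\<^sub>R cis (of_int k * t) \<partial>lborel) = (if k = 0 then of_real (2 * pi) else 0)"
proof (cases "k = 0")
  case True
  then show ?thesis by (simp add: scaleR_conv_of_real)
next
  case False
  define F where "F = (\<lambda>t. cis (of_int k * t) / (\<i> * of_int k))"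
  have "(\<integral>t. indicator {0..2 * pi} t *\<^sub>R cis (of_int k * t) \<partial>lborel) = F (2 * pi) - F 0"
  proof (rule integral_FTC_Icc)
    fix t :: real
    show "(F has_vector_derivative cis (of_int k * t)) (at t within {0..2 * pi})"
    proof -
      have "((\<lambda>z. exp (\<i> * (of_int k * z)) / (\<i> * of_int k)) has_field_derivative
          exp (\<i> * (of_int k * of_real t))) (at (of_real t :: complex))"
        using False by (auto intro!: derivative_eq_intros simp: mult_ac complex_i_mult_minus)
      from has_vector_derivative_real_field[OF this] show ?thesis
        unfolding F_def cis_conv_exp by simp
    qed
  qed (auto intro!: continuous_intros)
  also have "F (2 * pi) = F 0"
    using cis_multiple_2pi[of "of_int k"] by (simp add: F_def mult_ac)
  finally show ?thesis using False by simp
qed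

lemma uniform_circle_moments:
  "(\<integral>u. u ^ m * cnj u ^ n \<partial>uniform_circle) = (if m = n then 1 else 0)"
  "(\<integral>u. u ^ m * u ^ n \<partial>uniform_circle) = (if m = 0 \<and> n = 0 then 1 else 0)"
  "(\<integral>u. cnj u ^ m * cnj u ^ n \<partial>uniform_circle) = (if m = 0 \<and> n = 0 then 1 else 0)"
proof -
  have *: "(\<integral>u. f u \<partial>uniform_circle) = (if k = 0 then 1 else 0)"
    if "f \<in> borel_measurable borel" "\<And>t. f (cis t) = cis (of_int k * t)" for f :: "complex \<Rightarrow> complex" and k :: int
    unfolding integral_uniform_circle[OF that(1)] that(2) integral_cis_int by simp
  have cnj [measurable]: "(\<lambda>u :: complex. cnj u) \<in> borel_measurable borel"
    by (intro borel_measurable_continuous_onI continuous_intros)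
  have "cis t ^ m * cnj (cis t) ^ n = cis (of_int (int m - int n) * t)"
    "cis t ^ m * cis t ^ n = cis (of_int (int m + int n) * t)"
    "cnj (cis t) ^ m * cnj (cis t) ^ n = cis (of_int (- int m - int n) * t)" for t
    unfolding cis_cnj Complex.DeMoivre cis_mult by (rule arg_cong[of _ _ cis], simp add: algebra_simps)+
  note this[THEN *[rotated]]
  then show "(\<integral>u. u ^ m * cnj u ^ n \<partial>uniform_circle) = (if m = n then 1 else 0)"
    "(\<integral>u. u ^ m * u ^ n \<partial>uniform_circle) = (if m = 0 \<and> n = 0 then 1 else 0)"
    "(\<integral>u. cnj u ^ m * cnj u ^ n \<partial>uniform_circle) = (if m = 0 \<and> n = 0 then 1 else 0)"
    by auto
qed

lemma (in prob_space) integral_series_mult: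
  fixes f :: "nat \<Rightarrow> 'a \<Rightarrow> complex"
  assumes [measurable]: "\<And>n. f n \<in> borel_measurable M" "g \<in> borel_measurable M"
    and f: "AE x in M. \<forall>n. norm (f n x) \<le> 1" and g: "AE x in M. norm (g x) \<le> B"
    and a: "summable (\<lambda>n. norm (a n))"
  shows "(\<integral>x. (\<Sum>n. a n * f n x) * g x \<partial>M) = (\<Sum>n. a n * (\<integral>x. f n x * g x \<partial>M))"
proof -
  have fg: "AE x in M. \<forall>n. norm (f n x * g x) \<le> \<bar>B\<bar>"
    using f g
  proof eventually_elim
    fix x assume x: "\<forall>n. norm (f n x) \<le> 1" "norm (g x) \<le> B"
    show "\<forall>n. norm (f n x * g x) \<le> \<bar>B\<bar>"
    proof
      fix n
      have "norm (f n x * g x) \<le> 1 * \<bar>B\<bar>" unfolding norm_mult using x by (intro mult_mono) auto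
      then show "norm (f n x * g x) \<le> \<bar>B\<bar>" by simp
    qed
  qed
  have int: "integrable M (\<lambda>x. f n x * g x)" for n
    using fg by (intro integrable_const_bound[where B = "\<bar>B\<bar>"]) auto
  have "(\<integral>x. (\<Sum>n. a n * f n x) * g x \<partial>M) = (\<integral>x. (\<Sum>n. a n * (f n x * g x)) \<partial>M)"
  proof (rule integral_cong_AE)
    show "AE x in M. (\<Sum>n. a n * f n x) * g x = (\<Sum>n. a n * (f n x * g x))"
      using f
    proof eventually_elim
      fix x assume x: "\<forall>n. norm (f n x) \<le> 1"
      have "summable (\<lambda>n. a n * f n x)"
      proof (rule summable_comparison_test'[OF a])
        fix n show "norm (a n * f n x) \<le> norm (a n)"
          using x mult_left_mono[of "norm (f n x)" 1 "norm (a n)"] by (simp add: norm_mult)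
      qed
      from suminf_mult2[OF this, of "g x"]
      show "(\<Sum>n. a n * f n x) * g x = (\<Sum>n. a n * (f n x * g x))" by (simp add: mult.assoc)
    qed
  qed measurable
  also have "\<dots> = (\<Sum>n. \<integral>x. a n * (f n x * g x) \<partial>M)"
  proof (rule integral_suminf)
    show "integrable M (\<lambda>x. a n * (f n x * g x))" for n by (intro integrable_mult_right int)
    show "AE x in M. summable (\<lambda>n. norm (a n * (f n x * g x)))"
      using fg
    proof eventually_elim
      fix x assume x: "\<forall>n. norm (f n x * g x) \<le> \<bar>B\<bar>"
      show "summable (\<lambda>n. norm (a n * (f n x * g x)))"
        by (rule summable_comparison_test'[OF summable_mult2[OF a, of "\<bar>B\<bar>"]])
          (use x in \<open>simp add: norm_mult[of "a _"] mult_left_mono\<close>)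
    qed
    show "summable (\<lambda>n. \<integral>x. norm (a n * (f n x * g x)) \<partial>M)"
    proof (rule summable_comparison_test'[OF summable_mult2[OF a, of "\<bar>B\<bar>"]])
      fix n
      have "(\<integral>x. norm (a n * (f n x * g x)) \<partial>M) \<le> (\<integral>x. norm (a n) * \<bar>B\<bar> \<partial>M)"
      proof (rule integral_mono_AE)
        show "integrable M (\<lambda>x. norm (a n * (f n x * g x)))" by (intro integrable_norm integrable_mult_right int)
        show "AE x in M. norm (a n * (f n x * g x)) \<le> norm (a n) * \<bar>B\<bar>"
          using fg by eventually_elim (simp add: norm_mult[of "a _"] mult_left_mono)
      qed simp
      then show "norm (\<integral>x. norm (a n * (f n x * g x)) \<partial>M) \<le> norm (a n) * \<bar>B\<bar>"
        by (simp add: prob_space)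
    qed
  qed
  also have "\<dots> = (\<Sum>n. a n * (\<integral>x. f n x * g x \<partial>M))"
    by (simp only: integral_mult_right_zero)
  finally show ?thesis .
qed

lemma (in prob_space) integral_double_series:
  fixes f h :: "nat \<Rightarrow> 'a \<Rightarrow> complex"
  assumes [measurable]: "\<And>n. f n \<in> borel_measurable M" "\<And>n. h n \<in> borel_measurable M"
    and f: "AE x in M. \<forall>n. norm (f n x) \<le> 1" and h: "AE x in M. \<forall>n. norm (h n x) \<le> 1"
    and a: "summable (\<lambda>n. norm (a n))" and c: "summable (\<lambda>n. norm (c n))"
  shows "(\<integral>x. (\<Sum>m. a m * f m x) * (\<Sum>n. c n * h n x) \<partial>M) =
     (\<Sum>m. a m * (\<Sum>n. c n * (\<integral>x. f m x * h n x \<partial>M)))"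
proof -
  have g: "AE x in M. norm (\<Sum>n. c n * h n x) \<le> (\<Sum>n. norm (c n))"
    using h
  proof eventually_elim
    fix x assume x: "\<forall>n. norm (h n x) \<le> 1"
    show "norm (\<Sum>n. c n * h n x) \<le> (\<Sum>n. norm (c n))"
    proof (rule norm_suminf_le[OF _ c])
      fix n show "norm (c n * h n x) \<le> norm (c n)"
        using x mult_left_mono[of "norm (h n x)" 1 "norm (c n)"] by (simp add: norm_mult)
    qed
  qed
  have "(\<integral>x. (\<Sum>m. a m * f m x) * (\<Sum>n. c n * h n x) \<partial>M) =
     (\<Sum>m. a m * (\<integral>x. f m x * (\<Sum>n. c n * h n x) \<partial>M))"
    by (rule integral_series_mult[OF _ _ f g a]) measurable
  moreover have "(\<integral>x. f m x * (\<Sum>n. c n * h n x) \<partial>M) = (\<Sum>n. c n * (\<integral>x. f m x * h n x \<partial>M))" for m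
  proof -
    have fm: "AE x in M. norm (f m x) \<le> 1" using f by eventually_elim simp
    show ?thesis
      using integral_series_mult[OF assms(2) assms(1)[of m] h fm c] by (simp add: mult.commute)
  qed
  ultimately show ?thesis by simp
qed

text \<open>Orthogonality of the powers on the circle: if one factor is conjugated, equal indices survive
  (Parseval); if both factors are of the same kind, only the constant terms survive.\<close>

lemma circle_double_series:
  assumes a: "summable (\<lambda>n. norm (a n :: complex))" and c: "summable (\<lambda>n. norm (c n :: complex))"
  shows "(\<integral>u. (\<Sum>m. a m * u ^ m) * (\<Sum>n. c n * cnj u ^ n) \<partial>uniform_circle) = (\<Sum>m. a m * c m)"
    and "(\<integral>u. (\<Sum>m. a m * u ^ m) * (\<Sum>n. c n * u ^ n) \<partial>uniform_circle) = a 0 * c 0"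
    and "(\<integral>u. (\<Sum>m. a m * cnj u ^ m) * (\<Sum>n. c n * cnj u ^ n) \<partial>uniform_circle) = a 0 * c 0"
proof -
  interpret prob_space uniform_circle by (rule prob_space_uniform_circle)
  have [measurable]: "(\<lambda>u :: complex. cnj u ^ n) \<in> borel_measurable borel" for n
    by (intro borel_measurable_continuous_onI continuous_intros)
  have b: "AE u in uniform_circle. \<forall>n. norm (u ^ n) \<le> 1" "AE u in uniform_circle. \<forall>n. norm (cnj u ^ n) \<le> 1"
    using AE_uniform_circle by (eventually_elim, simp add: norm_power)+
  have s1: "(\<Sum>n. c n * (if m = n then 1 else 0)) = c m" for m
    using sums_If_finite_set[of "{m}" c] by (simp add: sums_iff if_distrib eq_commute[of m] cong: if_cong)
  have s0: "(\<Sum>n. c n * (if m = 0 \<and> n = 0 then 1 else 0)) = (if m = 0 then c 0 else 0)" for m :: nat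
    using sums_If_finite_set[of "{0}" c] by (simp add: sums_iff if_distrib cong: if_cong)
  have s2: "(\<Sum>m. a m * (if m = 0 then c 0 else 0)) = a 0 * c 0"
    using sums_If_finite_set[of "{0}" "\<lambda>m. a m * c 0"] by (simp add: sums_iff if_distrib cong: if_cong)
  show "(\<integral>u. (\<Sum>m. a m * u ^ m) * (\<Sum>n. c n * cnj u ^ n) \<partial>uniform_circle) = (\<Sum>m. a m * c m)"
    by (subst integral_double_series[OF _ _ b a c]) (simp_all add: uniform_circle_moments s1)
  show "(\<integral>u. (\<Sum>m. a m * u ^ m) * (\<Sum>n. c n * u ^ n) \<partial>uniform_circle) = a 0 * c 0"
    by (subst integral_double_series[OF _ _ b(1) b(1) a c]) (simp_all add: uniform_circle_moments s0 s2)
  show "(\<integral>u. (\<Sum>m. a m * cnj u ^ m) * (\<Sum>n. c n * cnj u ^ n) \<partial>uniform_circle) = a 0 * c 0"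
    by (subst integral_double_series[OF _ _ b(2) b(2) a c]) (simp_all add: uniform_circle_moments s0 s2)
qed

lemma norm_exp_quadratic_remainder:
  fixes w :: complex
  shows "norm (exp w - (1 + w + w\<^sup>2 / 2)) \<le> norm w ^ 3 * exp (norm w)"
proof -
  have "(\<lambda>n. w ^ n /\<^sub>R fact n) sums exp w" by (rule exp_converges)
  then have "(\<lambda>n. w ^ (n + 3) /\<^sub>R fact (n + 3)) sums (exp w - (\<Sum>i<3. w ^ i /\<^sub>R fact i))"
    by (rule sums_split_initial_segment)
  moreover have "(\<Sum>i<3. w ^ i /\<^sub>R fact i) = 1 + w + w\<^sup>2 / 2"
    by (simp add: eval_nat_numeral scaleR_conv_of_real)
  ultimately have s: "(\<lambda>n. w ^ (n + 3) /\<^sub>R fact (n + 3)) sums (exp w - (1 + w + w\<^sup>2 / 2))" by simp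
  have e: "(\<lambda>n. norm w ^ 3 * (norm w ^ n /\<^sub>R fact n)) sums (norm w ^ 3 * exp (norm w))"
    by (intro sums_mult exp_converges)
  have "norm (w ^ (n + 3) /\<^sub>R fact (n + 3)) \<le> norm w ^ 3 * (norm w ^ n /\<^sub>R fact n)" for n
  proof -
    have "norm (w ^ (n + 3) /\<^sub>R fact (n + 3)) = norm w ^ (n + 3) / fact (n + 3)"
      by (simp add: norm_power divide_inverse mult.commute del: fact_Suc)
    also have "\<dots> \<le> norm w ^ (n + 3) / fact n"
      by (intro divide_left_mono fact_mono) auto
    finally show ?thesis by (simp add: power_add field_simps)
  qed
  from norm_suminf_le[OF this sums_summable[OF e]] show ?thesis
    using s e by (simp add: sums_iff)
qed

text \<open>With \<open>w = \<kappa>1 * G + \<kappa>2 * cnj G\<close> the terms of \<open>exp w\<close> up to second order are integrated exactly. As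
  \<open>a 0 = 0\<close>, the means of \<open>G\<close>, \<open>G\<^sup>2\<close> and their conjugates vanish, and of \<open>w\<^sup>2\<close> only
  \<open>2 * \<kappa>1 * \<kappa>2 * (norm G)\<^sup>2\<close> contributes. The rest is bounded by the cubic remainder of the exponential.\<close>

lemma circle_moment_expansion:
  fixes a :: "nat \<Rightarrow> real" and \<kappa> :: "complex \<times> complex"
  assumes a: "summable (\<lambda>n. \<bar>a n\<bar>)" and a0: "a 0 = 0"
  defines "G \<equiv> (\<lambda>u. \<Sum>n. of_real (a n) * u ^ n)"
  defines "R \<equiv> (norm (fst \<kappa>) + norm (snd \<kappa>)) * (\<Sum>n. \<bar>a n\<bar>)"
  shows "norm ((\<integral>u. exp (kcirc \<kappa> (G u)) \<partial>uniform_circle) - (1 + fst \<kappa> * snd \<kappa> * of_real (\<Sum>n. (a n)\<^sup>2))) \<le> R ^ 3 * exp R"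
proof -
  interpret prob_space uniform_circle by (rule prob_space_uniform_circle)
  have prob_UNIV: "prob UNIV = 1" using prob_space by simp
  define c where "c = (\<lambda>n. complex_of_real (a n))"
  have c: "summable (\<lambda>n. norm (c n))" using a by (simp add: c_def)
  define H where "H = (\<lambda>u. \<Sum>n. c n * cnj u ^ n)"
  have G: "G = (\<lambda>u. \<Sum>n. c n * u ^ n)" by (simp add: G_def c_def)
  have HG: "H u = cnj (G u)" if "norm u = 1" for u
  proof -
    have "summable (\<lambda>n. c n * u ^ n)"
      by (rule summable_comparison_test'[OF c]) (simp add: norm_mult norm_power that)
    then have "(\<lambda>n. c n * u ^ n) sums G u" by (simp add: G summable_sums)
    then have "(\<lambda>n. cnj (c n * u ^ n)) sums cnj (G u)" by (simp only: sums_cnj)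
    then show ?thesis by (simp add: H_def sums_iff c_def)
  qed
  have Gb: "norm (G u) \<le> (\<Sum>n. \<bar>a n\<bar>)" if "norm u = 1" for u
    unfolding G using that by (intro norm_suminf_le a) (simp add: norm_mult norm_power c_def)
  \<comment> \<open>a power series that agrees with \<open>kcirc \<kappa> (G u)\<close> on the circle\<close>
  define w where "w = (\<lambda>u. fst \<kappa> * G u + snd \<kappa> * H u)"
  have wb: "norm (w u) \<le> R" if "norm u = 1" for u
  proof -
    have "norm (w u) \<le> norm (fst \<kappa>) * norm (G u) + norm (snd \<kappa>) * norm (H u)"
      unfolding w_def by (rule order_trans[OF norm_triangle_ineq]) (simp add: norm_mult)
    also have "\<dots> \<le> norm (fst \<kappa>) * (\<Sum>n. \<bar>a n\<bar>) + norm (snd \<kappa>) * (\<Sum>n. \<bar>a n\<bar>)"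
      using Gb[OF that] by (intro add_mono mult_left_mono) (auto simp: HG[OF that])
    finally show ?thesis by (simp add: R_def distrib_right)
  qed
  have [measurable]: "(\<lambda>u :: complex. cnj u) \<in> borel_measurable borel"
    by (intro borel_measurable_continuous_onI continuous_intros)
  have Gm [measurable]: "G \<in> borel_measurable borel" unfolding G by measurable
  have Hm [measurable]: "H \<in> borel_measurable borel" unfolding H_def by measurable
  have wm [measurable]: "w \<in> borel_measurable borel" unfolding w_def by measurable
  have AEb: "integrable uniform_circle f" if [measurable]: "f \<in> borel_measurable borel"
     and "\<And>u. norm u = 1 \<Longrightarrow> norm (f u) \<le> B" for f :: "complex \<Rightarrow> complex" and B :: real
  proof (rule integrable_const_bound)
    show "AE u in uniform_circle. norm (f u) \<le> B"
      using AE_uniform_circle by eventually_elim (rule that(2))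
  qed measurable
  have iw: "integrable uniform_circle w" by (rule AEb[OF wm wb])
  have iw2: "integrable uniform_circle (\<lambda>u. (w u)\<^sup>2)"
    by (rule AEb[of "\<lambda>u. (w u)\<^sup>2" "R\<^sup>2"]) (auto simp: norm_power wb intro!: power_mono)
  have ie: "integrable uniform_circle (\<lambda>u. exp (w u))"
    by (rule AEb[of "\<lambda>u. exp (w u)" "exp R"]) (auto intro: order_trans[OF complex_Re_le_cmod wb])
  have one: "(\<lambda>n. if n = 0 then 1 else 0 :: complex) sums 1"
    using sums_If_finite_set[of "{0}" "\<lambda>_. 1::complex"] by simp
  have o1: "(\<Sum>n. (if n = 0 then 1 else 0) * v ^ n) = 1" for v :: complex
    by (subst suminf_finite[of "{0}"]) auto
  have so: "summable (\<lambda>n. norm (if n = 0 then 1 else 0 :: complex))"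
    using one by (simp add: sums_iff if_distrib cong: if_cong)
  have c0: "c 0 = 0" by (simp add: c_def a0)
  have EG: "(\<integral>u. G u \<partial>uniform_circle) = 0"
    using circle_double_series(2)[OF c so] unfolding o1 G c0 by simp
  have EH: "(\<integral>u. H u \<partial>uniform_circle) = 0"
    using circle_double_series(3)[OF c so] unfolding o1 H_def c0 by simp
  have EGG: "(\<integral>u. G u * G u \<partial>uniform_circle) = 0"
    using circle_double_series(2)[OF c c] unfolding G c0 by simp
  have EHH: "(\<integral>u. H u * H u \<partial>uniform_circle) = 0"
    using circle_double_series(3)[OF c c] unfolding H_def c0 by simp
  have a2: "summable (\<lambda>n. (a n)\<^sup>2)"
  proof -
    have "(\<lambda>n. \<bar>a n\<bar>) \<longlonglongrightarrow> 0" by (rule summable_LIMSEQ_zero[OF a])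
    then have "\<forall>\<^sub>F n in sequentially. \<bar>a n\<bar> < 1" by (rule order_tendstoD) simp
    then have "\<forall>\<^sub>F n in sequentially. norm ((a n)\<^sup>2) \<le> \<bar>a n\<bar>"
    proof eventually_elim
      fix n assume "\<bar>a n\<bar> < 1"
      then have "\<bar>a n\<bar> * \<bar>a n\<bar> \<le> \<bar>a n\<bar> * 1" by (intro mult_left_mono) auto
      then show "norm ((a n)\<^sup>2) \<le> \<bar>a n\<bar>" by (simp add: power2_eq_square)
    qed
    then show ?thesis by (rule summable_comparison_test_ev[OF _ a])
  qed
  have EGH: "(\<integral>u. G u * H u \<partial>uniform_circle) = of_real (\<Sum>n. (a n)\<^sup>2)"
  proof -
    have "(\<integral>u. G u * H u \<partial>uniform_circle) = (\<Sum>n. c n * c n)"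
      using circle_double_series(1)[OF c c] unfolding G H_def .
    also have "\<dots> = of_real (\<Sum>n. (a n)\<^sup>2)"
      by (subst suminf_of_real[OF a2]) (simp add: c_def power2_eq_square)
    finally show ?thesis .
  qed
  have Hb: "norm (H u) \<le> (\<Sum>n. \<bar>a n\<bar>)" if "norm u = 1" for u using Gb[OF that] HG[OF that] by simp
  have iG: "integrable uniform_circle G" and iH: "integrable uniform_circle H"
    by (rule AEb[OF _ Gb], auto) (rule AEb[OF _ Hb], auto)
  have prods: "integrable uniform_circle (\<lambda>u. f u * h u)"
    if [measurable]: "f \<in> borel_measurable borel" "h \<in> borel_measurable borel"
      and "\<And>u. norm u = 1 \<Longrightarrow> norm (f u) \<le> (\<Sum>n. \<bar>a n\<bar>)" "\<And>u. norm u = 1 \<Longrightarrow> norm (h u) \<le> (\<Sum>n. \<bar>a n\<bar>)"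
    for f h :: "complex \<Rightarrow> complex"
    using that(3,4) suminf_nonneg[OF a]
    by (intro AEb[of "\<lambda>u. f u * h u" "(\<Sum>n. \<bar>a n\<bar>) * (\<Sum>n. \<bar>a n\<bar>)"]) (auto simp: norm_mult intro!: mult_mono)
  note ip = prods[OF Gm Gm Gb Gb] prods[OF Gm Hm Gb Hb] prods[OF Hm Hm Hb Hb]
  have Ew: "(\<integral>u. w u \<partial>uniform_circle) = 0"
    unfolding w_def using iG iH by (simp add: EG EH)
  have Ew2: "(\<integral>u. (w u)\<^sup>2 \<partial>uniform_circle) = 2 * (fst \<kappa> * snd \<kappa> * of_real (\<Sum>n. (a n)\<^sup>2))"
  proof -
    have "(\<integral>u. (w u)\<^sup>2 \<partial>uniform_circle) =
      (\<integral>u. (fst \<kappa>)\<^sup>2 * (G u * G u) + (2 * fst \<kappa> * snd \<kappa> * (G u * H u) + (snd \<kappa>)\<^sup>2 * (H u * H u)) \<partial>uniform_circle)"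
      unfolding w_def by (simp add: power2_eq_square algebra_simps)
    also have "\<dots> = (fst \<kappa>)\<^sup>2 * 0 + (2 * fst \<kappa> * snd \<kappa> * of_real (\<Sum>n. (a n)\<^sup>2) + (snd \<kappa>)\<^sup>2 * 0)"
      by (simp add: ip EGG EGH EHH)
    finally show ?thesis by simp
  qed
  have "(\<integral>u. exp (kcirc \<kappa> (G u)) \<partial>uniform_circle) = (\<integral>u. exp (w u) \<partial>uniform_circle)"
  proof (rule integral_cong_AE)
    show "AE u in uniform_circle. exp (kcirc \<kappa> (G u)) = exp (w u)"
      using AE_uniform_circle by eventually_elim (simp add: kcirc_def w_def HG)
    show "(\<lambda>u. exp (kcirc \<kappa> (G u))) \<in> borel_measurable uniform_circle"
      unfolding kcirc_def by measurable
  qed measurable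
  moreover have "1 + fst \<kappa> * snd \<kappa> * of_real (\<Sum>n. (a n)\<^sup>2) = (\<integral>u. 1 + w u + (w u)\<^sup>2 / 2 \<partial>uniform_circle)"
    using iw iw2 by (simp add: Ew Ew2 prob_UNIV)
  ultimately have "(\<integral>u. exp (kcirc \<kappa> (G u)) \<partial>uniform_circle) - (1 + fst \<kappa> * snd \<kappa> * of_real (\<Sum>n. (a n)\<^sup>2))
     = (\<integral>u. exp (w u) - (1 + w u + (w u)\<^sup>2 / 2) \<partial>uniform_circle)"
    using ie iw iw2 by simp
  also have "norm \<dots> \<le> R ^ 3 * exp R"
  proof (rule order_trans[OF integral_norm_bound])
    have "(\<integral>u. norm (exp (w u) - (1 + w u + (w u)\<^sup>2 / 2)) \<partial>uniform_circle) \<le> (\<integral>u. R ^ 3 * exp R \<partial>uniform_circle)"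
    proof (rule integral_mono_AE)
      show "integrable uniform_circle (\<lambda>u. norm (exp (w u) - (1 + w u + (w u)\<^sup>2 / 2)))"
        using ie iw iw2 by (intro integrable_norm Bochner_Integration.integrable_diff Bochner_Integration.integrable_add) auto
      show "AE u in uniform_circle. norm (exp (w u) - (1 + w u + (w u)\<^sup>2 / 2)) \<le> R ^ 3 * exp R"
        using AE_uniform_circle
      proof eventually_elim
        fix u :: complex assume u: "norm u = 1"
        have "norm (exp (w u) - (1 + w u + (w u)\<^sup>2 / 2)) \<le> norm (w u) ^ 3 * exp (norm (w u))"
          by (rule norm_exp_quadratic_remainder)
        also have "\<dots> \<le> R ^ 3 * exp R"
          using wb[OF u] order_trans[OF norm_ge_zero wb[OF u]] by (intro mult_mono power_mono) auto
        finally show "norm (exp (w u) - (1 + w u + (w u)\<^sup>2 / 2)) \<le> R ^ 3 * exp R" .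
      qed
    qed simp
    then show "(\<integral>u. norm (exp (w u) - (1 + w u + (w u)\<^sup>2 / 2)) \<partial>uniform_circle) \<le> R ^ 3 * exp R"
      by (simp add: prob_UNIV)
  qed
  finally show ?thesis .
qed

section \<open>Local factors\<close>

text \<open>The coefficients of \<open>damped_log\<close> as a power series in its last argument, with index 0 included so
  that the results on power series on the circle apply.\<close>

definition damped_coeff :: "real \<Rightarrow> real \<Rightarrow> nat \<Rightarrow> nat \<Rightarrow> real" where
  "damped_coeff a b p n =
     (if n = 0 then 0 else real p powr (- (a * real n)) * exp (- (b * (real n * ln (real p))\<^sup>2)) / real n)"

lemma damped_coeff_bounds:
  assumes "p > 0" "0 \<le> b"
  shows "0 \<le> damped_coeff a b p n" "damped_coeff a b p n \<le> (real p powr (- a)) ^ n"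
proof -
  show "0 \<le> damped_coeff a b p n" by (simp add: damped_coeff_def)
  have "damped_coeff a b p n \<le> real p powr (- (a * real n)) * 1 / 1" if "n > 0"
  proof -
    have "real p powr (- (a * real n)) * exp (- (b * (real n * ln (real p))\<^sup>2)) / real n \<le>
        real p powr (- (a * real n)) * 1 / 1"
      by (intro frac_le mult_mono) (use that assms in auto)
    then show ?thesis using that by (simp add: damped_coeff_def)
  qed
  moreover have "real p powr (- (a * real n)) = (real p powr (- a)) ^ n"
    using assms by (simp add: powr_powr flip: powr_realpow)
  ultimately show "damped_coeff a b p n \<le> (real p powr (- a)) ^ n"
    by (cases "n = 0") (simp_all add: damped_coeff_def)
qed

lemma prime_powr_less_1:
  assumes "prime p" "a > 0"
  shows "0 < real p powr (- a)" "real p powr (- a) < 1"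
  using prime_gt_1_nat[OF assms(1)] assms(2) by (auto simp: powr_less_one)

lemma summable_damped_coeff:
  assumes "prime p" "0 \<le> b" "a > 0"
  shows "summable (damped_coeff a b p)" "summable (\<lambda>n. \<bar>damped_coeff a b p n\<bar>)"
proof -
  have p: "p > 0" using prime_gt_0_nat[OF assms(1)] .
  have "summable (\<lambda>n. (real p powr (- a)) ^ n)"
    using prime_powr_less_1[OF assms(1,3)] by (intro summable_geometric) auto
  then show 1: "summable (damped_coeff a b p)"
    by (rule summable_comparison_test') (use damped_coeff_bounds[OF p assms(2)] in auto)
  show "summable (\<lambda>n. \<bar>damped_coeff a b p n\<bar>)"
    using 1 damped_coeff_bounds(1)[OF p assms(2)] by simp
qed

lemma damped_log_power_series:
  assumes "prime p" "0 \<le> b" "a > 0" "norm y \<le> 1"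
  shows "damped_log a b p y = (\<Sum>n. of_real (damped_coeff a b p n) * y ^ n)"
proof -
  have sm: "summable (\<lambda>n. of_real (damped_coeff a b p n) * y ^ n)"
  proof (rule summable_comparison_test'[OF summable_damped_coeff(2)[OF assms(1-3)]])
    fix n
    show "norm (of_real (damped_coeff a b p n) * y ^ n) \<le> \<bar>damped_coeff a b p n\<bar>"
      using assms(4) mult_left_mono[of "norm y ^ n" 1 "\<bar>damped_coeff a b p n\<bar>"]
      by (simp add: norm_mult norm_power power_le_one)
  qed
  have "(\<Sum>n. of_real (damped_coeff a b p n) * y ^ n) =
    (\<Sum>j. of_real (damped_coeff a b p (Suc j)) * y ^ Suc j)"
    using suminf_split_head[OF sm] by (simp add: damped_coeff_def)
  also have "\<dots> = damped_log a b p y"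
    unfolding damped_log_def damped_coeff_def by (simp add: mult_ac del: power_Suc of_nat_Suc)
  finally show ?thesis by simp
qed

lemma small_series_bounds:
  fixes f :: "nat \<Rightarrow> real"
  assumes "f 0 = 0" "\<And>n. 0 \<le> f n" "\<And>n. f n \<le> q ^ n" "0 \<le> q" "q < 1"
  shows "summable f" "(\<Sum>n. f n) \<le> q / (1 - q)" "\<bar>(\<Sum>n. f n) - f 1\<bar> \<le> q\<^sup>2 / (1 - q)"
proof -
  have g: "(\<lambda>n. q ^ n) sums (1 / (1 - q))" using assms by (intro geometric_sums) auto
  show s: "summable f"
    by (rule summable_comparison_test'[OF sums_summable[OF g]]) (use assms in auto)
  have s1: "(\<Sum>n. f n) = (\<Sum>n. f (Suc n))" using suminf_split_head[OF s] assms(1) by simp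
  have s2: "(\<Sum>n. f (Suc n)) = f 1 + (\<Sum>n. f (Suc (Suc n)))"
    using suminf_split_head[of "\<lambda>n. f (Suc n)"] s by (simp add: summable_Suc_iff)
  have sS: "summable (\<lambda>n. f (Suc n))" "summable (\<lambda>n. f (Suc (Suc n)))"
    using s by (simp_all add: summable_Suc_iff[of f] summable_Suc_iff[of "\<lambda>n. f (Suc n)"])
  have g1: "(\<lambda>n. q * q ^ n) sums (q * (1 / (1 - q)))" by (rule sums_mult[OF g])
  have g2: "(\<lambda>n. q\<^sup>2 * q ^ n) sums (q\<^sup>2 * (1 / (1 - q)))" by (rule sums_mult[OF g])
  have "(\<Sum>n. f (Suc n)) \<le> (\<Sum>n. q * q ^ n)"
    using assms(3)[of "Suc _"] by (intro suminf_le sS sums_summable[OF g1]) simp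
  then show "(\<Sum>n. f n) \<le> q / (1 - q)" using g1 s1 by (simp add: sums_iff)
  have "(\<Sum>n. f (Suc (Suc n))) \<le> (\<Sum>n. q\<^sup>2 * q ^ n)"
    using assms(3)[of "Suc (Suc _)"]
    by (intro suminf_le sS sums_summable[OF g2]) (simp add: power2_eq_square mult_ac)
  then show "\<bar>(\<Sum>n. f n) - f 1\<bar> \<le> q\<^sup>2 / (1 - q)"
    using g2 s1 s2 suminf_nonneg[OF sS(2)] assms(2) by (simp add: sums_iff)
qed

definition local_moment :: "complex \<times> complex \<Rightarrow> real \<Rightarrow> nat \<Rightarrow> complex" where
  "local_moment \<kappa> b p = (\<integral>u. exp (kcirc \<kappa> (damped_log (1/2) b p u)) \<partial>uniform_circle)"

text \<open>The weight that cancels the term of order \<open>1 / p\<close> in \<open>local_moment\<close>. The damping is doubled because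
  that term contains the square of the coefficient \<open>damped_coeff (1/2) b p 1\<close>.\<close>

definition local_weight :: "complex \<times> complex \<Rightarrow> real \<Rightarrow> nat \<Rightarrow> complex" where
  "local_weight \<kappa> b p = exp (- (fst \<kappa> * snd \<kappa> * damped_log 1 (2 * b) p 1))"

lemma borel_measurable_damped_log [measurable]:
  "damped_log a b p \<in> borel_measurable borel"
  unfolding damped_log_def[abs_def] by measurable

lemma borel_measurable_kcirc [measurable]:
  "kcirc \<kappa> \<in> borel_measurable borel"
proof -
  have [measurable]: "(\<lambda>u :: complex. cnj u) \<in> borel_measurable borel"
    by (intro borel_measurable_continuous_onI continuous_intros)
  show ?thesis unfolding kcirc_def[abs_def] by measurable
qed

lemma norm_kcirc_le: "norm (kcirc \<kappa> z) \<le> (norm (fst \<kappa>) + norm (snd \<kappa>)) * norm z"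
  unfolding kcirc_def by (rule order_trans[OF norm_triangle_ineq]) (simp add: norm_mult distrib_right)

lemma prime_sqrt_bounds:
  assumes "prime p"
  defines "r \<equiv> real p powr (- (1/2))"
  shows "0 < r" "r \<le> 3/4" "r / (1 - r) \<le> 4 * r" "r\<^sup>2 = 1 / real p" "1 / real p \<le> 1 / 2" "r ^ 3 = real p powr (- 3/2)"
proof -
  have p: "real p \<ge> 2" using prime_ge_2_nat[OF assms(1)] by simp
  show r0: "0 < r" using p by (simp add: r_def)
  have rr: "r * r = real p powr (- 1)" unfolding r_def by (simp flip: powr_add)
  then show r2: "r\<^sup>2 = 1 / real p"
    using p by (simp add: power2_eq_square powr_minus_divide)
  show p2: "1 / real p \<le> 1 / 2" using p by (simp add: field_simps)
  have "r\<^sup>2 \<le> (3/4)\<^sup>2" unfolding r2 using p2 by (simp add: power2_eq_square)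
  then show r34: "r \<le> 3/4" by (rule power2_le_imp_le) simp
  have "r / (1 - r) \<le> r / (1/4)" using r0 r34 by (intro divide_left_mono) auto
  then show "r / (1 - r) \<le> 4 * r" by simp
  have "r ^ 3 = real p powr (- 1) * real p powr (- (1/2))" by (simp add: power3_eq_cube rr flip: r_def)
  also have "\<dots> = real p powr (- 3/2)" unfolding powr_add[symmetric] by simp
  finally show "r ^ 3 = real p powr (- 3/2)" .
qed

text \<open>All exponents \<open>(n * ln p)\<^sup>2\<close> are at least \<open>(ln p)\<^sup>2\<close>, so one damping factor can be taken out of the
  whole series. It makes the bound summable over the primes for fixed \<open>b > 0\<close>.\<close>

lemma norm_damped_log_half_le:
  assumes "prime p" "0 \<le> b" "norm y \<le> 1"
  shows "norm (damped_log (1/2) b p y) \<le> 4 * real p powr (- (1/2)) * exp (- (b * (ln (real p))\<^sup>2))"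
proof -
  have p: "p > 0" using prime_gt_0_nat[OF assms(1)] .
  define e where "e = exp (- (b * (ln (real p))\<^sup>2))"
  define r where "r = real p powr (- (1/2))"
  note r = prime_sqrt_bounds[OF assms(1), folded r_def]
  define f where "f = (\<lambda>n. damped_coeff (1/2) b p n / e)"
  have f: "0 \<le> f n" "f n \<le> r ^ n" "f 0 = 0" for n
  proof -
    show "0 \<le> f n" using damped_coeff_bounds(1)[OF p assms(2)] by (simp add: f_def e_def)
    show "f 0 = 0" by (simp add: f_def damped_coeff_def)
    show "f n \<le> r ^ n"
    proof (cases "n = 0")
      case False
      then have "1 * (ln (real p))\<^sup>2 \<le> (real n)\<^sup>2 * (ln (real p))\<^sup>2" by (intro mult_right_mono) auto
      then have "b * (ln (real p))\<^sup>2 \<le> b * (real n * ln (real p))\<^sup>2"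
        using assms(2) by (intro mult_left_mono) (auto simp: power_mult_distrib)
      then have "exp (- (b * (real n * ln (real p))\<^sup>2)) \<le> e" by (simp add: e_def)
      then have "real p powr (- (1/2 * real n)) * exp (- (b * (real n * ln (real p))\<^sup>2)) / real n \<le>
          real p powr (- (1/2 * real n)) * e / 1"
        using False by (intro frac_le mult_left_mono) (auto simp: e_def)
      also have pe: "real p powr (- (1/2 * real n)) = r ^ n"
        using p by (simp add: r_def powr_powr flip: powr_realpow)
      finally have "damped_coeff (1/2) b p n \<le> r ^ n * e" using False by (simp only: damped_coeff_def if_False div_by_1 pe)
      then show ?thesis by (simp add: f_def e_def pos_divide_le_eq)
    qed (simp add: f_def damped_coeff_def)
  qed
  note sb = small_series_bounds[of f r, OF f(3,1,2)]
  have fe: "damped_coeff (1/2) b p n = e * f n" for n by (simp add: f_def e_def)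
  have "norm (damped_log (1/2) b p y) \<le> (\<Sum>n. e * f n)"
    unfolding damped_log_power_series[OF assms(1,2) _ assms(3), of "1/2", simplified]
  proof (rule norm_suminf_le)
    show "summable (\<lambda>n. e * f n)" using sb(1) r by (intro summable_mult) auto
    fix n
    show "norm (of_real (damped_coeff (1/2) b p n) * y ^ n) \<le> e * f n"
      using assms(3) mult_left_mono[of "norm y ^ n" 1 "damped_coeff (1/2) b p n"] damped_coeff_bounds(1)[OF p assms(2), of "1/2" n]
      unfolding fe[symmetric] by (simp add: norm_mult norm_power power_le_one)
  qed
  also have "\<dots> = e * (\<Sum>n. f n)" using sb(1) r by (intro suminf_mult) auto
  also have "\<dots> \<le> e * (4 * r)" using sb(2) r by (intro mult_left_mono) (auto simp: e_def)
  finally show ?thesis by (simp add: e_def r_def mult_ac)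
qed

lemma norm_exp_linear_remainder:
  fixes w :: complex
  shows "norm (exp w - (1 + w)) \<le> (norm w)\<^sup>2 * (1 + norm w) * exp (norm w)"
proof -
  have "norm (exp w - (1 + w)) = norm ((exp w - (1 + w + w\<^sup>2 / 2)) + w\<^sup>2 / 2)"
    by (rule arg_cong[of _ _ norm]) simp
  also have "\<dots> \<le> norm w ^ 3 * exp (norm w) + (norm w)\<^sup>2 / 2"
    by (rule norm_triangle_mono[OF norm_exp_quadratic_remainder]) (simp add: norm_power norm_divide)
  also have "(norm w)\<^sup>2 / 2 \<le> (norm w)\<^sup>2 * exp (norm w)"
  proof -
    have "(norm w)\<^sup>2 * (1 / 2) \<le> (norm w)\<^sup>2 * exp (norm w)"
    proof (rule mult_left_mono)
      have "1 \<le> exp (norm w)" by simp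
      then show "1 / 2 \<le> exp (norm w)" by linarith
    qed simp
    then show ?thesis by simp
  qed
  finally show ?thesis by (simp add: power2_eq_square power3_eq_cube algebra_simps)
qed

text \<open>Put \<open>x = \<kappa>1 * \<kappa>2 * exp (- 2 * b * (ln p)\<^sup>2) / p\<close>. Then \<open>local_moment\<close> is \<open>1 + x\<close> and \<open>local_weight\<close> is
  \<open>1 - x\<close>, both up to \<open>O(p powr (- 3/2))\<close> uniformly in \<open>b\<close>, and \<open>x\<^sup>2\<close> is of smaller order.\<close>

lemma local_factor_bound:
  "\<exists>C\<ge>0. \<forall>p b. prime p \<longrightarrow> 0 \<le> b \<longrightarrow>
     norm (local_moment \<kappa> b p * local_weight \<kappa> b p - 1) \<le> C * real p powr (- 3/2)"
proof -
  define k \<mu> where "k = norm (fst \<kappa>) + norm (snd \<kappa>)" and "\<mu> = norm (fst \<kappa> * snd \<kappa>)"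
  \<comment> \<open>the constants in the bounds for the errors of \<open>local_moment\<close> and \<open>local_weight\<close>\<close>
  define C1 where "C1 = (4 * k) ^ 3 * exp (4 * k) + 2 * \<mu>"
  define C2 where "C2 = 2 * \<mu> + (2 * \<mu>)\<^sup>2 * (1 + 2 * \<mu>) * exp (2 * \<mu>)"
  have k: "k \<ge> 0" "\<mu> \<ge> 0" by (auto simp: k_def \<mu>_def)
  have C12: "C1 \<ge> 0" "C2 \<ge> 0" using k by (auto simp: C1_def C2_def intro!: add_nonneg_nonneg mult_nonneg_nonneg)
  show ?thesis
  proof (intro exI conjI allI impI)
    show "\<mu>\<^sup>2 + C1 * (1 + \<mu> + C2) + C2 * (1 + \<mu>) \<ge> 0" using k C12 by auto
    fix p :: nat and b :: real assume p: "prime p" and b: "0 \<le> b"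
    have p0: "p > 0" using prime_gt_0_nat[OF p] .
    define r where "r = real p powr (- (1/2))"
    define q where "q = 1 / real p"
    note r = prime_sqrt_bounds[OF p, folded r_def q_def]
    have q: "0 \<le> q" "q \<le> 1/2" "q \<le> 1" using r by (auto simp: q_def)
    have q': "real p powr (- 1) = q" using p0 by (simp add: q_def powr_minus_divide)
    have q2: "q\<^sup>2 \<le> r ^ 3"
    proof -
      have "r ^ 4 = q\<^sup>2" using r(4) by (metis mult_2 numeral_Bit0 power_add power2_eq_square)
      moreover have "r ^ 4 \<le> r ^ 3" using r(1,2) by (intro power_decreasing) auto
      ultimately show ?thesis by simp
    qed
    have q1: "q\<^sup>2 / (1 - q) \<le> 2 * q\<^sup>2"
    proof -
      have "q\<^sup>2 / (1 - q) \<le> q\<^sup>2 / (1/2)" using q by (intro divide_left_mono) auto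
      then show ?thesis by simp
    qed
    define a where "a = damped_coeff (1/2) b p"
    define t where "t = damped_coeff 1 (2 * b) p 1"
    have a0: "a 0 = 0" by (simp add: a_def damped_coeff_def)
    have a1: "(a 1)\<^sup>2 = t"
    proof -
      have "(real p powr (- (1/2)))\<^sup>2 = real p powr (- 1)"
        using r(4) q' by (simp add: r_def)
      moreover have "(exp (- (b * (ln (real p))\<^sup>2)))\<^sup>2 = exp (- (2 * b * (ln (real p))\<^sup>2))"
        by (simp add: power2_eq_square flip: exp_add)
      ultimately show ?thesis by (simp add: a_def t_def damped_coeff_def power_mult_distrib)
    qed
    have tq: "0 \<le> t" "t \<le> q"
      using damped_coeff_bounds[of p "2 * b" 1 1] p0 b q' by (auto simp: t_def)
    have A: "0 \<le> (\<Sum>n. \<bar>a n\<bar>)" "(\<Sum>n. \<bar>a n\<bar>) \<le> 4 * r"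
    proof -
      have sm: "summable (\<lambda>n. \<bar>a n\<bar>)" unfolding a_def using p b by (intro summable_damped_coeff) auto
      then show "0 \<le> (\<Sum>n. \<bar>a n\<bar>)" by (rule suminf_nonneg) simp
      have "(\<Sum>n. \<bar>a n\<bar>) \<le> r / (1 - r)"
        by (rule small_series_bounds(2))
          (use a0 r damped_coeff_bounds[OF p0 b, of "1/2"] in \<open>auto simp: a_def r_def\<close>)
      then show "(\<Sum>n. \<bar>a n\<bar>) \<le> 4 * r" using r(3) by linarith
    qed
    have A2: "\<bar>(\<Sum>n. (a n)\<^sup>2) - t\<bar> \<le> 2 * q\<^sup>2"
    proof -
      have "\<bar>(\<Sum>n. (a n)\<^sup>2) - (a 1)\<^sup>2\<bar> \<le> q\<^sup>2 / (1 - q)"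
      proof (rule small_series_bounds(3))
        fix n
        have "(a n)\<^sup>2 \<le> (r ^ n)\<^sup>2"
          using damped_coeff_bounds[OF p0 b, of "1/2" n] by (intro power_mono) (auto simp: a_def r_def)
        also have "\<dots> = q ^ n" using r(4) by (metis power_mult mult.commute)
        finally show "(a n)\<^sup>2 \<le> q ^ n" .
      qed (use a0 q in auto)
      then show ?thesis using q1 a1 by simp
    qed
    define T where "T = (\<Sum>n. damped_coeff 1 (2 * b) p n)"
    have T: "\<bar>T - t\<bar> \<le> 2 * q\<^sup>2"
    proof -
      have "\<bar>T - t\<bar> \<le> q\<^sup>2 / (1 - q)" unfolding T_def t_def
        by (rule small_series_bounds(3))
          (use q damped_coeff_bounds[OF p0, of "2 * b" 1] b q' in \<open>auto simp: damped_coeff_def\<close>)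
      then show ?thesis using q1 by linarith
    qed
    have T': "damped_log 1 (2 * b) p 1 = of_real T"
    proof -
      have "damped_log 1 (2 * b) p 1 = (\<Sum>n. complex_of_real (damped_coeff 1 (2 * b) p n))"
        using damped_log_power_series[of p "2 * b" 1 1] p b by simp
      also have "\<dots> = of_real T"
        unfolding T_def using p b by (intro suminf_of_real[symmetric] summable_damped_coeff) auto
      finally show ?thesis .
    qed
    \<comment> \<open>the common term of order \<open>1 / p\<close>; \<open>e1\<close> and \<open>e2\<close> are the errors of order \<open>r ^ 3 = p powr (- 3/2)\<close>\<close>
    define x where "x = fst \<kappa> * snd \<kappa> * of_real t"
    have x: "norm x \<le> \<mu> * q" using tq k by (simp add: x_def \<mu>_def norm_mult mult_left_mono)
    have x1: "norm x \<le> \<mu>" using x mult_left_mono[of q 1 \<mu>] q k by simp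
    define e1 where "e1 = local_moment \<kappa> b p - (1 + x)"
    define e2 where "e2 = local_weight \<kappa> b p - (1 - x)"
    have e1: "norm e1 \<le> C1 * r ^ 3"
    proof -
      interpret prob_space uniform_circle by (rule prob_space_uniform_circle)
      define R where "R = k * (\<Sum>n. \<bar>a n\<bar>)"
      have R: "0 \<le> R" "R \<le> 4 * k * r"
        using A k mult_left_mono[OF A(2), of k] by (auto simp: R_def)
      have R4: "R \<le> 4 * k" using R mult_left_mono[of r 1 "4 * k"] r k by simp
      have "local_moment \<kappa> b p = (\<integral>u. exp (kcirc \<kappa> (\<Sum>n. of_real (a n) * u ^ n)) \<partial>uniform_circle)"
        unfolding local_moment_def
      proof (rule integral_cong_AE)
        show "AE u in uniform_circle. exp (kcirc \<kappa> (damped_log (1/2) b p u)) = exp (kcirc \<kappa> (\<Sum>n. of_real (a n) * u ^ n))"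
          using AE_uniform_circle
          by eventually_elim (use p b in \<open>simp add: damped_log_power_series a_def\<close>)
      qed measurable
      then have "norm (local_moment \<kappa> b p - (1 + fst \<kappa> * snd \<kappa> * of_real (\<Sum>n. (a n)\<^sup>2))) \<le> R ^ 3 * exp R"
        using circle_moment_expansion[of a \<kappa>] a0 summable_damped_coeff(2)[OF p b, of "1/2"]
        unfolding R_def k_def by (simp add: a_def)
      also have "\<dots> \<le> (4 * k * r) ^ 3 * exp (4 * k)"
        using R R4 by (intro mult_mono power_mono) auto
      finally have 1: "norm (local_moment \<kappa> b p - (1 + fst \<kappa> * snd \<kappa> * of_real (\<Sum>n. (a n)\<^sup>2))) \<le> (4 * k * r) ^ 3 * exp (4 * k)" .
      have "norm (fst \<kappa> * snd \<kappa> * of_real ((\<Sum>n. (a n)\<^sup>2) - t)) \<le> \<mu> * (2 * q\<^sup>2)"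
        unfolding norm_mult[of "fst \<kappa> * snd \<kappa>"] \<mu>_def[symmetric] norm_of_real
        using A2 k by (intro mult_left_mono) auto
      also have "\<dots> \<le> \<mu> * (2 * r ^ 3)" using q2 k by (intro mult_left_mono) auto
      finally have 2: "norm (fst \<kappa> * snd \<kappa> * of_real ((\<Sum>n. (a n)\<^sup>2) - t)) \<le> \<mu> * (2 * r ^ 3)" .
      have "e1 = (local_moment \<kappa> b p - (1 + fst \<kappa> * snd \<kappa> * of_real (\<Sum>n. (a n)\<^sup>2))) +
          fst \<kappa> * snd \<kappa> * of_real ((\<Sum>n. (a n)\<^sup>2) - t)"
        by (simp add: e1_def x_def algebra_simps)
      then have "norm e1 \<le> (4 * k * r) ^ 3 * exp (4 * k) + \<mu> * (2 * r ^ 3)"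
        using norm_triangle_mono[OF 1 2] by simp
      then show ?thesis by (simp add: C1_def power_mult_distrib algebra_simps)
    qed
    have e2: "norm e2 \<le> C2 * r ^ 3"
    proof -
      define y where "y = - (fst \<kappa> * snd \<kappa> * of_real T)"
      have "\<bar>T\<bar> \<le> 2 * q"
      proof -
        have "q * q \<le> q * (1/2)" using q by (intro mult_left_mono) auto
        then show ?thesis using T tq by (simp add: power2_eq_square)
      qed
      then have y: "norm y \<le> 2 * \<mu> * q"
        using mult_left_mono[of "\<bar>T\<bar>" "2 * q" \<mu>] k by (simp add: y_def norm_mult \<mu>_def mult_ac)
      have y1: "norm y \<le> 2 * \<mu>" using y mult_left_mono[of q 1 "2 * \<mu>"] q k by simp
      have "norm (exp y - (1 + y)) \<le> (norm y)\<^sup>2 * (1 + norm y) * exp (norm y)"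
        by (rule norm_exp_linear_remainder)
      also have "\<dots> \<le> (2 * \<mu> * q)\<^sup>2 * (1 + 2 * \<mu>) * exp (2 * \<mu>)"
        using y y1 k by (intro mult_mono power_mono) auto
      also have "\<dots> = ((2 * \<mu>)\<^sup>2 * (1 + 2 * \<mu>) * exp (2 * \<mu>)) * q\<^sup>2"
        by (simp add: power_mult_distrib)
      also have "\<dots> \<le> ((2 * \<mu>)\<^sup>2 * (1 + 2 * \<mu>) * exp (2 * \<mu>)) * r ^ 3"
        using q2 k by (intro mult_left_mono) auto
      finally have 1: "norm (exp y - (1 + y)) \<le> ((2 * \<mu>)\<^sup>2 * (1 + 2 * \<mu>) * exp (2 * \<mu>)) * r ^ 3" .
      have "norm (fst \<kappa> * snd \<kappa> * of_real (t - T)) \<le> \<mu> * (2 * q\<^sup>2)"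
        unfolding norm_mult[of "fst \<kappa> * snd \<kappa>"] \<mu>_def[symmetric] norm_of_real
        using T k by (intro mult_left_mono) (auto simp: abs_minus_commute)
      also have "\<dots> \<le> \<mu> * (2 * r ^ 3)" using q2 k by (intro mult_left_mono) auto
      finally have 2: "norm (fst \<kappa> * snd \<kappa> * of_real (t - T)) \<le> \<mu> * (2 * r ^ 3)" .
      have "e2 = (exp y - (1 + y)) + fst \<kappa> * snd \<kappa> * of_real (t - T)"
        unfolding e2_def local_weight_def T' y_def x_def by (simp add: algebra_simps)
      then have "norm e2 \<le> ((2 * \<mu>)\<^sup>2 * (1 + 2 * \<mu>) * exp (2 * \<mu>)) * r ^ 3 + \<mu> * (2 * r ^ 3)"
        using norm_triangle_mono[OF 1 2] by simp
      then show ?thesis by (simp add: C2_def algebra_simps)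
    qed
    have r31: "r ^ 3 \<le> 1" using r by (intro power_le_one) auto
    have e2': "norm e2 \<le> C2" using e2 mult_left_mono[OF r31, of C2] C12 by simp
    have "local_moment \<kappa> b p * local_weight \<kappa> b p - 1 = - (x\<^sup>2) + (e1 * (1 - x + e2) + e2 * (1 + x))"
      by (simp add: e1_def e2_def power2_eq_square algebra_simps)
    also have "norm \<dots> \<le> \<mu>\<^sup>2 * r ^ 3 + (C1 * r ^ 3 * (1 + \<mu> + C2) + C2 * r ^ 3 * (1 + \<mu>))"
    proof (intro norm_triangle_mono)
      have "norm (- (x\<^sup>2)) \<le> (\<mu> * q)\<^sup>2" using x by (simp add: norm_power power_mono)
      also have "\<dots> \<le> \<mu>\<^sup>2 * r ^ 3" using q2 by (simp add: power_mult_distrib mult_left_mono)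
      finally show "norm (- (x\<^sup>2)) \<le> \<mu>\<^sup>2 * r ^ 3" .
      have "norm (1 - x + e2) \<le> 1 + \<mu> + C2"
        by (intro norm_triangle_mono e2' order_trans[OF norm_triangle_ineq4]) (use x1 in auto)
      then show "norm (e1 * (1 - x + e2)) \<le> C1 * r ^ 3 * (1 + \<mu> + C2)"
        unfolding norm_mult using e1 C12 r by (intro mult_mono) auto
      have "norm (1 + x) \<le> 1 + \<mu>" by (intro norm_triangle_mono) (use x1 in auto)
      then show "norm (e2 * (1 + x)) \<le> C2 * r ^ 3 * (1 + \<mu>)"
        unfolding norm_mult using e2 C12 r by (intro mult_mono) auto
    qed
    finally show "norm (local_moment \<kappa> b p * local_weight \<kappa> b p - 1) \<le>
        (\<mu>\<^sup>2 + C1 * (1 + \<mu> + C2) + C2 * (1 + \<mu>)) * real p powr (- 3/2)"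
      unfolding r(6)[symmetric] by (simp add: algebra_simps)
  qed
qed

lemma damped_log_tendsto:
  assumes "prime p" "a > 0" "norm y \<le> 1"
  shows "((\<lambda>b. damped_log a b p y) \<longlongrightarrow> damped_log a 0 p y) (at_right 0)"
proof -
  have p: "p > 0" using prime_gt_0_nat[OF assms(1)] .
  have "((\<lambda>b. \<Sum>n. of_real (damped_coeff a b p n) * y ^ n) \<longlongrightarrow> (\<Sum>n. of_real (damped_coeff a 0 p n) * y ^ n)) (at_right 0)"
  proof (rule tannerys_theorem[where M = "\<lambda>n. (real p powr (- a)) ^ n", THEN conjunct2, THEN conjunct2])
    show "((\<lambda>b. of_real (damped_coeff a b p n) * y ^ n) \<longlongrightarrow> of_real (damped_coeff a 0 p n) * y ^ n) (at_right 0)" for n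
      unfolding damped_coeff_def by (cases "n = 0") (auto intro!: tendsto_eq_intros)
    have "norm (of_real (damped_coeff a b p n) * y ^ n) \<le> (real p powr (- a)) ^ n" if "b > 0" for b n
    proof -
      have "norm (of_real (damped_coeff a b p n) * y ^ n) \<le> (real p powr (- a)) ^ n * 1"
        unfolding norm_mult using damped_coeff_bounds[OF p, of b a n] that assms(3)
        by (intro mult_mono) (auto simp: norm_power power_le_one)
      then show ?thesis by simp
    qed
    then show "\<forall>\<^sub>F (n, b) in sequentially \<times>\<^sub>F at_right 0. norm (of_real (damped_coeff a b p n) * y ^ n) \<le> (real p powr (- a)) ^ n"
      unfolding eventually_prod_filter
      by (intro exI[of _ "\<lambda>_. True"] exI[of _ "\<lambda>b. b > 0"]) (auto simp: eventually_at_right_less)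
    show "summable (\<lambda>n. (real p powr (- a)) ^ n)"
      using prime_powr_less_1[OF assms(1,2)] by (intro summable_geometric) auto
  qed simp
  moreover have "\<forall>\<^sub>F b in at_right 0. (\<Sum>n. of_real (damped_coeff a b p n) * y ^ n) = damped_log a b p y"
    using eventually_at_right_less[of 0]
    by eventually_elim (use assms in \<open>simp add: damped_log_power_series\<close>)
  moreover have "(\<Sum>n. of_real (damped_coeff a 0 p n) * y ^ n) = damped_log a 0 p y"
    using assms by (simp add: damped_log_power_series)
  ultimately show ?thesis by (simp add: tendsto_cong)
qed

lemma local_moment_tendsto:
  assumes "prime p"
  shows "((\<lambda>b. local_moment \<kappa> b p) \<longlongrightarrow> local_moment \<kappa> 0 p) (at_right 0)"
proof (rule tendsto_at_right_sequentially[OF zero_less_one])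
  fix S :: "nat \<Rightarrow> real" assume S: "\<And>n. 0 < S n" "S \<longlonglongrightarrow> 0"
  interpret prob_space uniform_circle by (rule prob_space_uniform_circle)
  have fl: "filterlim S (at_right 0) sequentially"
    using S by (auto simp: filterlim_at order_less_imp_not_eq2)
  define k where "k = norm (fst \<kappa>) + norm (snd \<kappa>)"
  show "(\<lambda>n. local_moment \<kappa> (S n) p) \<longlonglongrightarrow> local_moment \<kappa> 0 p"
    unfolding local_moment_def
  proof (rule integral_dominated_convergence[where w = "\<lambda>_. exp (k * 4)"])
    show "AE u in uniform_circle. (\<lambda>n. exp (kcirc \<kappa> (damped_log (1/2) (S n) p u))) \<longlonglongrightarrow> exp (kcirc \<kappa> (damped_log (1/2) 0 p u))"
      using AE_uniform_circle
    proof eventually_elim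
      fix u :: complex assume u: "norm u = 1"
      have "(\<lambda>n. damped_log (1/2) (S n) p u) \<longlonglongrightarrow> damped_log (1/2) 0 p u"
        by (rule filterlim_compose[OF damped_log_tendsto[OF assms] fl]) (use u in auto)
      then show "(\<lambda>n. exp (kcirc \<kappa> (damped_log (1/2) (S n) p u))) \<longlonglongrightarrow> exp (kcirc \<kappa> (damped_log (1/2) 0 p u))"
        unfolding kcirc_def by (intro tendsto_intros)
    qed
    show "AE u in uniform_circle. norm (exp (kcirc \<kappa> (damped_log (1/2) (S n) p u))) \<le> exp (k * 4)" for n
      using AE_uniform_circle
    proof eventually_elim
      fix u :: complex assume u: "norm u = 1"
      have "norm (damped_log (1/2) (S n) p u) \<le> 4 * real p powr (- (1/2)) * exp (- (S n * (ln (real p))\<^sup>2))"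
        using assms S(1)[of n] u by (intro norm_damped_log_half_le) auto
      also have "\<dots> \<le> 4 * 1 * 1"
        using prime_sqrt_bounds(2)[OF assms] S(1)[of n] by (intro mult_mono) auto
      also have "\<dots> = 4" by simp
      finally have "norm (kcirc \<kappa> (damped_log (1/2) (S n) p u)) \<le> k * 4"
        unfolding k_def by (intro order_trans[OF norm_kcirc_le] mult_left_mono) auto
      then show "norm (exp (kcirc \<kappa> (damped_log (1/2) (S n) p u))) \<le> exp (k * 4)"
        by (intro order_trans[OF norm_exp]) simp
    qed
  qed measurable
qed

lemma damped_log_0:
  assumes "prime p" "a > 0" "norm y \<le> 1"
  shows "damped_log a 0 p y = - Ln (1 - y * of_real (real p powr (- a)))"
proof -
  have p: "p > 0" using prime_gt_0_nat[OF assms(1)] .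
  define v where "v = y * of_real (real p powr (- a))"
  have "norm v \<le> 1 * real p powr (- a)" unfolding v_def norm_mult using assms(3) by (intro mult_mono) auto
  then have v: "norm v < 1" using prime_powr_less_1[OF assms(1,2)] by linarith
  have "y ^ Suc j * of_real (real p powr (- (a * real (Suc j))) * exp (- (0 * (real (Suc j) * ln (real p))\<^sup>2))) = v ^ Suc j" for j
  proof -
    have "real p powr (- (a * real (Suc j))) = (real p powr (- a)) ^ Suc j"
      using p by (simp add: powr_powr del: of_nat_Suc power_Suc flip: powr_realpow)
    then show ?thesis by (simp only: v_def power_mult_distrib of_real_power) simp
  qed
  then show ?thesis
    using sums_neg_Ln_one_minus[OF v] unfolding damped_log_def v_def[symmetric] by (simp add: sums_iff)
qed

lemma sums_pochhammer_powr:
  fixes v c :: complex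
  assumes "norm v < 1"
  shows "(\<lambda>n. pochhammer c n / fact n * v ^ n) sums (exp (c * (- Ln (1 - v))))"
proof -
  have "1 - v \<noteq> 0" using assms by auto
  then have "(1 + - v) powr (- c) = exp (c * (- Ln (1 - v)))" by (simp add: powr_def)
  moreover have "((- c) gchoose n) * (- v) ^ n = pochhammer c n / fact n * v ^ n" for n
  proof -
    have "(- v) ^ n = (- 1) ^ n * v ^ n" by (rule power_minus)
    moreover have "(- 1) ^ n * (- 1) ^ n = (1 :: complex)" by (simp flip: power_mult_distrib)
    ultimately show ?thesis by (simp add: gbinomial_pochhammer)
  qed
  ultimately show ?thesis using gen_binomial_complex[of "- v" "- c"] assms by simp
qed

lemma summable_norm_pochhammer:
  fixes c :: complex and r :: real
  assumes "0 \<le> r" "r < 1"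
  shows "summable (\<lambda>n. norm (pochhammer c n / fact n * of_real r ^ n))"
proof (rule powser_insidea)
  show "summable (\<lambda>n. pochhammer c n / fact n * of_real ((r + 1) / 2) ^ n)"
    using assms by (intro sums_summable[OF sums_pochhammer_powr]) (simp add: norm_divide)
  show "norm (complex_of_real r) < norm (complex_of_real ((r + 1) / 2))"
    unfolding norm_of_real using assms by simp
qed

text \<open>Without damping, the exponential of the logarithms is \<open>(1 - v) powr (- \<kappa>1)\<close> times
  \<open>(1 - cnj v) powr (- \<kappa>2)\<close> with \<open>v = u / sqrt p\<close>. Integrating the product of the two binomial series
  over the circle leaves the products of coefficients with equal index.\<close>

lemma local_moment_0:
  assumes p: "prime p"
  shows "local_moment \<kappa> 0 p = (\<Sum>m. arith_term \<kappa> p m)" "summable (arith_term \<kappa> p)"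
proof -
  define r where "r = real p powr (- (1/2))"
  note r = prime_sqrt_bounds[OF p, folded r_def]
  define A where "A = (\<lambda>c n. pochhammer c n / fact n * complex_of_real r ^ n)"
  have A: "summable (\<lambda>n. norm (A c n))" for c unfolding A_def using r by (intro summable_norm_pochhammer) auto
  have AA: "A (fst \<kappa>) m * A (snd \<kappa>) m = arith_term \<kappa> p m" for m
  proof -
    have "complex_of_real r ^ m * complex_of_real r ^ m = (of_real (r\<^sup>2)) ^ m"
      by (simp add: power2_eq_square power_mult_distrib)
    also have "\<dots> = 1 / of_nat p ^ m" unfolding r(4) by (simp add: power_divide)
    finally show ?thesis by (simp add: A_def arith_term_def field_simps)
  qed
  have "local_moment \<kappa> 0 p = (\<integral>u. (\<Sum>m. A (fst \<kappa>) m * u ^ m) * (\<Sum>n. A (snd \<kappa>) n * cnj u ^ n) \<partial>uniform_circle)"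
    unfolding local_moment_def
  proof (rule integral_cong_AE)
    have [measurable]: "(\<lambda>u :: complex. cnj u) \<in> borel_measurable borel"
      by (intro borel_measurable_continuous_onI continuous_intros)
    show "(\<lambda>u. (\<Sum>m. A (fst \<kappa>) m * u ^ m) * (\<Sum>n. A (snd \<kappa>) n * cnj u ^ n)) \<in> borel_measurable uniform_circle"
      by measurable
    show "AE u in uniform_circle. exp (kcirc \<kappa> (damped_log (1/2) 0 p u)) =
       (\<Sum>m. A (fst \<kappa>) m * u ^ m) * (\<Sum>n. A (snd \<kappa>) n * cnj u ^ n)"
      using AE_uniform_circle
    proof eventually_elim
      fix u :: complex assume u: "norm u = 1"
      define v where "v = u * of_real r"
      have v: "norm v < 1" "norm (cnj v) < 1" using u r by (auto simp: v_def norm_mult)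
      have np: "1 - v \<notin> \<real>\<^sub>\<le>\<^sub>0"
        using v(1) complex_Re_le_cmod[of v] by (auto simp: complex_nonpos_Reals_iff)
      have D: "damped_log (1/2) 0 p u = - Ln (1 - v)"
        using damped_log_0[OF p, of "1/2" u] u by (simp add: v_def r_def)
      have "cnj (- Ln (1 - v)) = - Ln (1 - cnj v)" using cnj_Ln[OF np] by simp
      then have "exp (kcirc \<kappa> (damped_log (1/2) 0 p u)) =
          exp (fst \<kappa> * (- Ln (1 - v))) * exp (snd \<kappa> * (- Ln (1 - cnj v)))"
        unfolding D kcirc_def by (simp only: exp_add)
      also have "exp (fst \<kappa> * (- Ln (1 - v))) = (\<Sum>m. A (fst \<kappa>) m * u ^ m)"
        using sums_pochhammer_powr[OF v(1), of "fst \<kappa>"] by (simp add: sums_iff A_def v_def power_mult_distrib mult_ac)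
      also have "exp (snd \<kappa> * (- Ln (1 - cnj v))) = (\<Sum>n. A (snd \<kappa>) n * cnj u ^ n)"
        using sums_pochhammer_powr[OF v(2), of "snd \<kappa>"] by (simp add: sums_iff A_def v_def power_mult_distrib mult_ac)
      finally show "exp (kcirc \<kappa> (damped_log (1/2) 0 p u)) = (\<Sum>m. A (fst \<kappa>) m * u ^ m) * (\<Sum>n. A (snd \<kappa>) n * cnj u ^ n)" .
    qed
  qed measurable
  also have "\<dots> = (\<Sum>m. arith_term \<kappa> p m)"
    by (subst circle_double_series(1)[OF A A]) (simp add: AA)
  finally show "local_moment \<kappa> 0 p = (\<Sum>m. arith_term \<kappa> p m)" .
  have "(\<lambda>n. norm (A (snd \<kappa>) n)) \<longlonglongrightarrow> 0" by (rule summable_LIMSEQ_zero[OF A])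
  then have "\<forall>\<^sub>F n in sequentially. norm (A (snd \<kappa>) n) < 1" by (rule order_tendstoD) simp
  then have "\<forall>\<^sub>F n in sequentially. norm (arith_term \<kappa> p n) \<le> norm (A (fst \<kappa>) n)"
  proof eventually_elim
    fix n assume "norm (A (snd \<kappa>) n) < 1"
    then have "norm (A (fst \<kappa>) n) * norm (A (snd \<kappa>) n) \<le> norm (A (fst \<kappa>) n) * 1"
      by (intro mult_left_mono) auto
    then show "norm (arith_term \<kappa> p n) \<le> norm (A (fst \<kappa>) n)" by (simp add: norm_mult flip: AA)
  qed
  then show "summable (arith_term \<kappa> p)" by (rule summable_comparison_test_ev[OF _ A])
qed

lemma local_factor_0:
  assumes p: "prime p"
  shows "local_moment \<kappa> 0 p * local_weight \<kappa> 0 p = arith_local_factor \<kappa> p"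
proof -
  have p1: "real p > 1" using prime_gt_1_nat[OF p] by simp
  have "damped_log 1 (2 * 0) p 1 = - Ln (1 - 1 / of_nat p)"
    using damped_log_0[OF p, of 1 1] p1 by (simp add: powr_minus_divide)
  moreover have "1 - 1 / complex_of_nat p \<noteq> 0"
    using p1 by (auto simp: field_simps)
  moreover have "p \<noteq> Suc 0" using p1 by auto
  ultimately show ?thesis
    by (simp add: local_weight_def arith_local_factor_def powr_def local_moment_0(1)[OF p])
qed

lemma local_product_limit:
  shows "((\<lambda>b. \<Prod>p. if prime p then local_moment \<kappa> b p * local_weight \<kappa> b p else 1) \<longlongrightarrow> arith_factor \<kappa>) (at_right 0)"
    and "convergent_prod (\<lambda>p. if prime p then arith_local_factor \<kappa> p else 1)"
    and "0 < b \<Longrightarrow> convergent_prod (\<lambda>p. if prime p then local_moment \<kappa> b p * local_weight \<kappa> b p else 1)"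
proof -
  obtain C where C: "C \<ge> 0" and bd: "\<And>p b. prime p \<Longrightarrow> 0 \<le> b \<Longrightarrow>
     norm (local_moment \<kappa> b p * local_weight \<kappa> b p - 1) \<le> C * real p powr (- 3/2)"
    using local_factor_bound[of \<kappa>] by blast
  have sm: "summable (\<lambda>p. C * real p powr (- 3/2))"
    by (intro summable_mult) (simp add: summable_real_powr_iff)
  have bd': "norm ((if prime p then local_moment \<kappa> b p * local_weight \<kappa> b p else 1) - 1) \<le> C * real p powr (- 3/2)"
    if "b > 0" for p b using bd[of p b] C that by auto
  have lim: "((\<lambda>b. if prime p then local_moment \<kappa> b p * local_weight \<kappa> b p else 1) \<longlongrightarrow>
      (if prime p then arith_local_factor \<kappa> p else 1)) (at_right 0)" for p
  proof (cases "prime p")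
    case True
    have "filterlim (\<lambda>b::real. 2 * b) (at_right 0) (at_right 0)" by real_asymp
    from filterlim_compose[OF damped_log_tendsto[OF True, of 1 1] this]
    have "((\<lambda>b. local_weight \<kappa> b p) \<longlongrightarrow> local_weight \<kappa> 0 p) (at_right 0)"
      unfolding local_weight_def by (intro tendsto_intros) auto
    then have "((\<lambda>b. local_moment \<kappa> b p * local_weight \<kappa> b p) \<longlongrightarrow> local_moment \<kappa> 0 p * local_weight \<kappa> 0 p) (at_right 0)"
      by (intro tendsto_mult local_moment_tendsto True)
    then show ?thesis using True by (simp add: local_factor_0)
  qed simp
  have ev: "\<forall>\<^sub>F b in at_right 0. \<forall>p. norm ((if prime p then local_moment \<kappa> b p * local_weight \<kappa> b p else 1) - 1) \<le> C * real p powr (- 3/2)"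
    using eventually_at_right_less[of 0] by eventually_elim (intro allI bd')
  show "((\<lambda>b. \<Prod>p. if prime p then local_moment \<kappa> b p * local_weight \<kappa> b p else 1) \<longlongrightarrow> arith_factor \<kappa>) (at_right 0)"
    unfolding arith_factor_def by (rule tannery_product(1)[OF lim sm ev]) simp
  show "convergent_prod (\<lambda>p. if prime p then arith_local_factor \<kappa> p else 1)"
    by (rule tannery_product(2)[OF lim sm ev]) simp
  show "convergent_prod (\<lambda>p. if prime p then local_moment \<kappa> b p * local_weight \<kappa> b p else 1)" if "0 < b"
  proof (intro abs_convergent_prod_imp_convergent_prod summable_imp_abs_convergent_prod)
    show "summable (\<lambda>p. norm ((if prime p then local_moment \<kappa> b p * local_weight \<kappa> b p else 1) - 1))"
      by (rule summable_comparison_test'[OF sm]) (use bd'[OF that] in simp)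
  qed
qed

section \<open>Moments of the Steinhaus series\<close>

text \<open>In the completion, a function that agrees almost everywhere with a measurable one is itself
  measurable; so the expectation may be computed with an explicit version.\<close>

lemma as_expectation_eqI:
  assumes h: "integrable M h" and eq: "AE \<omega> in M. f \<omega> = h \<omega>"
  shows "as_integrable M f" "as_expectation M f = (\<integral>\<omega>. h \<omega> \<partial>M)"
proof -
  have hm: "h \<in> borel_measurable M" using h by simp
  have hm': "h \<in> borel_measurable (completion M)" using hm by (rule measurable_completion)
  have eq': "AE \<omega> in completion M. f \<omega> = h \<omega>" by (rule AE_completion[OF eq])
  have fm: "f \<in> borel_measurable (completion M)"
  proof (rule measurableI)
    fix A :: "complex set" assume A: "A \<in> sets borel"
    show "f -` A \<inter> space (completion M) \<in> sets (completion M)"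
    proof (rule completion.in_sets_AE)
      show "h -` A \<inter> space (completion M) \<in> sets (completion M)"
        by (rule measurable_sets[OF hm' A])
      show "AE \<omega> in completion M. (\<omega> \<in> h -` A \<inter> space (completion M)) = (\<omega> \<in> f -` A \<inter> space (completion M))"
        using eq' by eventually_elim auto
    qed auto
  qed simp
  have "integrable (completion M) h" using h integrable_completion[OF hm] by simp
  then show "as_integrable M f" unfolding as_integrable_def
    using integrable_cong_AE[OF fm hm' eq'] by simp
  show "as_expectation M f = (\<integral>\<omega>. h \<omega> \<partial>M)"
    unfolding as_expectation_def using integral_cong_AE[OF fm hm' eq'] integral_completion[OF hm] by simp
qed

lemma circle_linear_functional:
  assumes "norm c = 1"
  shows "(\<integral>u. Re (c * u) \<partial>uniform_circle) = 0" "AE u in uniform_circle. Re (c * u) \<in> {-1..1}"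
proof -
  interpret prob_space uniform_circle by (rule prob_space_uniform_circle)
  have i: "integrable uniform_circle (\<lambda>u. c * u)"
    by (rule integrable_const_bound[where B = 1]) (use AE_uniform_circle assms in \<open>auto simp: norm_mult\<close>)
  have e: "(\<integral>u. c * u \<partial>uniform_circle) = 0" using uniform_circle_moments(1)[of 1 0] by simp
  have "(\<integral>u. Re (c * u) \<partial>uniform_circle) = Re (\<integral>u. c * u \<partial>uniform_circle)" by (rule integral_Re[OF i])
  also have "\<dots> = 0" by (simp only: e zero_complex.sel)
  finally show "(\<integral>u. Re (c * u) \<partial>uniform_circle) = 0" .
  show "AE u in uniform_circle. Re (c * u) \<in> {-1..1}"
    using AE_uniform_circle
  proof eventually_elim
    fix u :: complex assume "norm u = 1"
    then show "Re (c * u) \<in> {-1..1}"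
      using abs_Re_le_cmod[of "c * u"] assms by (auto simp: norm_mult abs_le_iff)
  qed
qed

text \<open>Turns one-sided bounds for real random variables into a bound for the modulus.\<close>

lemma Re_rotations_bound:
  assumes "\<And>c. c \<in> {1, -1, \<i>, -\<i>} \<Longrightarrow> Re (c * z) < e"
  shows "norm z \<le> 2 * e"
proof -
  have "\<bar>Re z\<bar> < e" "\<bar>Im z\<bar> < e" using assms[of 1] assms[of "-1"] assms[of \<i>] assms[of "- \<i>"] by auto
  then show ?thesis using cmod_le[of z] by linarith
qed

text \<open>Independent random variables with uniform distribution on the circle are known as Steinhaus
  variables.\<close>

locale steinhaus = prob_space M for M :: "'a measure" +
  fixes X :: "nat \<Rightarrow> 'a \<Rightarrow> complex"
  assumes indep: "indep_vars (\<lambda>_. borel) X {p. prime p}"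
    and unif: "\<And>p. prime p \<Longrightarrow> distr M borel (X p) = uniform_circle"
begin

lemma X_measurable [measurable]: "prime p \<Longrightarrow> X p \<in> borel_measurable M"
  using indep unfolding indep_vars_def by auto

lemma expectation_X:
  fixes f :: "complex \<Rightarrow> 'b :: {banach, second_countable_topology}"
  assumes "prime p" "f \<in> borel_measurable borel"
  shows "expectation (\<lambda>\<omega>. f (X p \<omega>)) = (\<integral>u. f u \<partial>uniform_circle)"
  unfolding unif[OF assms(1), symmetric]
  by (rule integral_distr[symmetric]) (use assms in auto)

lemma AE_X:
  assumes "prime p" "AE u in uniform_circle. P u" "Measurable.pred borel P"
  shows "AE \<omega> in M. P (X p \<omega>)"
  using assms(2) unfolding unif[OF assms(1), symmetric]
  by (subst (asm) AE_distr_iff) (use assms in auto)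

lemma AE_norm_X: "AE \<omega> in M. \<forall>p. prime p \<longrightarrow> norm (X p \<omega>) = 1"
proof -
  have "AE \<omega> in M. prime p \<longrightarrow> norm (X p \<omega>) = 1" for p
    using AE_X[of p "\<lambda>u. norm u = 1"] AE_uniform_circle by (cases "prime p") auto
  then show ?thesis by (simp add: AE_all_countable)
qed

text \<open>Hoeffding's inequality for at most \<open>n\<close> centred variables with values in \<open>[-1, 1]\<close>.\<close>

lemma partial_sum_tail:
  assumes c: "norm c = 1" and n: "n \<ge> 2" and e: "\<epsilon> \<ge> 0"
  shows "prob {\<omega> \<in> space M. (\<Sum>p | p \<le> n \<and> prime p. Re (c * X p \<omega>)) \<ge> \<epsilon>} \<le> exp (- (\<epsilon>\<^sup>2 / (2 * real n)))"
proof -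
  define I where "I = {p. p \<le> n \<and> prime p}"
  define Y where "Y = (\<lambda>p \<omega>. Re (c * X p \<omega>))"
  have fin: "finite I" by (auto simp: I_def)
  have I2: "2 \<in> I" using n by (auto simp: I_def)
  have sub: "I \<subseteq> {p. prime p}" by (auto simp: I_def)
  have iv: "indep_vars (\<lambda>_. borel) Y I"
    unfolding Y_def by (rule indep_vars_compose2[OF indep_vars_subset[OF indep sub]]) measurable
  have E0: "expectation (Y p) = 0" if "p \<in> I" for p
    using expectation_X[of p "\<lambda>u. Re (c * u)"] circle_linear_functional(1)[OF c] that
    by (simp add: Y_def I_def)
  interpret B: indep_interval_bounded_random_variables M I Y "\<lambda>_. -1" "\<lambda>_. 1"
  proof unfold_locales
    show "finite I" by (rule fin)
    show "indep_vars (\<lambda>_. borel) Y I" by (rule iv)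
    show "AE \<omega> in M. Y p \<omega> \<in> {- 1..1}" if "p \<in> I" for p
      unfolding Y_def using that by (intro AE_X[OF _ circle_linear_functional(2)[OF c]]) (auto simp: I_def)
  qed
  interpret H: Hoeffding_ineq M I Y "\<lambda>_. -1" "\<lambda>_. 1" "\<Sum>p\<in>I. expectation (Y p)"
    by unfold_locales
  have cI: "card I \<ge> 1" using I2 fin by (metis One_nat_def Suc_leI card_gt_0_iff empty_iff)
  have "I \<subseteq> {1..n}" by (auto simp: I_def Suc_leI prime_gt_0_nat)
  then have cn: "card I \<le> n" using card_mono[of "{1..n}" I] by simp
  have "prob {\<omega> \<in> space M. (\<Sum>p\<in>I. Y p \<omega>) \<ge> (\<Sum>p\<in>I. expectation (Y p)) + \<epsilon>} \<le> exp (- 2 * \<epsilon>\<^sup>2 / (\<Sum>p\<in>I. (1 - (- 1))\<^sup>2))"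
    by (rule H.Hoeffding_ineq_ge) (use e cI in auto)
  also have "\<dots> \<le> exp (- (\<epsilon>\<^sup>2 / (2 * real n)))"
  proof -
    have "\<epsilon>\<^sup>2 / (2 * real n) \<le> \<epsilon>\<^sup>2 / (2 * real (card I))"
      using cI cn by (intro divide_left_mono) auto
    then show ?thesis by (simp add: field_simps)
  qed
  finally show ?thesis by (simp add: E0) (simp add: I_def Y_def)
qed

text \<open>At the level \<open>sqrt n * ln n\<close> the tail bound is \<open>exp (- (ln n)\<^sup>2 / 2)\<close>. This is summable in \<open>n\<close>, so the
  Borel--Cantelli lemma applies.\<close>

lemma AE_partial_sums_bound:
  "AE \<omega> in M. \<forall>\<^sub>F n in sequentially. norm (\<Sum>p | p \<le> n \<and> prime p. X p \<omega>) \<le> 2 * (sqrt (real n) * ln (real n))"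
proof -
  define S where "S = (\<lambda>n \<omega>. \<Sum>p | p \<le> n \<and> prime p. X p \<omega>)"
  have one: "AE \<omega> in M. \<forall>\<^sub>F n in sequentially. Re (c * S n \<omega>) < sqrt (real n) * ln (real n)" if c: "norm c = 1" for c
  proof -
    define A where "A = (\<lambda>n. {\<omega> \<in> space M. (\<Sum>p | p \<le> n \<and> prime p. Re (c * X p \<omega>)) \<ge> sqrt (real n) * ln (real n)})"
    have "AE \<omega> in M. \<forall>\<^sub>F n in sequentially. \<omega> \<in> space M - A n"
    proof (rule borel_cantelli_AE1)
      show "A n \<in> sets M" for n unfolding A_def by measurable
      show "emeasure M (A n) < \<infinity>" for n by (simp add: emeasure_eq_measure)
      show "summable (\<lambda>n. measure M (A n))"
      proof (rule summable_comparison_test_ev)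
        show "summable (\<lambda>n. exp (- ((ln (real n))\<^sup>2 / 2)))"
        proof (rule summable_comparison_test_bigo)
          show "summable (\<lambda>n. norm (1 / real n ^ 2))"
            using inverse_power_summable[of 2] by (simp add: field_simps)
          show "(\<lambda>n. exp (- ((ln (real n))\<^sup>2 / 2))) \<in> O(\<lambda>n. 1 / real n ^ 2)" by real_asymp
        qed
        show "\<forall>\<^sub>F n in sequentially. norm (measure M (A n)) \<le> exp (- ((ln (real n))\<^sup>2 / 2))"
          using eventually_ge_at_top[of 2]
        proof eventually_elim
          fix n :: nat assume n: "n \<ge> 2"
          have "measure M (A n) \<le> exp (- ((sqrt (real n) * ln (real n))\<^sup>2 / (2 * real n)))"
            unfolding A_def using n by (intro partial_sum_tail[OF c]) auto
          also have "(sqrt (real n) * ln (real n))\<^sup>2 / (2 * real n) = (ln (real n))\<^sup>2 / 2"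
            using n by (simp add: power_mult_distrib)
          finally show "norm (measure M (A n)) \<le> exp (- ((ln (real n))\<^sup>2 / 2))" by simp
        qed
      qed
    qed
    then show ?thesis
    proof eventually_elim
      fix \<omega> assume "\<forall>\<^sub>F n in sequentially. \<omega> \<in> space M - A n"
      then show "\<forall>\<^sub>F n in sequentially. Re (c * S n \<omega>) < sqrt (real n) * ln (real n)"
        by eventually_elim (auto simp: A_def S_def sum_distrib_left Re_sum)
    qed
  qed
  have "AE \<omega> in M. \<forall>\<^sub>F n in sequentially. Re (1 * S n \<omega>) < sqrt (real n) * ln (real n)"
    "AE \<omega> in M. \<forall>\<^sub>F n in sequentially. Re (- 1 * S n \<omega>) < sqrt (real n) * ln (real n)"
    "AE \<omega> in M. \<forall>\<^sub>F n in sequentially. Re (\<i> * S n \<omega>) < sqrt (real n) * ln (real n)"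
    "AE \<omega> in M. \<forall>\<^sub>F n in sequentially. Re (- \<i> * S n \<omega>) < sqrt (real n) * ln (real n)"
    by (rule one, simp)+
  then have "AE \<omega> in M. \<forall>\<^sub>F n in sequentially. norm (S n \<omega>) \<le> 2 * (sqrt (real n) * ln (real n))"
  proof eventually_elim
    fix \<omega>
    assume "\<forall>\<^sub>F n in sequentially. Re (1 * S n \<omega>) < sqrt (real n) * ln (real n)"
      "\<forall>\<^sub>F n in sequentially. Re (- 1 * S n \<omega>) < sqrt (real n) * ln (real n)"
      "\<forall>\<^sub>F n in sequentially. Re (\<i> * S n \<omega>) < sqrt (real n) * ln (real n)"
      "\<forall>\<^sub>F n in sequentially. Re (- \<i> * S n \<omega>) < sqrt (real n) * ln (real n)"
    then show "\<forall>\<^sub>F n in sequentially. norm (S n \<omega>) \<le> 2 * (sqrt (real n) * ln (real n))"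
      by eventually_elim (rule Re_rotations_bound, blast)
  qed
  then show ?thesis by (simp add: S_def)
qed

lemma sum_primes_if:
  fixes f :: "nat \<Rightarrow> complex"
  shows "(\<Sum>p\<le>n. if prime p then f p else 0) = (\<Sum>p | p \<le> n \<and> prime p. f p)"
  by (subst sum.inter_filter[symmetric]) auto

lemma AE_growth:
  "AE \<omega> in M. \<forall>\<theta>>1/2. \<exists>C. \<forall>n. norm (\<Sum>p\<le>n. if prime p then X p \<omega> else 0) \<le> C * real n powr \<theta>"
  using AE_partial_sums_bound
proof eventually_elim
  fix \<omega> assume ev: "\<forall>\<^sub>F n in sequentially. norm (\<Sum>p | p \<le> n \<and> prime p. X p \<omega>) \<le> 2 * (sqrt (real n) * ln (real n))"
  define A where "A = (\<lambda>n. norm (\<Sum>p | p \<le> n \<and> prime p. X p \<omega>))"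
  obtain N where N: "\<And>n. n \<ge> N \<Longrightarrow> A n \<le> 2 * (sqrt (real n) * ln (real n))"
    using ev unfolding eventually_sequentially A_def by blast
  show "\<forall>\<theta>>1/2. \<exists>C. \<forall>n. norm (\<Sum>p\<le>n. if prime p then X p \<omega> else 0) \<le> C * real n powr \<theta>"
  proof (intro allI impI)
    fix \<theta> :: real assume \<theta>: "\<theta> > 1/2"
    define \<eta> where "\<eta> = \<theta> - 1/2"
    have \<eta>: "\<eta> > 0" using \<theta> by (simp add: \<eta>_def)
    \<comment> \<open>\<open>ln n \<le> n powr \<eta> / \<eta>\<close> for the large \<open>n\<close>, the sum for the finitely many others\<close>
    define C where "C = 2 / \<eta> + (\<Sum>k<N. A k)"
    have A0: "A k \<ge> 0" for k by (simp add: A_def)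
    have "A n \<le> C * real n powr \<theta>" for n
    proof (cases "n = 0")
      case True
      then have "{p. p \<le> n \<and> prime p} = {}" by auto
      then show ?thesis unfolding A_def using True by (simp only: sum.empty norm_zero) simp
    next
      case False
      then have n: "real n \<ge> 1" by simp
      have S0: "(\<Sum>k<N. A k) \<ge> 0" by (intro sum_nonneg A0)
      show ?thesis
      proof (cases "n < N")
        case True
        then have "A n \<le> (\<Sum>k<N. A k)" by (intro member_le_sum) (auto simp: A0)
        also have "\<dots> \<le> C * 1" using \<eta> by (simp add: C_def)
        also have "\<dots> \<le> C * real n powr \<theta>"
          using n \<theta> \<eta> S0 by (intro mult_left_mono ge_one_powr_ge_zero) (auto simp: C_def)
        finally show ?thesis .
      next
        case False
        then have "A n \<le> 2 * (sqrt (real n) * ln (real n))" by (intro N) simp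
        also have "ln (real n) \<le> real n powr \<eta> / \<eta>" using n \<eta> by (intro ln_powr_bound) auto
        then have "2 * (sqrt (real n) * ln (real n)) \<le> 2 * (sqrt (real n) * (real n powr \<eta> / \<eta>))"
          by (intro mult_left_mono) auto
        also have "\<dots> = (2 / \<eta>) * (real n powr (1/2) * real n powr \<eta>)"
          using n by (simp add: powr_half_sqrt)
        also have "real n powr (1/2) * real n powr \<eta> = real n powr \<theta>"
          by (simp add: \<eta>_def flip: powr_add)
        also have "(2 / \<eta>) * real n powr \<theta> \<le> C * real n powr \<theta>"
          using S0 by (intro mult_right_mono) (auto simp: C_def)
        finally show ?thesis .
      qed
    qed
    then show "\<exists>C. \<forall>n. norm (\<Sum>p\<le>n. if prime p then X p \<omega> else 0) \<le> C * real n powr \<theta>"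
      unfolding sum_primes_if A_def by blast
  qed
qed

lemma summable_gaussian_damping:
  assumes "b > 0"
  shows "summable (\<lambda>p. 4 * real p powr (- (1/2)) * exp (- (b * (ln (real p))\<^sup>2)))"
proof (rule summable_comparison_test_bigo)
  show "summable (\<lambda>n. norm (1 / real n ^ 2))"
    using inverse_power_summable[of 2] by (simp add: field_simps)
  show "(\<lambda>p. 4 * real p powr (- (1/2)) * exp (- (b * (ln (real p))\<^sup>2))) \<in> O(\<lambda>n. 1 / real n ^ 2)"
    using assms by real_asymp
qed

text \<open>For fixed \<open>L\<close> the damping makes the series over the primes bounded by a convergent series of
  constants, so the partial products, whose expectations factor by independence, are uniformly
  bounded.\<close>

lemma expectation_rand_moment:
  assumes L: "L > 0"
  shows "as_integrable M (rand_moment_var \<kappa> X L)"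
    and "(\<lambda>N. \<Prod>p<N. if prime p then local_moment \<kappa> (1 / (2 * L)) p else 1) \<longlonglongrightarrow>
           as_expectation M (rand_moment_var \<kappa> X L)"
proof -
  define b where "b = 1 / (2 * L)"
  have b: "b > 0" using L by (simp add: b_def)
  define k where "k = norm (fst \<kappa>) + norm (snd \<kappa>)"
  define m where "m = (\<lambda>p. 4 * real p powr (- (1/2)) * exp (- (b * (ln (real p))\<^sup>2)))"
  have m: "summable m" unfolding m_def by (rule summable_gaussian_damping[OF b])
  have m0: "m p \<ge> 0" for p by (simp add: m_def)
  define g where "g = (\<lambda>p \<omega>. if prime p then damped_log (1/2) b p (X p \<omega>) else 0)"
  have gm [measurable]: "g p \<in> borel_measurable M" for p
    unfolding g_def by (cases "prime p") auto
  define h where "h = (\<lambda>\<omega>. exp (kcirc \<kappa> (\<Sum>p. g p \<omega>)))"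
  have hm [measurable]: "h \<in> borel_measurable M" unfolding h_def by measurable
  have gb: "AE \<omega> in M. \<forall>p. norm (g p \<omega>) \<le> m p"
    using AE_norm_X
    by eventually_elim (use b m0 in \<open>auto simp: g_def m_def intro!: norm_damped_log_half_le\<close>)
  have sb: "AE \<omega> in M. \<forall>N. norm (exp (kcirc \<kappa> (\<Sum>p<N. g p \<omega>))) \<le> exp (k * suminf m)"
    using gb
  proof eventually_elim
    fix \<omega> assume g: "\<forall>p. norm (g p \<omega>) \<le> m p"
    show "\<forall>N. norm (exp (kcirc \<kappa> (\<Sum>p<N. g p \<omega>))) \<le> exp (k * suminf m)"
    proof
      fix N
      have "norm (\<Sum>p<N. g p \<omega>) \<le> (\<Sum>p<N. m p)" using g by (intro sum_norm_le) auto
      also have "\<dots> \<le> suminf m" by (intro sum_le_suminf m) (auto simp: m0)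
      finally have "norm (kcirc \<kappa> (\<Sum>p<N. g p \<omega>)) \<le> k * suminf m"
        unfolding k_def by (intro order_trans[OF norm_kcirc_le] mult_left_mono) auto
      then show "norm (exp (kcirc \<kappa> (\<Sum>p<N. g p \<omega>))) \<le> exp (k * suminf m)"
        by (intro order_trans[OF norm_exp]) simp
    qed
  qed
  have lim: "AE \<omega> in M. (\<lambda>N. exp (kcirc \<kappa> (\<Sum>p<N. g p \<omega>))) \<longlonglongrightarrow> h \<omega>"
    using gb
  proof eventually_elim
    fix \<omega> assume g: "\<forall>p. norm (g p \<omega>) \<le> m p"
    have "summable (\<lambda>p. g p \<omega>)" by (rule summable_comparison_test'[OF m]) (use g in auto)
    then have "(\<lambda>N. \<Sum>p<N. g p \<omega>) \<longlonglongrightarrow> (\<Sum>p. g p \<omega>)" by (rule summable_LIMSEQ)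
    then show "(\<lambda>N. exp (kcirc \<kappa> (\<Sum>p<N. g p \<omega>))) \<longlonglongrightarrow> h \<omega>"
      unfolding h_def kcirc_def by (intro tendsto_intros)
  qed
  have ih: "integrable M h"
  proof (rule integrable_const_bound)
    show "AE \<omega> in M. norm (h \<omega>) \<le> exp (k * suminf m)"
      using sb lim
    proof eventually_elim
      fix \<omega> assume "\<forall>N. norm (exp (kcirc \<kappa> (\<Sum>p<N. g p \<omega>))) \<le> exp (k * suminf m)"
        and l: "(\<lambda>N. exp (kcirc \<kappa> (\<Sum>p<N. g p \<omega>))) \<longlonglongrightarrow> h \<omega>"
      then show "norm (h \<omega>) \<le> exp (k * suminf m)"
        by (intro LIMSEQ_le_const2[OF tendsto_norm[OF l]]) auto
    qed
  qed measurable
  have eq: "AE \<omega> in M. rand_moment_var \<kappa> X L \<omega> = h \<omega>"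
    using AE_norm_X AE_growth
  proof eventually_elim
    fix \<omega> assume n: "\<forall>p. prime p \<longrightarrow> norm (X p \<omega>) = 1"
      and gr: "\<forall>\<theta>>1/2. \<exists>C. \<forall>n. norm (\<Sum>p\<le>n. if prime p then X p \<omega> else 0) \<le> C * real n powr \<theta>"
    have "(\<lambda>p. if prime p then damped_log (1/2) (1 / (2 * L)) p (X p \<omega>) else 0) sums
       hyper_pairing (\<lambda>z. - gauss_kernel L z) (log_zeta_rand_hyper (\<lambda>p. X p \<omega>))"
      by (rule hyper_pairing_log_zeta_rand[OF _ _ L]) (use n gr in auto)
    then show "rand_moment_var \<kappa> X L \<omega> = h \<omega>"
      unfolding rand_moment_var_def h_def g_def b_def by (simp add: sums_iff)
  qed
  show "as_integrable M (rand_moment_var \<kappa> X L)" by (rule as_expectation_eqI(1)[OF ih eq])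
  have "(\<lambda>N. expectation (\<lambda>\<omega>. exp (kcirc \<kappa> (\<Sum>p<N. g p \<omega>)))) \<longlonglongrightarrow> expectation h"
  proof (rule integral_dominated_convergence[where w = "\<lambda>_. exp (k * suminf m)"])
    show "AE \<omega> in M. norm (exp (kcirc \<kappa> (\<Sum>p<N. g p \<omega>))) \<le> exp (k * suminf m)" for N
      using sb by eventually_elim auto
  qed (use lim in \<open>auto\<close>)
  moreover have "expectation (\<lambda>\<omega>. exp (kcirc \<kappa> (\<Sum>p<N. g p \<omega>))) =
      (\<Prod>p<N. if prime p then local_moment \<kappa> b p else 1)" for N
  proof -
    define F where "F = (\<lambda>p u. exp (kcirc \<kappa> (damped_log (1/2) b p u)))"
    have Fm [measurable]: "F p \<in> borel_measurable borel" for p unfolding F_def by measurable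
    have kc: "kcirc \<kappa> (sum f A) = (\<Sum>p\<in>A. kcirc \<kappa> (f p))" for f :: "nat \<Rightarrow> complex" and A
      by (simp add: kcirc_def sum.distrib sum_distrib_left cnj_sum)
    have "exp (kcirc \<kappa> (\<Sum>p<N. g p \<omega>)) = (\<Prod>p | p < N \<and> prime p. F p (X p \<omega>))" for \<omega>
    proof -
      have "(\<Sum>p<N. g p \<omega>) = (\<Sum>p | p < N \<and> prime p. damped_log (1/2) b p (X p \<omega>))"
        unfolding g_def by (subst sum.inter_filter[symmetric]) auto
      then show ?thesis by (simp add: kc exp_sum F_def)
    qed
    then have "expectation (\<lambda>\<omega>. exp (kcirc \<kappa> (\<Sum>p<N. g p \<omega>))) =
        expectation (\<lambda>\<omega>. \<Prod>p | p < N \<and> prime p. F p (X p \<omega>))" by simp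
    also have "\<dots> = (\<Prod>p | p < N \<and> prime p. expectation (\<lambda>\<omega>. F p (X p \<omega>)))"
    proof (rule indep_vars_lebesgue_integral)
      show "indep_vars (\<lambda>_. borel) (\<lambda>p \<omega>. F p (X p \<omega>)) {p. p < N \<and> prime p}"
        by (rule indep_vars_compose2[OF indep_vars_subset[OF indep]]) auto
      fix p assume p: "p \<in> {p. p < N \<and> prime p}"
      show "integrable M (\<lambda>\<omega>. F p (X p \<omega>))"
      proof (rule integrable_const_bound)
        show "AE \<omega> in M. norm (F p (X p \<omega>)) \<le> exp (k * m p)"
          using gb
        proof eventually_elim
          fix \<omega> assume gp: "\<forall>p. norm (g p \<omega>) \<le> m p"
          have "g p \<omega> = damped_log (1/2) b p (X p \<omega>)" using p by (simp add: g_def)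
          with gp have "norm (damped_log (1/2) b p (X p \<omega>)) \<le> m p" by metis
          then have "norm (kcirc \<kappa> (damped_log (1/2) b p (X p \<omega>))) \<le> k * m p"
            unfolding k_def by (intro order_trans[OF norm_kcirc_le] mult_left_mono) auto
          then show "norm (F p (X p \<omega>)) \<le> exp (k * m p)"
            unfolding F_def by (intro order_trans[OF norm_exp]) simp
        qed
        have [measurable]: "X p \<in> borel_measurable M" using p by (intro X_measurable) simp
        show "(\<lambda>\<omega>. F p (X p \<omega>)) \<in> borel_measurable M" by measurable
      qed
    qed simp
    also have "\<dots> = (\<Prod>p | p < N \<and> prime p. local_moment \<kappa> b p)"
    proof (rule prod.cong)
      fix p assume "p \<in> {p. p < N \<and> prime p}"
      then show "expectation (\<lambda>\<omega>. F p (X p \<omega>)) = local_moment \<kappa> b p"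
        unfolding local_moment_def by (subst expectation_X) (auto simp: F_def)
    qed simp
    also have "\<dots> = (\<Prod>p<N. if prime p then local_moment \<kappa> b p else 1)"
      by (subst prod.inter_filter[symmetric]) auto
    finally show ?thesis .
  qed
  ultimately show "(\<lambda>N. \<Prod>p<N. if prime p then local_moment \<kappa> (1 / (2 * L)) p else 1) \<longlonglongrightarrow>
           as_expectation M (rand_moment_var \<kappa> X L)"
    unfolding as_expectation_eqI(2)[OF ih eq] b_def by simp
qed

end

section \<open>Moments of the Gaussian series\<close>

lemma lborel_complex_eq:
  "distr (lborel \<Otimes>\<^sub>M lborel) borel (\<lambda>(x, y). Complex x y) = (lborel :: complex measure)"
proof (rule lborel_eqI[symmetric])
  have m: "(\<lambda>(x, y). Complex x y) \<in> borel_measurable (lborel \<Otimes>\<^sub>M lborel)"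
    unfolding Complex_eq by measurable
  fix l u :: complex
  assume lu: "\<And>b. b \<in> Basis \<Longrightarrow> l \<bullet> b \<le> u \<bullet> b"
  have le: "Re l \<le> Re u" "Im l \<le> Im u"
    using lu[of 1] lu[of \<i>] by (simp_all add: Basis_complex_def inner_complex_def)
  have box: "box l u = {z. Re l < Re z \<and> Re z < Re u \<and> Im l < Im z \<and> Im z < Im u}"
    by (auto simp: box_def Basis_complex_def inner_complex_def)
  have "(\<lambda>(x, y). Complex x y) -` box l u \<inter> space (lborel \<Otimes>\<^sub>M lborel) = {Re l<..<Re u} \<times> {Im l<..<Im u}"
    by (auto simp: box space_pair_measure)
  then have "emeasure (distr (lborel \<Otimes>\<^sub>M lborel) borel (\<lambda>(x, y). Complex x y)) (box l u) =
      emeasure (lborel \<Otimes>\<^sub>M lborel) ({Re l<..<Re u} \<times> {Im l<..<Im u})"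
    by (subst emeasure_distr[OF m]) auto
  also have "\<dots> = emeasure lborel {Re l<..<Re u} * emeasure lborel {Im l<..<Im u}"
    by (rule lborel.emeasure_pair_measure_Times) auto
  also have "\<dots> = ennreal (prod ((\<bullet>) (u - l)) Basis)"
    using le by (simp add: Basis_complex_def inner_complex_def ennreal_mult)
  finally show "emeasure (distr (lborel \<Otimes>\<^sub>M lborel) borel (\<lambda>(x, y). Complex x y)) (box l u) =
      ennreal (prod ((\<bullet>) (u - l)) Basis)" .
qed simp

text \<open>The density at \<open>x + \<i> y\<close> is the product of \<open>gauss_kernel 2\<close> at \<open>x\<close> and at \<open>y\<close>, so the integral
  splits into two real Gaussian integrals.\<close>

lemma has_bochner_integral_complex_gaussian:
  fixes b c :: complex
  shows "has_bochner_integral lborel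
     (\<lambda>z. std_complex_gaussian_density z *\<^sub>R exp (b * of_real (Re z) + c * of_real (Im z))) (exp ((b\<^sup>2 + c\<^sup>2) / 4))"
proof -
  define G where "G = (\<lambda>(b::complex) x. gauss_kernel 2 (complex_of_real x) * exp (b * of_real x))"
  have G: "has_bochner_integral lborel (G b) (exp (b\<^sup>2 / 4))" for b
    using has_bochner_integral_gauss_kernel_exp[of 2 b] by (simp add: G_def)
  have Gm [measurable]: "G b \<in> borel_measurable borel" for b
    unfolding G_def gauss_kernel_of_real by measurable
  define H where "H = (\<lambda>(x, y). G b x * G c y)"
  have H [measurable]: "H \<in> borel_measurable (lborel \<Otimes>\<^sub>M lborel)" unfolding H_def by measurable
  have int: "integrable (lborel \<Otimes>\<^sub>M lborel) H"
  proof (rule lborel_pair.Fubini_integrable)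
    show "H \<in> borel_measurable (lborel \<Otimes>\<^sub>M lborel)" by (rule H)
    have "integrable lborel (\<lambda>x. norm (G b x) * (\<integral>y. norm (G c y) \<partial>lborel))"
      using G[of b] by (intro integrable_mult_left integrable_norm) (simp add: has_bochner_integral_iff)
    then show "integrable lborel (\<lambda>x. \<integral>y. norm (H (x, y)) \<partial>lborel)"
      by (simp add: H_def norm_mult)
    show "AE x in lborel. integrable lborel (\<lambda>y. H (x, y))"
      using G[of c] by (auto simp: H_def has_bochner_integral_iff)
  qed
  have val: "integral\<^sup>L (lborel \<Otimes>\<^sub>M lborel) H = exp (b\<^sup>2 / 4) * exp (c\<^sup>2 / 4)"
  proof -
    have "integral\<^sup>L (lborel \<Otimes>\<^sub>M lborel) H = (\<integral>x. \<integral>y. H (x, y) \<partial>lborel \<partial>lborel)"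
      by (rule lborel_pair.integral_fst'[OF int, symmetric])
    then show ?thesis using G[of b] G[of c] by (simp add: H_def has_bochner_integral_iff)
  qed
  define f where "f = (\<lambda>z. std_complex_gaussian_density z *\<^sub>R exp (b * of_real (Re z) + c * of_real (Im z)))"
  have fH: "f (Complex x y) = H (x, y)" for x y
  proof -
    have "std_complex_gaussian_density (Complex x y) = (sqrt (2 / (2 * pi)) * exp (- 2 * x\<^sup>2 / 2)) * (sqrt (2 / (2 * pi)) * exp (- 2 * y\<^sup>2 / 2))"
    proof -
      have "exp (- (norm (Complex x y))\<^sup>2) = exp (- x\<^sup>2) * exp (- y\<^sup>2)"
        by (simp add: cmod_power2 flip: exp_add)
      moreover have "1 / pi = sqrt (1 / pi) * sqrt (1 / pi)" by simp
      ultimately show ?thesis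
        unfolding std_complex_gaussian_density_def by (simp add: field_simps)
    qed
    then show ?thesis
      unfolding f_def H_def G_def gauss_kernel_of_real
      by (simp add: scaleR_conv_of_real exp_add mult_ac)
  qed
  have fm [measurable]: "f \<in> borel_measurable borel"
    unfolding f_def std_complex_gaussian_density_def by measurable
  have Cm: "(\<lambda>(x, y). Complex x y) \<in> borel_measurable (lborel \<Otimes>\<^sub>M lborel)"
    unfolding Complex_eq by measurable
  have "integrable lborel f"
    unfolding lborel_complex_eq[symmetric]
    by (subst integrable_distr_eq[OF Cm fm]) (use int in \<open>simp add: case_prod_beta' fH\<close>)
  moreover have "integral\<^sup>L lborel f = exp (b\<^sup>2 / 4) * exp (c\<^sup>2 / 4)"
    unfolding lborel_complex_eq[symmetric] val[symmetric]
    by (subst integral_distr[OF Cm fm]) (simp add: case_prod_beta' fH)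
  moreover have "exp (b\<^sup>2 / 4) * exp (c\<^sup>2 / 4) = exp ((b\<^sup>2 + c\<^sup>2) / 4)"
    by (simp add: add_divide_distrib flip: exp_add)
  ultimately show ?thesis unfolding f_def by (simp add: has_bochner_integral_iff)
qed

locale complex_gaussians = prob_space N for N :: "'b measure" +
  fixes W :: "nat \<Rightarrow> 'b \<Rightarrow> complex"
  assumes indep: "indep_vars (\<lambda>_. borel) W {1..}"
    and gauss: "\<And>k. k \<ge> 1 \<Longrightarrow> distributed N lborel (W k) (\<lambda>z. ennreal (std_complex_gaussian_density z))"
begin

lemma W_measurable [measurable]: "W (Suc k) \<in> borel_measurable N"
  using indep unfolding indep_vars_def by auto

lemma has_bochner_integral_exp_linear:
  fixes b c :: complex
  shows "has_bochner_integral N (\<lambda>\<omega>. exp (b * of_real (Re (W (Suc k) \<omega>)) + c * of_real (Im (W (Suc k) \<omega>)))) (exp ((b\<^sup>2 + c\<^sup>2) / 4))"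
proof -
  define f where "f = (\<lambda>z. exp (b * of_real (Re z) + c * of_real (Im z)))"
  have [measurable]: "f \<in> borel_measurable borel" unfolding f_def by measurable
  have d: "distr N lborel (W (Suc k)) = density lborel (\<lambda>z. ennreal (std_complex_gaussian_density z))"
    using gauss[of "Suc k"] by (simp add: distributed_def)
  have dm: "std_complex_gaussian_density \<in> borel_measurable lborel"
    unfolding std_complex_gaussian_density_def[abs_def] by measurable
  have pos: "0 \<le> std_complex_gaussian_density z" for z by (simp add: std_complex_gaussian_density_def)
  note I = has_bochner_integral_complex_gaussian[of b c, folded f_def, unfolded has_bochner_integral_iff]
  have fold: "(\<lambda>z. std_complex_gaussian_density z *\<^sub>R exp (b * of_real (Re z) + c * of_real (Im z))) = (\<lambda>z. std_complex_gaussian_density z *\<^sub>R f z)"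
    by (simp add: f_def)
  have "integrable (distr N lborel (W (Suc k))) f"
    unfolding d using I pos dm unfolding fold by (subst integrable_density) auto
  then have 1: "integrable N (\<lambda>\<omega>. f (W (Suc k) \<omega>))"
    by (subst (asm) integrable_distr_eq) auto
  have "(\<integral>\<omega>. f (W (Suc k) \<omega>) \<partial>N) = (\<integral>z. f z \<partial>distr N lborel (W (Suc k)))"
    by (rule integral_distr[symmetric]) auto
  also have "\<dots> = exp ((b\<^sup>2 + c\<^sup>2) / 4)"
    unfolding d using I pos dm unfolding fold by (subst integral_density) auto
  finally show ?thesis using 1 by (simp add: has_bochner_integral_iff f_def)
qed

text \<open>Since \<open>exp (T * norm w)\<close> is at most the sum of \<open>exp (\<plusminus> T * Re w \<plusminus> T * Im w)\<close> over the four choices of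
  signs, four Gaussian integrals bound it.\<close>

lemma exp_norm_W:
  assumes "T \<ge> 0"
  shows "integrable N (\<lambda>\<omega>. exp (T * norm (W (Suc k) \<omega>)))"
    and "expectation (\<lambda>\<omega>. exp (T * norm (W (Suc k) \<omega>))) \<le> 4 * exp (T\<^sup>2 / 2)"
proof -
  define D where "D = (\<lambda>s t \<omega>. exp (s * T * Re (W (Suc k) \<omega>) + t * T * Im (W (Suc k) \<omega>)))"
  have D: "has_bochner_integral N (D s t) (exp (T\<^sup>2 / 2))" if "s\<^sup>2 = 1" "t\<^sup>2 = 1" for s t
  proof -
    have "has_bochner_integral N (\<lambda>\<omega>. Re (exp (of_real (s * T) * of_real (Re (W (Suc k) \<omega>)) + of_real (t * T) * of_real (Im (W (Suc k) \<omega>)))))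
       (Re (exp (((of_real (s * T))\<^sup>2 + (of_real (t * T))\<^sup>2) / 4)))"
      by (intro has_bochner_integral_Re has_bochner_integral_exp_linear)
    moreover have "((complex_of_real (s * T))\<^sup>2 + (of_real (t * T))\<^sup>2) / 4 = of_real (T\<^sup>2 / 2)"
      using that by (simp add: power_mult_distrib flip: of_real_power)
    moreover have "of_real (s * T) * of_real (Re w) + of_real (t * T) * of_real (Im w) = complex_of_real (s * T * Re w + t * T * Im w)" for w
      by simp
    ultimately show ?thesis unfolding D_def by (simp only: exp_of_real Re_complex_of_real)
  qed
  define U where "U = (\<lambda>\<omega>. D 1 1 \<omega> + D 1 (-1) \<omega> + D (-1) 1 \<omega> + D (-1) (-1) \<omega>)"
  have U: "has_bochner_integral N U (exp (T\<^sup>2 / 2) + exp (T\<^sup>2 / 2) + exp (T\<^sup>2 / 2) + exp (T\<^sup>2 / 2))"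
    unfolding U_def by (intro has_bochner_integral_add D) auto
  have le: "exp (T * norm (W (Suc k) \<omega>)) \<le> U \<omega>" for \<omega>
  proof -
    define x y where "x = T * Re (W (Suc k) \<omega>)" and "y = T * Im (W (Suc k) \<omega>)"
    have "T * norm (W (Suc k) \<omega>) \<le> T * (\<bar>Re (W (Suc k) \<omega>)\<bar> + \<bar>Im (W (Suc k) \<omega>)\<bar>)"
      by (intro mult_left_mono cmod_le assms)
    also have "\<dots> = \<bar>x\<bar> + \<bar>y\<bar>" using assms by (simp add: x_def y_def abs_mult distrib_left)
    finally have "exp (T * norm (W (Suc k) \<omega>)) \<le> exp \<bar>x\<bar> * exp \<bar>y\<bar>" by (simp flip: exp_add)
    also have "\<dots> \<le> (exp x + exp (- x)) * (exp y + exp (- y))"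
      by (intro mult_mono) (auto simp: abs_if)
    also have "\<dots> = U \<omega>"
      by (simp add: U_def D_def x_def y_def algebra_simps flip: exp_add)
    finally show ?thesis .
  qed
  show "integrable N (\<lambda>\<omega>. exp (T * norm (W (Suc k) \<omega>)))"
    by (rule Bochner_Integration.integrable_bound[where f = U])
      (use U le in \<open>auto simp: has_bochner_integral_iff intro!: AE_I2 order_trans[OF le abs_ge_self]\<close>)
  then have "expectation (\<lambda>\<omega>. exp (T * norm (W (Suc k) \<omega>))) \<le> expectation U"
    using U le by (intro integral_mono) (auto simp: has_bochner_integral_iff)
  also have "\<dots> = 4 * exp (T\<^sup>2 / 2)" using U by (simp add: has_bochner_integral_iff)
  finally show "expectation (\<lambda>\<omega>. exp (T * norm (W (Suc k) \<omega>))) \<le> 4 * exp (T\<^sup>2 / 2)" .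
qed

text \<open>Markov's inequality for \<open>exp (norm W)\<close> gives exponentially small tails, and the Borel--Cantelli
  lemma applies.\<close>

lemma AE_linear_bound: "AE \<omega> in N. \<exists>C. \<forall>k. norm (W (Suc k) \<omega>) \<le> C * real (Suc k)"
proof -
  define A where "A = (\<lambda>k. {\<omega> \<in> space N. exp (norm (W (Suc k) \<omega>)) \<ge> exp (real (Suc k))})"
  have "AE \<omega> in N. \<forall>\<^sub>F k in sequentially. \<omega> \<in> space N - A k"
  proof (rule borel_cantelli_AE1)
    show "A k \<in> sets N" for k unfolding A_def by measurable
    show "emeasure N (A k) < \<infinity>" for k by (simp add: emeasure_eq_measure)
    show "summable (\<lambda>k. measure N (A k))"
    proof (rule summable_comparison_test')
      show "summable (\<lambda>k. (4 * exp (1/2) * exp (-1)) * exp (- 1) ^ k :: real)"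
        by (intro summable_mult summable_geometric) simp
      fix k
      have "measure N (A k) \<le> expectation (\<lambda>\<omega>. exp (norm (W (Suc k) \<omega>))) / exp (real (Suc k))"
        unfolding A_def using exp_norm_W(1)[of 1 k] by (intro integral_Markov_inequality_measure[where A = "{}"]) auto
      also have "\<dots> \<le> 4 * exp (1/2) / exp (real (Suc k))"
        using exp_norm_W(2)[of 1 k] by (intro divide_right_mono) auto
      also have "\<dots> = (4 * exp (1/2) * exp (-1)) * exp (- 1) ^ k"
        by (simp add: exp_minus exp_of_nat_mult[symmetric] field_simps flip: exp_add)
      finally show "norm (measure N (A k)) \<le> (4 * exp (1/2) * exp (-1)) * exp (- 1) ^ k" by simp
    qed
  qed
  then show ?thesis
  proof eventually_elim
    fix \<omega> assume "\<forall>\<^sub>F k in sequentially. \<omega> \<in> space N - A k"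
    then obtain K where K': "\<forall>k\<ge>K. \<omega> \<in> space N - A k"
      unfolding eventually_sequentially by blast
    have K: "norm (W (Suc k) \<omega>) < real (Suc k)" if "k \<ge> K" for k
      using K'[rule_format, OF that] by (auto simp: A_def not_le simp del: of_nat_Suc)
    define C where "C = 1 + (\<Sum>k<K. norm (W (Suc k) \<omega>))"
    have S0: "(\<Sum>k<K. norm (W (Suc k) \<omega>)) \<ge> 0" by (intro sum_nonneg) auto
    have "norm (W (Suc k) \<omega>) \<le> C * real (Suc k)" for k
    proof (cases "k < K")
      case True
      then have "norm (W (Suc k) \<omega>) \<le> (\<Sum>k<K. norm (W (Suc k) \<omega>))"
        by (intro member_le_sum[of k "{..<K}" "\<lambda>k. norm (W (Suc k) \<omega>)"]) auto
      also have "\<dots> \<le> C * 1" by (simp add: C_def)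
      also have "\<dots> \<le> C * real (Suc k)" using S0 by (intro mult_left_mono) (auto simp: C_def)
      finally show ?thesis .
    next
      case False
      then have "norm (W (Suc k) \<omega>) \<le> 1 * real (Suc k)" using K[of k] by simp
      also have "\<dots> \<le> C * real (Suc k)" using S0 by (intro mult_right_mono) (auto simp: C_def)
      finally show ?thesis .
    qed
    then show "\<exists>C. \<forall>k. norm (W (Suc k) \<omega>) \<le> C * real (Suc k)" by blast
  qed
qed

text \<open>By convexity of the exponential function, with weights \<open>b k / T\<close>, the exponential of the sum is at
  most a weighted mean of the variables \<open>exp (T * norm (W (Suc k)))\<close>. The resulting bound depends only on the
  total weight \<open>T\<close>, hence is uniform in \<open>n\<close>.\<close>

lemma exp_sum_norm_W:
  fixes b :: "nat \<Rightarrow> real"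
  assumes b: "\<And>k. b k > 0" and B: "(\<Sum>k<Suc n. b k) \<le> B"
  shows "integrable N (\<lambda>\<omega>. exp (\<Sum>k<Suc n. b k * norm (W (Suc k) \<omega>)))"
    and "expectation (\<lambda>\<omega>. exp (\<Sum>k<Suc n. b k * norm (W (Suc k) \<omega>))) \<le> 4 * exp (B\<^sup>2 / 2)"
proof -
  define T where "T = (\<Sum>k<Suc n. b k)"
  have T: "T > 0" unfolding T_def using b by (intro sum_pos) auto
  define V where "V = (\<lambda>\<omega>. \<Sum>k<Suc n. (b k / T) * exp (T * norm (W (Suc k) \<omega>)))"
  have V: "integrable N V"
    unfolding V_def using T by (intro Bochner_Integration.integrable_sum integrable_mult_right exp_norm_W) auto
  have le: "exp (\<Sum>k<Suc n. b k * norm (W (Suc k) \<omega>)) \<le> V \<omega>" for \<omega>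
  proof -
    have "exp (\<Sum>k<Suc n. (b k / T) *\<^sub>R (T * norm (W (Suc k) \<omega>))) \<le> (\<Sum>k<Suc n. (b k / T) * exp (T * norm (W (Suc k) \<omega>)))"
    proof (rule convex_on_sum[where C = UNIV])
      show "convex_on UNIV (exp :: real \<Rightarrow> real)" by (rule exp_convex)
      show "(\<Sum>k<Suc n. b k / T) = 1" using T unfolding sum_divide_distrib[symmetric] T_def[symmetric] by simp
    qed (use T b in \<open>auto simp: less_imp_le\<close>)
    then show ?thesis using T by (simp add: V_def)
  qed
  show i: "integrable N (\<lambda>\<omega>. exp (\<Sum>k<Suc n. b k * norm (W (Suc k) \<omega>)))"
  proof (rule Bochner_Integration.integrable_bound[OF V])
    show "AE \<omega> in N. norm (exp (\<Sum>k<Suc n. b k * norm (W (Suc k) \<omega>))) \<le> norm (V \<omega>)"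
      unfolding real_norm_def abs_exp_cancel by (intro AE_I2 order_trans[OF le abs_ge_self])
  qed measurable
  have "expectation (\<lambda>\<omega>. exp (\<Sum>k<Suc n. b k * norm (W (Suc k) \<omega>))) \<le> expectation V"
    by (rule integral_mono[OF i V le])
  also have "\<dots> = (\<Sum>k<Suc n. (b k / T) * expectation (\<lambda>\<omega>. exp (T * norm (W (Suc k) \<omega>))))"
    unfolding V_def using T by (subst Bochner_Integration.integral_sum) (auto intro!: exp_norm_W integrable_mult_right)
  also have "\<dots> \<le> (\<Sum>k<Suc n. (b k / T) * (4 * exp (B\<^sup>2 / 2)))"
  proof (intro sum_mono mult_left_mono)
    fix k
    have "expectation (\<lambda>\<omega>. exp (T * norm (W (Suc k) \<omega>))) \<le> 4 * exp (T\<^sup>2 / 2)"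
      using T by (intro exp_norm_W) auto
    also have "\<dots> \<le> 4 * exp (B\<^sup>2 / 2)" using B T by (auto simp: T_def intro!: power_mono)
    finally show "expectation (\<lambda>\<omega>. exp (T * norm (W (Suc k) \<omega>))) \<le> 4 * exp (B\<^sup>2 / 2)" .
    show "0 \<le> b k / T" using T b[of k] by simp
  qed
  also have "\<dots> = 4 * exp (B\<^sup>2 / 2)"
  proof -
    have "(\<Sum>k<Suc n. b k / T) = 1" using T unfolding sum_divide_distrib[symmetric] T_def[symmetric] by simp
    then show ?thesis unfolding sum_distrib_right[symmetric] by simp
  qed
  finally show "expectation (\<lambda>\<omega>. exp (\<Sum>k<Suc n. b k * norm (W (Suc k) \<omega>))) \<le> 4 * exp (B\<^sup>2 / 2)" .
qed

lemma summable_linear_times_gaussian: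
  assumes "L > 0"
  shows "summable (\<lambda>j. real (Suc j) * exp (- (real (Suc j))\<^sup>2 / (2 * L)))"
proof (rule summable_comparison_test_bigo)
  show "summable (\<lambda>n. norm (1 / real n ^ 2))"
    using inverse_power_summable[of 2] by (simp add: field_simps)
  show "(\<lambda>j. real (Suc j) * exp (- (real (Suc j))\<^sup>2 / (2 * L))) \<in> O(\<lambda>n. 1 / real n ^ 2)"
    using assms by real_asymp
qed

text \<open>For real \<open>a\<close> the expectation of \<open>exp (\<kappa>1 * a * W + \<kappa>2 * a * cnj W)\<close> is \<open>exp (\<kappa>1 * \<kappa>2 * a\<^sup>2)\<close>. The
  partial sums are majorized by the exponential of the full sum of \<open>k * a j * norm (W (Suc j))\<close>, which is integrable by
  monotone convergence and \<open>exp_sum_norm_W\<close>.\<close>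

lemma expectation_gauss_moment:
  assumes L: "L > 0"
  shows "as_integrable N (gauss_moment_var \<kappa> W L)"
    and "as_expectation N (gauss_moment_var \<kappa> W L) =
      exp (fst \<kappa> * snd \<kappa> * (\<Sum>j. of_real (exp (- (1 / L * (real (Suc j))\<^sup>2)) / real (Suc j))))"
proof -
  \<comment> \<open>the summand 1 makes \<open>k\<close> positive also for \<open>\<kappa> = 0\<close>, as \<open>exp_sum_norm_W\<close> requires\<close>
  define k where "k = norm (fst \<kappa>) + norm (snd \<kappa>) + 1"
  have k: "k > 0" by (auto simp: k_def intro!: add_nonneg_pos)
  define a where "a = (\<lambda>j. exp (- (real (Suc j))\<^sup>2 / (2 * L)) / sqrt (real (Suc j)))"
  have a0: "a j > 0" for j by (simp add: a_def)
  define l where "l = (\<lambda>j. real (Suc j) * exp (- (real (Suc j))\<^sup>2 / (2 * L)))"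
  have l: "summable l" unfolding l_def by (rule summable_linear_times_gaussian[OF L])
  have al: "real (Suc j) * a j \<le> l j" for j
  proof -
    have "exp (- (real (Suc j))\<^sup>2 / (2 * L)) / sqrt (real (Suc j)) \<le> exp (- (real (Suc j))\<^sup>2 / (2 * L)) / 1"
      by (intro divide_left_mono) auto
    then show ?thesis unfolding a_def l_def by (intro mult_left_mono) auto
  qed
  have sa: "summable a"
  proof (rule summable_comparison_test'[OF l])
    fix j
    have "1 * a j \<le> real (Suc j) * a j" using a0[of j] by (intro mult_right_mono) auto
    then have "a j \<le> l j" using al[of j] by linarith
    then show "norm (a j) \<le> l j" using a0[of j] by simp
  qed
  define b where "b = (\<lambda>j. k * a j)"
  have b: "b j > 0" "summable b" for j using k a0 sa by (auto simp: b_def intro: summable_mult)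
  define S where "S = (\<lambda>n \<omega>. \<Sum>j<n. of_real (a j) * W (Suc j) \<omega>)"
  define h where "h = (\<lambda>\<omega>. exp (kcirc \<kappa> (\<Sum>j. of_real (a j) * W (Suc j) \<omega>)))"
  define Dn where "Dn = (\<lambda>n \<omega>. exp (\<Sum>j<Suc n. b j * norm (W (Suc j) \<omega>)))"
  define D where "D = (\<lambda>\<omega>. exp (\<Sum>j. b j * norm (W (Suc j) \<omega>)))"
  have [measurable]: "S n \<in> borel_measurable N" for n unfolding S_def by measurable
  have hm [measurable]: "h \<in> borel_measurable N" unfolding h_def by measurable
  have Dm [measurable]: "D \<in> borel_measurable N" unfolding D_def by measurable
  have conv: "AE \<omega> in N. summable (\<lambda>j. b j * norm (W (Suc j) \<omega>))"
    using AE_linear_bound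
  proof eventually_elim
    fix \<omega> assume "\<exists>C. \<forall>k. norm (W (Suc k) \<omega>) \<le> C * real (Suc k)"
    then obtain C where C: "\<And>k. norm (W (Suc k) \<omega>) \<le> C * real (Suc k)" by blast
    have C0: "C \<ge> 0" using order_trans[OF norm_ge_zero C[of 0]] by simp
    show "summable (\<lambda>j. b j * norm (W (Suc j) \<omega>))"
    proof (rule summable_comparison_test'[OF summable_mult[OF l, of "k * C"]])
      fix j
      have "b j * norm (W (Suc j) \<omega>) \<le> b j * (C * real (Suc j))"
        using b(1)[of j] by (intro mult_left_mono C) auto
      also have "\<dots> = (k * C) * (real (Suc j) * a j)" by (simp add: b_def)
      also have "\<dots> \<le> (k * C) * l j" using k C0 by (intro mult_left_mono al) auto
      finally show "norm (b j * norm (W (Suc j) \<omega>)) \<le> (k * C) * l j"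
        using b(1)[of j] by (simp add: abs_mult)
    qed
  qed
  have iD: "integrable N D"
  proof -
    have iDn: "integrable N (Dn n)" and eDn: "expectation (Dn n) \<le> 4 * exp ((suminf b)\<^sup>2 / 2)" for n
      unfolding Dn_def using b sum_le_suminf[OF b(2), of "{..<Suc n}"]
      by (intro exp_sum_norm_W; auto simp: less_imp_le)+
    have mono: "Dn n \<omega> \<le> Dn (Suc n) \<omega>" for n \<omega>
      unfolding Dn_def using b(1)[of "Suc n"] by simp
    have "incseq (\<lambda>n. expectation (Dn n))"
      by (intro incseq_SucI integral_mono iDn mono)
    then obtain x where x: "(\<lambda>n. expectation (Dn n)) \<longlonglongrightarrow> x"
      using incseq_convergent[of "\<lambda>n. expectation (Dn n)"] eDn by blast
    show ?thesis
    proof (rule integrable_monotone_convergence[OF iDn _ _ x Dm])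
      show "AE \<omega> in N. mono (\<lambda>n. Dn n \<omega>)" by (intro AE_I2 incseq_SucI mono)
      show "AE \<omega> in N. (\<lambda>n. Dn n \<omega>) \<longlonglongrightarrow> D \<omega>"
        using conv
      proof eventually_elim
        fix \<omega> assume "summable (\<lambda>j. b j * norm (W (Suc j) \<omega>))"
        then have "(\<lambda>n. \<Sum>j<n. b j * norm (W (Suc j) \<omega>)) \<longlonglongrightarrow> (\<Sum>j. b j * norm (W (Suc j) \<omega>))"
          by (rule summable_LIMSEQ)
        then have "(\<lambda>n. \<Sum>j<Suc n. b j * norm (W (Suc j) \<omega>)) \<longlonglongrightarrow> (\<Sum>j. b j * norm (W (Suc j) \<omega>))"
          by (rule LIMSEQ_Suc)
        then show "(\<lambda>n. Dn n \<omega>) \<longlonglongrightarrow> D \<omega>" unfolding Dn_def D_def by (intro tendsto_exp)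
      qed
    qed
  qed
  have dom: "AE \<omega> in N. norm (exp (kcirc \<kappa> (S n \<omega>))) \<le> D \<omega>" for n
    using conv
  proof eventually_elim
    fix \<omega> assume sm: "summable (\<lambda>j. b j * norm (W (Suc j) \<omega>))"
    have "norm (S n \<omega>) \<le> (\<Sum>j<n. a j * norm (W (Suc j) \<omega>))"
      unfolding S_def using a0 by (intro sum_norm_le) (auto simp: norm_mult less_imp_le)
    then have "norm (kcirc \<kappa> (S n \<omega>)) \<le> k * (\<Sum>j<n. a j * norm (W (Suc j) \<omega>))"
      unfolding k_def by (intro order_trans[OF norm_kcirc_le] mult_mono) auto
    also have "\<dots> = (\<Sum>j<n. b j * norm (W (Suc j) \<omega>))" by (simp add: b_def sum_distrib_left mult.assoc)
    also have "\<dots> \<le> (\<Sum>j. b j * norm (W (Suc j) \<omega>))"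
      using b(1) by (intro sum_le_suminf sm) (auto simp: less_imp_le)
    finally show "norm (exp (kcirc \<kappa> (S n \<omega>))) \<le> D \<omega>"
      unfolding D_def by (intro order_trans[OF norm_exp]) simp
  qed
  have lim: "AE \<omega> in N. (\<lambda>n. exp (kcirc \<kappa> (S n \<omega>))) \<longlonglongrightarrow> h \<omega>"
    using conv
  proof eventually_elim
    fix \<omega> assume sm: "summable (\<lambda>j. b j * norm (W (Suc j) \<omega>))"
    have "summable (\<lambda>j. of_real (a j) * W (Suc j) \<omega>)"
    proof (rule summable_comparison_test'[OF summable_mult[OF sm, of "1 / k"]])
      fix j show "norm (of_real (a j) * W (Suc j) \<omega>) \<le> 1 / k * (b j * norm (W (Suc j) \<omega>))"
        using k a0[of j] by (simp add: b_def norm_mult)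
    qed
    then have "(\<lambda>n. S n \<omega>) \<longlonglongrightarrow> (\<Sum>j. of_real (a j) * W (Suc j) \<omega>)"
      unfolding S_def by (rule summable_LIMSEQ)
    then show "(\<lambda>n. exp (kcirc \<kappa> (S n \<omega>))) \<longlonglongrightarrow> h \<omega>"
      unfolding h_def kcirc_def by (intro tendsto_intros)
  qed
  have ih: "integrable N h"
    by (rule integrable_dominated_convergence[OF _ _ iD lim dom]) auto
  have Elim: "(\<lambda>n. expectation (\<lambda>\<omega>. exp (kcirc \<kappa> (S n \<omega>)))) \<longlonglongrightarrow> expectation h"
    by (rule integral_dominated_convergence[OF _ _ iD lim dom]) auto
  have a2: "(a j)\<^sup>2 = exp (- (1 / L * (real (Suc j))\<^sup>2)) / real (Suc j)" for j
  proof -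
    have "(exp (- (real (Suc j))\<^sup>2 / (2 * L)))\<^sup>2 = exp (- (1 / L * (real (Suc j))\<^sup>2))"
      using L by (simp add: power2_eq_square field_simps flip: exp_add)
    then show ?thesis by (simp add: a_def power_divide)
  qed
  have sa2: "summable (\<lambda>j. (a j)\<^sup>2)"
  proof (rule summable_comparison_test'[OF l])
    fix j
    have "a j * a j \<le> 1 * (real (Suc j) * a j)"
    proof (intro mult_mono)
      have "exp (- (real (Suc j))\<^sup>2 / (2 * L)) / sqrt (real (Suc j)) \<le> 1 / 1"
        using L by (intro frac_le) auto
      then show "a j \<le> 1" by (simp add: a_def)
      show "a j \<le> real (Suc j) * a j" using a0[of j] by simp
    qed (use a0[of j] in auto)
    then show "norm ((a j)\<^sup>2) \<le> l j" using al[of j] by (simp add: power2_eq_square)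
  qed
  have E: "expectation (\<lambda>\<omega>. exp (kcirc \<kappa> (S n \<omega>))) = exp (fst \<kappa> * snd \<kappa> * (\<Sum>j<n. of_real ((a j)\<^sup>2)))" for n
  proof -
    define F where "F = (\<lambda>j w. exp (kcirc \<kappa> (of_real (a j) * w)))"
    have Fm [measurable]: "F j \<in> borel_measurable borel" for j unfolding F_def by measurable
    have kc: "kcirc \<kappa> (sum f A) = (\<Sum>p\<in>A. kcirc \<kappa> (f p))" for f :: "nat \<Rightarrow> complex" and A
      by (simp add: kcirc_def sum.distrib sum_distrib_left cnj_sum)
    have ind: "indep_vars (\<lambda>_. borel) (\<lambda>i \<omega>. F (i - 1) (W i \<omega>)) {1..n}"
      by (rule indep_vars_compose2[OF indep_vars_subset[OF indep]]) auto
    have FE: "has_bochner_integral N (\<lambda>\<omega>. F j (W (Suc j) \<omega>)) (exp (fst \<kappa> * snd \<kappa> * of_real ((a j)\<^sup>2)))" for j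
    proof -
      define s t where "s = of_real (a j) * (fst \<kappa> + snd \<kappa>)" and "t = of_real (a j) * \<i> * (fst \<kappa> - snd \<kappa>)"
      have "kcirc \<kappa> (of_real (a j) * w) = s * of_real (Re w) + t * of_real (Im w)" for w
        by (simp add: kcirc_def s_def t_def complex_eq_iff algebra_simps)
      moreover have "(s\<^sup>2 + t\<^sup>2) / 4 = fst \<kappa> * snd \<kappa> * of_real ((a j)\<^sup>2)"
        by (simp add: s_def t_def power_mult_distrib power2_eq_square algebra_simps)
      ultimately show ?thesis
        using has_bochner_integral_exp_linear[of s j t] by (simp add: F_def)
    qed
    have "exp (kcirc \<kappa> (S n \<omega>)) = (\<Prod>i\<in>{1..n}. F (i - 1) (W i \<omega>))" for \<omega>
    proof -
      have "exp (kcirc \<kappa> (S n \<omega>)) = (\<Prod>j<n. F j (W (Suc j) \<omega>))"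
        by (simp add: S_def kc exp_sum F_def)
      also have "\<dots> = (\<Prod>i\<in>{1..n}. F (i - 1) (W i \<omega>))"
        by (rule prod.reindex_bij_witness[of _ "\<lambda>i. i - 1" Suc]) auto
      finally show ?thesis .
    qed
    then have "expectation (\<lambda>\<omega>. exp (kcirc \<kappa> (S n \<omega>))) = expectation (\<lambda>\<omega>. \<Prod>i\<in>{1..n}. F (i - 1) (W i \<omega>))" by simp
    also have "\<dots> = (\<Prod>i\<in>{1..n}. expectation (\<lambda>\<omega>. F (i - 1) (W i \<omega>)))"
    proof (rule indep_vars_lebesgue_integral[OF _ ind])
      fix i assume "i \<in> {1..n}"
      then show "integrable N (\<lambda>\<omega>. F (i - 1) (W i \<omega>))"
        using FE[of "i - 1"] by (simp add: has_bochner_integral_iff)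
    qed simp
    also have "\<dots> = (\<Prod>j<n. expectation (\<lambda>\<omega>. F j (W (Suc j) \<omega>)))"
      by (rule prod.reindex_bij_witness[of _ Suc "\<lambda>i. i - 1"]) auto
    also have "\<dots> = (\<Prod>j<n. exp (fst \<kappa> * snd \<kappa> * of_real ((a j)\<^sup>2)))"
      using FE by (simp add: has_bochner_integral_iff)
    also have "\<dots> = exp (fst \<kappa> * snd \<kappa> * (\<Sum>j<n. of_real ((a j)\<^sup>2)))"
      by (simp add: exp_sum sum_distrib_left)
    finally show ?thesis .
  qed
  have "(\<lambda>j. complex_of_real ((a j)\<^sup>2)) sums (\<Sum>j. of_real ((a j)\<^sup>2))"
    using sa2 by (intro summable_sums) (simp only: summable_of_real_iff)
  then have "(\<lambda>n. exp (fst \<kappa> * snd \<kappa> * (\<Sum>j<n. of_real ((a j)\<^sup>2)))) \<longlonglongrightarrow> exp (fst \<kappa> * snd \<kappa> * (\<Sum>j. of_real ((a j)\<^sup>2)))"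
    unfolding sums_def by (intro tendsto_intros)
  with Elim have val: "expectation h = exp (fst \<kappa> * snd \<kappa> * (\<Sum>j. of_real ((a j)\<^sup>2)))"
    unfolding E by (rule LIMSEQ_unique)
  have eq: "AE \<omega> in N. gauss_moment_var \<kappa> W L \<omega> = h \<omega>"
    using AE_linear_bound
  proof eventually_elim
    fix \<omega> assume "\<exists>C. \<forall>k. norm (W (Suc k) \<omega>) \<le> C * real (Suc k)"
    then obtain C where C: "\<And>k. norm (W (Suc k) \<omega>) \<le> C * real (Suc k)" by blast
    have "(\<lambda>j. W (Suc j) \<omega> / of_real (sqrt (real (Suc j))) * of_real (exp (- (real (Suc j))\<^sup>2 / (2 * L)))) sums
       hyper_pairing (\<lambda>z. - gauss_kernel L z) (log_Z_gauss_hyper (\<lambda>k. W k \<omega>))"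
      by (rule hyper_pairing_log_Z_gauss[OF C L])
    moreover have "W (Suc j) \<omega> / of_real (sqrt (real (Suc j))) * of_real (exp (- (real (Suc j))\<^sup>2 / (2 * L))) = of_real (a j) * W (Suc j) \<omega>" for j
      unfolding a_def of_real_divide by simp
    ultimately show "gauss_moment_var \<kappa> W L \<omega> = h \<omega>"
      unfolding gauss_moment_var_def h_def by (simp add: sums_iff)
  qed
  show "as_integrable N (gauss_moment_var \<kappa> W L)" by (rule as_expectation_eqI(1)[OF ih eq])
  show "as_expectation N (gauss_moment_var \<kappa> W L) =
      exp (fst \<kappa> * snd \<kappa> * (\<Sum>j. of_real (exp (- (1 / L * (real (Suc j))\<^sup>2)) / real (Suc j))))"
    unfolding as_expectation_eqI(2)[OF ih eq] val a2 ..
qed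

end

section \<open>The limit of the ratio\<close>

theorem theorem4p1:
  fixes \<kappa> :: "complex \<times> complex"
    and M :: "'a measure" and X :: "nat \<Rightarrow> 'a \<Rightarrow> complex"
    and N :: "'b measure" and W :: "nat \<Rightarrow> 'b \<Rightarrow> complex"
  assumes "prob_space M"
    and "prob_space.indep_vars M (\<lambda>_. borel) X {p. prime p}"
    and "\<And>p. prime p \<Longrightarrow> distr M borel (X p) = uniform_circle"
    and "prob_space N"
    and "prob_space.indep_vars N (\<lambda>_. borel) W {1..}"
    and "\<And>k. k \<ge> 1 \<Longrightarrow> distributed N lborel (W k) (\<lambda>z. ennreal (std_complex_gaussian_density z))"
  shows "(\<forall>L>0. as_integrable M (rand_moment_var \<kappa> X L)) \<and>
    (\<forall>L>0. as_integrable N (gauss_moment_var \<kappa> W L) \<and>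
           as_expectation N (gauss_moment_var \<kappa> W L) \<noteq> 0) \<and>
    (\<forall>p. prime p \<longrightarrow> summable (arith_term \<kappa> p)) \<and>
    convergent_prod (\<lambda>p. if prime p then arith_local_factor \<kappa> p else 1) \<and>
    ((\<lambda>L. as_expectation M (rand_moment_var \<kappa> X L) /
          as_expectation N (gauss_moment_var \<kappa> W L)) \<longlongrightarrow> arith_factor \<kappa>) at_top"
proof -
  interpret X: steinhaus M X
    by (intro steinhaus.intro steinhaus_axioms.intro assms)
  interpret W: complex_gaussians N W
    by (intro complex_gaussians.intro complex_gaussians_axioms.intro assms)
  define c where "c = fst \<kappa> * snd \<kappa>"
  define P where "P = (\<lambda>b. \<Prod>p. if prime p then local_moment \<kappa> b p * local_weight \<kappa> b p else 1)"
  define T where "T = (\<lambda>b p. if prime p then damped_log 1 b p 1 else 0)"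
  define H where "H = (\<lambda>b. \<Sum>j. complex_of_real (exp (- (b * (real (Suc j))\<^sup>2)) / real (Suc j)))"
  \<comment> \<open>pass the factor \<open>exp (c * \<Sum> T)\<close> from the compensated product to the Gaussian side\<close>
  have ratio: "as_expectation M (rand_moment_var \<kappa> X L) / as_expectation N (gauss_moment_var \<kappa> W L) =
      P (1 / (2 * L)) * exp (c * (suminf (T (1 / L)) - H (1 / L)))" if L: "L > 0" for L
  proof -
    have sT: "summable (T (1 / L))"
    proof -
      have "(sqrt (2 / L))\<^sup>2 / 2 = 1 / L" using L by simp
      then show ?thesis
        using smoothed_sums_line_integral[of "sqrt (2 / L)"] L unfolding T_def by (simp only:) (simp add: sums_iff)
    qed
    have "(\<lambda>n. \<Prod>p<n. if prime p then local_moment \<kappa> (1 / (2 * L)) p * local_weight \<kappa> (1 / (2 * L)) p else 1) \<longlonglongrightarrow> P (1 / (2 * L))"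
    proof -
      have "convergent_prod (\<lambda>p. if prime p then local_moment \<kappa> (1 / (2 * L)) p * local_weight \<kappa> (1 / (2 * L)) p else 1)"
        using L by (intro local_product_limit(3)) auto
      from convergent_prod_LIMSEQ[OF this] show ?thesis
        unfolding P_def by (simp add: LIMSEQ_lessThan_iff_atMost)
    qed
    moreover have "(\<lambda>n. \<Prod>p<n. if prime p then local_moment \<kappa> (1 / (2 * L)) p * local_weight \<kappa> (1 / (2 * L)) p else 1) \<longlonglongrightarrow>
       as_expectation M (rand_moment_var \<kappa> X L) * exp (- (c * suminf (T (1 / L))))"
    proof -
      have "(\<lambda>n. (\<Prod>p<n. if prime p then local_moment \<kappa> (1 / (2 * L)) p else 1) * exp (- (c * (\<Sum>p<n. T (1 / L) p)))) \<longlonglongrightarrow>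
         as_expectation M (rand_moment_var \<kappa> X L) * exp (- (c * suminf (T (1 / L))))"
        by (intro tendsto_intros X.expectation_rand_moment(2) L summable_LIMSEQ sT)
      moreover have "(\<Prod>p<n. if prime p then local_moment \<kappa> (1 / (2 * L)) p else 1) * exp (- (c * (\<Sum>p<n. T (1 / L) p))) =
          (\<Prod>p<n. if prime p then local_moment \<kappa> (1 / (2 * L)) p * local_weight \<kappa> (1 / (2 * L)) p else 1)" for n
      proof -
        have "exp (- (c * (\<Sum>p<n. T (1 / L) p))) = (\<Prod>p<n. exp (- (c * T (1 / L) p)))"
          by (simp add: sum_distrib_left exp_sum flip: sum_negf)
        then show ?thesis
          by (simp only: prod.distrib[symmetric]) (intro prod.cong, auto simp: T_def local_weight_def c_def)
      qed
      ultimately show ?thesis by simp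
    qed
    ultimately have "P (1 / (2 * L)) = as_expectation M (rand_moment_var \<kappa> X L) * exp (- (c * suminf (T (1 / L))))"
      by (rule LIMSEQ_unique)
    then have "as_expectation M (rand_moment_var \<kappa> X L) = P (1 / (2 * L)) * exp (c * suminf (T (1 / L)))"
      by (simp add: exp_minus)
    then show ?thesis
      unfolding W.expectation_gauss_moment(2)[OF L] c_def[symmetric] H_def
      by (simp add: right_diff_distrib exp_diff)
  qed
  have "filterlim (\<lambda>L::real. 1 / (2 * L)) (at_right 0) at_top" "filterlim (\<lambda>L::real. 1 / L) (at_right 0) at_top"
    by real_asymp+
  note fl = this
  have "((\<lambda>L. P (1 / (2 * L)) * exp (c * (suminf (T (1 / L)) - H (1 / L)))) \<longlongrightarrow> arith_factor \<kappa> * exp (c * 0)) at_top"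
  proof (intro tendsto_intros)
    show "((\<lambda>L. P (1 / (2 * L))) \<longlongrightarrow> arith_factor \<kappa>) at_top"
      using filterlim_compose[OF local_product_limit(1)[of \<kappa>] fl(1)] by (simp add: P_def)
    show "((\<lambda>L. suminf (T (1 / L)) - H (1 / L)) \<longlongrightarrow> 0) at_top"
      using filterlim_compose[OF smoothed_mertens fl(2)] unfolding T_def H_def .
  qed
  moreover have "\<forall>\<^sub>F L in at_top. as_expectation M (rand_moment_var \<kappa> X L) / as_expectation N (gauss_moment_var \<kappa> W L) =
      P (1 / (2 * L)) * exp (c * (suminf (T (1 / L)) - H (1 / L)))"
    using eventually_gt_at_top[of 0] by eventually_elim (rule ratio)
  ultimately have "((\<lambda>L. as_expectation M (rand_moment_var \<kappa> X L) / as_expectation N (gauss_moment_var \<kappa> W L)) \<longlongrightarrow> arith_factor \<kappa>) at_top"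
    by (simp add: tendsto_cong)
  then show ?thesis
    using X.expectation_rand_moment(1) W.expectation_gauss_moment local_product_limit(2) local_moment_0(2)
    by auto
qed

end
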